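(* Let $\mathcal{H}$ be an infinite dimensional separable complex Hilbert space and let $\mathcal{F}=\{f_i\}_{i\ge1}$ be a frame in a closed subspace $\mathcal{K}\subseteq\mathcal{H}$ such that there exists a Parseval frame quadratically close to $\{f_i\}$. Let $F$ be its synthesis operator, $F=U|F|$ the polar decomposition and $\{u_i\}=\{Ue_i\}$ the canonical Parseval frame. Assume that $n_1:=\dim\ker(F)>0$ and $n_3:=\dim\mathcal{K}^\perp>0$. Then for any integer $k$ satisfying $-\min\{n_1,n_3\}\le k\le-1$, and every partial isometry $S:\ker(F)\to\operatorname{ran}(F)^\perp$ such that $\operatorname{rank}(S)=-k$, the estimate $$\sum_{i=1}^\infty\|f_i-u_i-S(I-U^*U)e_i\|^2\le\sum_{i=1}^\infty\|f_i-x_i\|^2$$ is valid for all Parseval frames $\{x_i\}\in\mathcal{Q}_{\mathcal{F}}^k$. Thus, there are always infinitely many symmetric approximations of $\{f_i\}$ in $\mathcal{Q}_{\mathcal{F}}^k$. Moreover, all the symmetric approximations of $\{f_i\}$ in $\mathcal{Q}_{\mathcal{F}}^k$ are given by $\{u_i+S(I-U^*U)e_i\}$, where $S:\ker(F)\to\operatorname{ran}(F)^\perp$ is a partial isometry with $\operatorname{rank}(S)=-k$.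
   Context: A frame in a closed subspace $\mathcal{K}\subseteq\mathcal{H}$ is a sequence $\{f_i\}_{i\ge1}$ in $\mathcal{K}$ for which there are $A,B>0$ with $A\|f\|^2\le\sum_{i=1}^\infty|\langle f,f_i\rangle|^2\le B\|f\|^2$ for all $f\in\mathcal{K}$; it is a Parseval frame if one can take $A=B=1$. Two frames $\{f_i\}$, $\{g_i\}$ in subspaces of $\mathcal{H}$ are quadratically close if $\sum_{i=1}^\infty\|f_i-g_i\|^2<\infty$. The synthesis operator of $\{f_i\}$ is the bounded operator $F:\ell^2\to\mathcal{H}$, $F(e_i)=f_i$, with $\{e_i\}$ the standard basis of $\ell^2$; it has closed range $\mathcal{K}$, and for a Parseval frame it is a partial isometry. In the polar decomposition $F=U|F|$, $U$ is the unique partial isometry with $F=U|F|$ and $\ker(U)=\ker(F)$; thus $I-U^*U$ is the orthogonal projection onto $\ker(F)$. $\mathcal{Q}_{\mathcal{F}}$ is the set of all Parseval frames in closed subspaces of $\mathcal{H}$ that are quadratically close to $\{f_i\}$. For orthogonal projections $P,Q$ on a Hilbert space such that $QP|_{\operatorname{ran}(P)}:\operatorname{ran}(P)\to\operatorname{ran}(Q)$ is Fredholm, $j(P,Q)$ denotes the index of this operator, i.e. $j(P,Q)=\dim(\ker(Q)\cap\operatorname{ran}(P))-\dim(\operatorname{ran}(Q)\cap\ker(P))$. For $\{x_i\}\in\mathcal{Q}_{\mathcal{F}}$ with synthesis operator $X$, the index $j(U^*U,X^*X)$ is well defined. For an integer $k$, $\mathcal{Q}_{\mathcal{F}}^k=\{\{x_i\}\in\mathcal{Q}_{\mathcal{F}}: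 j(U^*U,X^*X)=k\}$. Given a nonempty family $\mathcal{Q}$ of Parseval frames in subspaces of $\mathcal{H}$, $\{y_i\}\in\mathcal{Q}$ is a symmetric approximation of $\{f_i\}$ in $\mathcal{Q}$ if $\sum_i\|f_i-y_i\|^2<\infty$ and $\sum_i\|f_i-y_i\|^2\le\sum_i\|f_i-x_i\|^2$ for all $\{x_i\}\in\mathcal{Q}$. If $\min\{n_1,n_3\}=\infty$, then $k$ may be any negative integer. *)

theory Defs
  imports "HOL-Analysis.Analysis"
begin

section \<open>Complex Hilbert spaces\<close>

text \<open>
  The complex inner product is linear in its first and conjugate linear in its second argument.
  A complex inner product space is built on top of \<^class>\<open>real_inner\<close>, whose inner product is
  required to be the real part of the complex one; hence \<open>norm x ^ 2 = cinner x x\<close>.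
\<close>

class complex_inner = real_inner +
  fixes scaleC :: "complex \<Rightarrow> 'a \<Rightarrow> 'a"  (infixr \<open>*\<^sub>C\<close> 75)
    and cinner :: "'a \<Rightarrow> 'a \<Rightarrow> complex"
  assumes scaleC_add_right: "a *\<^sub>C (x + y) = a *\<^sub>C x + a *\<^sub>C y"
    and scaleC_add_left: "(a + b) *\<^sub>C x = a *\<^sub>C x + b *\<^sub>C x"
    and scaleC_scaleC: "a *\<^sub>C b *\<^sub>C x = (a * b) *\<^sub>C x"
    and scaleC_of_real: "complex_of_real r *\<^sub>C x = r *\<^sub>R x"
    and cinner_commute: "cinner x y = cnj (cinner y x)"
    and cinner_add_left: "cinner (x + y) z = cinner x z + cinner y z"
    and cinner_scaleC_left: "cinner (a *\<^sub>C x) y = a * cinner x y"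
    and inner_eq_Re_cinner: "inner x y = Re (cinner x y)"

class complex_hilbert = complex_inner + banach

lemma scaleC_one: "1 *\<^sub>C x = (x :: 'a :: complex_inner)"
  using scaleC_of_real[of 1 x] by simp

global_interpretation complex_vector: vector_space "scaleC :: complex \<Rightarrow> 'a \<Rightarrow> 'a :: complex_inner"
  defines csubspace = complex_vector.subspace
    and cspan = complex_vector.span
    and cdependent = complex_vector.dependent
    and crepresentation = complex_vector.representation
    and cextend_basis = complex_vector.extend_basis
    and cdim = complex_vector.dim
  by unfold_locales (simp_all add: scaleC_add_right scaleC_add_left scaleC_scaleC scaleC_one)

definition finite_cdim :: "'a :: complex_inner set \<Rightarrow> bool" where
  "finite_cdim V \<longleftrightarrow> (\<exists>B. finite B \<and> V \<subseteq> cspan B)"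

text \<open>
  The dimension with values in \<open>{0, 1, \<dots>, \<infinity>}\<close>. The constant \<^const>\<open>cdim\<close> alone would not do,
  since it is \<open>0\<close> on infinite dimensional subspaces.
\<close>

definition ecdim :: "'a :: complex_inner set \<Rightarrow> enat" where
  "ecdim V = (if finite_cdim V then enat (cdim V) else \<infinity>)"

definition ortho_compl :: "'a :: complex_inner set \<Rightarrow> 'a set" where
  "ortho_compl V = {x. \<forall>v\<in>V. cinner x v = 0}"


section \<open>Operators\<close>

definition bounded_clinear :: "('a :: complex_inner \<Rightarrow> 'b :: complex_inner) \<Rightarrow> bool" where
  "bounded_clinear T \<longleftrightarrow> bounded_linear T \<and> (\<forall>c x. T (c *\<^sub>C x) = c *\<^sub>C T x)"

definition ker :: "('a :: complex_inner \<Rightarrow> 'b :: complex_inner) \<Rightarrow> 'a set" where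
  "ker T = {x. T x = 0}"

definition cadjoint :: "('a :: complex_inner \<Rightarrow> 'b :: complex_inner) \<Rightarrow> 'b \<Rightarrow> 'a" where
  "cadjoint T = (THE S. \<forall>x y. cinner (T x) y = cinner x (S y))"

definition positive_operator :: "('a :: complex_inner \<Rightarrow> 'a) \<Rightarrow> bool" where
  "positive_operator A \<longleftrightarrow>
     bounded_clinear A \<and> (\<forall>x. cinner (A x) x \<in> \<real> \<and> 0 \<le> Re (cinner (A x) x))"

text \<open>
  A partial isometry \<open>T : V \<rightarrow> W\<close> between subspaces: a bounded linear operator on \<open>V\<close> that is
  isometric on the orthogonal complement of its kernel within \<open>V\<close>. It is represented by a total
  function whose values outside \<open>V\<close> are irrelevant.
\<close>

definition partial_isometry_between ::
  "'a :: complex_inner set \<Rightarrow> 'b :: complex_inner set \<Rightarrow> ('a \<Rightarrow> 'b) \<Rightarrow> bool" where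
  "partial_isometry_between V W T \<longleftrightarrow>
     T ` V \<subseteq> W \<and>
     (\<forall>x\<in>V. \<forall>y\<in>V. T (x + y) = T x + T y) \<and>
     (\<forall>c. \<forall>x\<in>V. T (c *\<^sub>C x) = c *\<^sub>C T x) \<and>
     (\<exists>K. \<forall>x\<in>V. norm (T x) \<le> K * norm x) \<and>
     (\<forall>x \<in> V \<inter> ortho_compl (V \<inter> ker T). norm (T x) = norm x)"

abbreviation partial_isometry :: "('a :: complex_inner \<Rightarrow> 'b :: complex_inner) \<Rightarrow> bool" where
  "partial_isometry T \<equiv> partial_isometry_between UNIV UNIV T"

text \<open>\<open>F = U A\<close> is the polar decomposition of \<open>F\<close>, where \<open>A = |F|\<close> is the positive square root
  of \<open>F\<^sup>* F\<close>.\<close>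

definition polar_decomposition ::
  "('a :: complex_inner \<Rightarrow> 'b :: complex_inner) \<Rightarrow> ('a \<Rightarrow> 'b) \<Rightarrow> ('a \<Rightarrow> 'a) \<Rightarrow> bool" where
  "polar_decomposition F U A \<longleftrightarrow>
     positive_operator A \<and> A \<circ> A = cadjoint F \<circ> F \<and>
     partial_isometry U \<and> F = U \<circ> A \<and> ker U = ker F"

text \<open>The restriction of \<open>T\<close> to a Fredholm operator \<open>V \<rightarrow> W\<close>.\<close>

definition fredholm_between ::
  "'a :: complex_inner set \<Rightarrow> 'b :: complex_inner set \<Rightarrow> ('a \<Rightarrow> 'b) \<Rightarrow> bool" where
  "fredholm_between V W T \<longleftrightarrow>
     T ` V \<subseteq> W \<and> finite_cdim (V \<inter> ker T) \<and> closed (T ` V) \<and>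
     (\<exists>B. finite B \<and> B \<subseteq> W \<and> W \<subseteq> cspan (T ` V \<union> B))"

text \<open>
  The index \<open>j(P,Q)\<close> of a pair of orthogonal projections. It is meaningful only if \<open>Q P\<close> is
  Fredholm from \<open>ran P\<close> to \<open>ran Q\<close>; both dimensions are then finite.
\<close>

definition fredholm_pair :: "('a :: complex_inner \<Rightarrow> 'a) \<Rightarrow> ('a \<Rightarrow> 'a) \<Rightarrow> bool" where
  "fredholm_pair P Q \<longleftrightarrow> fredholm_between (range P) (range Q) (Q \<circ> P)"

definition pair_index :: "('a :: complex_inner \<Rightarrow> 'a) \<Rightarrow> ('a \<Rightarrow> 'a) \<Rightarrow> int" where
  "pair_index P Q = int (cdim (ker Q \<inter> range P)) - int (cdim (range Q \<inter> ker P))"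


section \<open>The Hilbert space of square summable sequences\<close>

typedef ell2 = "{x :: nat \<Rightarrow> complex. summable (\<lambda>i. (cmod (x i))\<^sup>2)}"
  morphisms coord Abs_ell2
  by (rule exI[of _ "\<lambda>_. 0"]) simp

lemma summable_coord: "summable (\<lambda>i. (cmod (coord x i))\<^sup>2)"
  using coord[of x] by simp

lemma coord_Abs_ell2: "summable (\<lambda>i. (cmod (f i))\<^sup>2) \<Longrightarrow> coord (Abs_ell2 f) = f"
  by (rule Abs_ell2_inverse) simp

lemma ell2_eqI: "(\<And>i. coord x i = coord y i) \<Longrightarrow> x = y"
  using coord_inject[of x y] by auto

lemma cmod_sum_square_le: "(cmod (a + b))\<^sup>2 \<le> 2 * (cmod a)\<^sup>2 + 2 * (cmod b)\<^sup>2"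
proof -
  have "(cmod (a + b))\<^sup>2 \<le> (cmod a + cmod b)\<^sup>2"
    by (rule power_mono[OF norm_triangle_ineq norm_ge_zero])
  also have "\<dots> \<le> 2 * (cmod a)\<^sup>2 + 2 * (cmod b)\<^sup>2"
    using zero_le_power2[of "cmod a - cmod b"] by (simp add: power2_eq_square algebra_simps)
  finally show ?thesis .
qed

lemma summable_square_add:
  assumes "summable (\<lambda>i. (cmod (f i))\<^sup>2)" "summable (\<lambda>i. (cmod (g i))\<^sup>2)"
  shows "summable (\<lambda>i. (cmod (f i + g i))\<^sup>2)"
  by (rule summable_comparison_test'[where N = 0 and
        g = "\<lambda>i. 2 * (cmod (f i))\<^sup>2 + 2 * (cmod (g i))\<^sup>2"])
     (auto intro!: summable_add summable_mult assms cmod_sum_square_le)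

lemma summable_square_mult:
  assumes "summable (\<lambda>i. (cmod (f i))\<^sup>2)"
  shows "summable (\<lambda>i. (cmod (c * f i))\<^sup>2)"
  using summable_mult[OF assms, of "(cmod c)\<^sup>2"] by (simp add: norm_mult power_mult_distrib)

lemma summable_mult_cnj:
  assumes "summable (\<lambda>i. (cmod (f i))\<^sup>2)" "summable (\<lambda>i. (cmod (g i))\<^sup>2)"
  shows "summable (\<lambda>i. f i * cnj (g i))"
proof (rule summable_comparison_test'[where N = 0 and g = "\<lambda>i. (cmod (f i))\<^sup>2 + (cmod (g i))\<^sup>2"])
  show "summable (\<lambda>i. (cmod (f i))\<^sup>2 + (cmod (g i))\<^sup>2)"
    by (rule summable_add[OF assms])
next
  fix n
  have "0 \<le> (cmod (f n) - cmod (g n))\<^sup>2" "0 \<le> cmod (f n) * cmod (g n)" by simp_all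
  hence "cmod (f n) * cmod (g n) \<le> (cmod (f n))\<^sup>2 + (cmod (g n))\<^sup>2"
    unfolding power2_diff by linarith
  thus "norm (f n * cnj (g n)) \<le> (cmod (f n))\<^sup>2 + (cmod (g n))\<^sup>2"
    by (simp add: norm_mult)
qed

instantiation ell2 :: complex_inner
begin

definition "0 = Abs_ell2 (\<lambda>_. 0)"
definition "x + y = Abs_ell2 (\<lambda>i. coord x i + coord y i)"
definition "c *\<^sub>C x = Abs_ell2 (\<lambda>i. c * coord x i)"
definition "r *\<^sub>R (x :: ell2) = complex_of_real r *\<^sub>C x"
definition "- (x :: ell2) = (- 1) *\<^sub>C x"
definition "x - (y :: ell2) = x + (- y)"
definition "cinner x y = (\<Sum>i. coord x i * cnj (coord y i))"
definition "inner x (y :: ell2) = Re (cinner x y)"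
definition "norm (x :: ell2) = sqrt (inner x x)"
definition "dist x (y :: ell2) = norm (x - y)"
definition "sgn (x :: ell2) = inverse (norm x) *\<^sub>R x"
definition "(uniformity :: (ell2 \<times> ell2) filter) =
  (INF e\<in>{0 <..}. principal {(x, y). dist x y < e})"
definition "open (U :: ell2 set) \<longleftrightarrow>
  (\<forall>x\<in>U. eventually (\<lambda>(x', y). x' = x \<longrightarrow> y \<in> U) uniformity)"

lemma coord_zero: "coord 0 i = 0"
  by (simp add: zero_ell2_def coord_Abs_ell2)

lemma coord_add: "coord (x + y) i = coord x i + coord y i"
  by (simp add: plus_ell2_def coord_Abs_ell2 summable_square_add summable_coord)

lemma coord_scaleC: "coord (c *\<^sub>C x) i = c * coord x i"
  by (simp add: scaleC_ell2_def coord_Abs_ell2 summable_square_mult summable_coord)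

lemma coord_scaleR: "coord (r *\<^sub>R x) i = complex_of_real r * coord x i"
  by (simp add: scaleR_ell2_def coord_scaleC)

lemma coord_minus: "coord (- x) i = - coord x i"
  by (simp add: uminus_ell2_def coord_scaleC)

lemma coord_diff: "coord (x - y) i = coord x i - coord y i"
  by (simp add: minus_ell2_def coord_add coord_minus)

lemmas coord_simps = coord_zero coord_add coord_scaleC coord_scaleR coord_minus coord_diff

lemma cinner_self_ell2: "cinner x (x :: ell2) = complex_of_real (\<Sum>i. (cmod (coord x i))\<^sup>2)"
proof -
  have "coord x i * cnj (coord x i) = complex_of_real ((cmod (coord x i))\<^sup>2)" for i
    using complex_norm_square[of "coord x i"] by simp
  thus ?thesis
    by (simp only: cinner_ell2_def suminf_of_real[OF summable_coord])
qed

lemma cinner_add_left_ell2: "cinner (x + y) (z :: ell2) = cinner x z + cinner y z"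
  by (simp add: cinner_ell2_def coord_add distrib_right
      suminf_add[OF summable_mult_cnj summable_mult_cnj] summable_coord)

lemma cinner_scaleC_left_ell2: "cinner (a *\<^sub>C x) (y :: ell2) = a * cinner x y"
  by (simp add: cinner_ell2_def coord_scaleC mult.assoc
      suminf_mult[OF summable_mult_cnj] summable_coord)

lemma cinner_commute_ell2: "cinner x (y :: ell2) = cnj (cinner y x)"
proof -
  have "(\<lambda>i. coord y i * cnj (coord x i)) sums cinner y x"
    unfolding cinner_ell2_def by (intro summable_sums summable_mult_cnj summable_coord)
  hence "(\<lambda>i. cnj (coord y i * cnj (coord x i))) sums cnj (cinner y x)"
    by (simp only: sums_cnj)
  thus ?thesis
    by (simp add: cinner_ell2_def sums_iff mult.commute)
qed

instance
proof
  fix x y z :: ell2 and a b :: complex and r s :: real and S :: "ell2 set"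
  show "x + y + z = x + (y + z)" "x + y = y + x" "0 + x = x" "- x + x = 0" "x - y = x + - y"
    by (auto intro!: ell2_eqI simp: coord_simps)
  show "r *\<^sub>R (x + y) = r *\<^sub>R x + r *\<^sub>R y" "(r + s) *\<^sub>R x = r *\<^sub>R x + s *\<^sub>R x"
    "r *\<^sub>R s *\<^sub>R x = (r * s) *\<^sub>R x" "1 *\<^sub>R x = x"
    by (auto intro!: ell2_eqI simp: coord_simps algebra_simps)
  show "a *\<^sub>C (x + y) = a *\<^sub>C x + a *\<^sub>C y" "(a + b) *\<^sub>C x = a *\<^sub>C x + b *\<^sub>C x"
    "a *\<^sub>C b *\<^sub>C x = (a * b) *\<^sub>C x" "complex_of_real r *\<^sub>C x = r *\<^sub>R x"
    by (auto intro!: ell2_eqI simp: coord_simps algebra_simps)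
  show "cinner x y = cnj (cinner y x)" by (rule cinner_commute_ell2)
  show "cinner (x + y) z = cinner x z + cinner y z" by (rule cinner_add_left_ell2)
  show "cinner (a *\<^sub>C x) y = a * cinner x y" by (rule cinner_scaleC_left_ell2)
  show "inner x y = Re (cinner x y)" by (rule inner_ell2_def)
  show "inner x y = inner y x"
    unfolding inner_ell2_def by (subst cinner_commute_ell2) simp
  show "inner (x + y) z = inner x z + inner y z"
    by (simp add: inner_ell2_def cinner_add_left_ell2)
  show "inner (r *\<^sub>R x) y = r * inner x y"
    by (simp add: inner_ell2_def scaleR_ell2_def cinner_scaleC_left_ell2)
  show "0 \<le> inner x x"
    by (simp add: inner_ell2_def cinner_self_ell2 suminf_nonneg summable_coord)
  show "inner x x = 0 \<longleftrightarrow> x = 0"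
  proof
    assume "inner x x = 0"
    hence "\<forall>i. coord x i = 0"
      by (simp add: inner_ell2_def cinner_self_ell2 suminf_eq_zero_iff summable_coord)
    thus "x = 0" by (auto intro!: ell2_eqI simp: coord_simps)
  qed (simp add: inner_ell2_def cinner_self_ell2 coord_zero)
  show "norm x = sqrt (inner x x)" by (rule norm_ell2_def)
  show "dist x y = norm (x - y)" by (rule dist_ell2_def)
  show "sgn x = inverse (norm x) *\<^sub>R x" by (rule sgn_ell2_def)
  show "uniformity = (INF e\<in>{0 <..}. principal {(x, y :: ell2). dist x y < e})"
    by (rule uniformity_ell2_def)
  show "open S \<longleftrightarrow> (\<forall>x\<in>S. eventually (\<lambda>(x', y). x' = x \<longrightarrow> y \<in> S) uniformity)"
    by (rule open_ell2_def)
qed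

end

lemma norm_ell2_sq: "(norm (x :: ell2))\<^sup>2 = (\<Sum>i. (cmod (coord x i))\<^sup>2)"
  by (simp add: norm_ell2_def inner_ell2_def cinner_self_ell2 suminf_nonneg summable_coord)

lemma sum_coord_le_norm: "(\<Sum>i<n. (cmod (coord x i))\<^sup>2) \<le> (norm x)\<^sup>2"
  unfolding norm_ell2_sq by (rule sum_le_suminf) (auto simp: summable_coord)

lemma cmod_coord_le_norm: "cmod (coord x i) \<le> norm x"
proof -
  have "(cmod (coord x i))\<^sup>2 \<le> (\<Sum>j<Suc i. (cmod (coord x j))\<^sup>2)" by (simp add: sum_nonneg)
  also have "\<dots> \<le> (norm x)\<^sup>2" by (rule sum_coord_le_norm)
  finally show ?thesis by (simp add: power2_le_iff_abs_le)
qed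

instance ell2 :: complex_hilbert
proof
  fix X :: "nat \<Rightarrow> ell2"
  assume X: "Cauchy X"
  have "Cauchy (\<lambda>n. coord (X n) i)" for i
    unfolding Cauchy_def
  proof (intro allI impI)
    fix e :: real assume "e > 0"
    then obtain M where M: "\<forall>m\<ge>M. \<forall>n\<ge>M. dist (X m) (X n) < e"
      using X unfolding Cauchy_def by blast
    have "dist (coord (X m) i) (coord (X n) i) < e" if "m \<ge> M" "n \<ge> M" for m n
      using cmod_coord_le_norm[of "X m - X n" i] M that
      by (fastforce simp: dist_norm coord_simps)
    thus "\<exists>M. \<forall>m\<ge>M. \<forall>n\<ge>M. dist (coord (X m) i) (coord (X n) i) < e" by blast
  qed
  hence "\<forall>i. \<exists>l. (\<lambda>n. coord (X n) i) \<longlonglongrightarrow> l"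
    unfolding Cauchy_convergent_iff convergent_def by blast
  then obtain y where y: "\<And>i. (\<lambda>n. coord (X n) i) \<longlonglongrightarrow> y i"
    by metis
  have tail: "summable (\<lambda>i. (cmod (coord (X m) i - y i))\<^sup>2) \<and>
      (\<Sum>i. (cmod (coord (X m) i - y i))\<^sup>2) \<le> e\<^sup>2"
    if "\<And>n. n \<ge> M \<Longrightarrow> norm (X m - X n) \<le> e" for m M e
  proof -
    have "(\<Sum>i<N. (cmod (coord (X m) i - y i))\<^sup>2) \<le> e\<^sup>2" for N
    proof (rule LIMSEQ_le_const2)
      show "(\<lambda>n. \<Sum>i<N. (cmod (coord (X m) i - coord (X n) i))\<^sup>2)
              \<longlonglongrightarrow> (\<Sum>i<N. (cmod (coord (X m) i - y i))\<^sup>2)"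
        by (intro tendsto_intros y)
      have "(\<Sum>i<N. (cmod (coord (X m) i - coord (X n) i))\<^sup>2) \<le> e\<^sup>2" if "n \<ge> M" for n
      proof -
        have "(norm (X m - X n))\<^sup>2 \<le> e\<^sup>2"
          using \<open>\<And>n. n \<ge> M \<Longrightarrow> norm (X m - X n) \<le> e\<close>[OF that] by (simp add: power_mono)
        thus ?thesis
          using sum_coord_le_norm[of "X m - X n" N] by (simp add: coord_simps)
      qed
      thus "\<exists>M. \<forall>n\<ge>M. (\<Sum>i<N. (cmod (coord (X m) i - coord (X n) i))\<^sup>2) \<le> e\<^sup>2" by blast
    qed
    moreover from this have "summable (\<lambda>i. (cmod (coord (X m) i - y i))\<^sup>2)"
      by (intro summableI_nonneg_bounded[where x = "e\<^sup>2"]) auto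
    ultimately show ?thesis by (auto intro: suminf_le_const)
  qed
  have cau: "\<exists>M. \<forall>m\<ge>M. \<forall>n\<ge>M. norm (X m - X n) \<le> e" if "e > 0" for e
    using X that unfolding Cauchy_def dist_norm by (meson less_imp_le)
  have sy: "summable (\<lambda>i. (cmod (y i))\<^sup>2)"
  proof -
    obtain M where "\<forall>m\<ge>M. \<forall>n\<ge>M. norm (X m - X n) \<le> 1" using cau[of 1] by auto
    hence "summable (\<lambda>i. (cmod (coord (X M) i - y i))\<^sup>2)" using tail[of M M 1] by auto
    hence "summable (\<lambda>i. (cmod (y i - coord (X M) i))\<^sup>2)" by (simp add: norm_minus_commute)
    from summable_square_add[OF this summable_coord[of "X M"]] show ?thesis by simp
  qed
  have "X \<longlonglongrightarrow> Abs_ell2 y"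
  proof (rule LIMSEQ_I)
    fix r :: real assume "r > 0"
    then obtain M where M: "\<forall>m\<ge>M. \<forall>n\<ge>M. norm (X m - X n) \<le> r / 2" using cau[of "r / 2"] by auto
    have "norm (X m - Abs_ell2 y) < r" if "m \<ge> M" for m
    proof -
      have "(norm (X m - Abs_ell2 y))\<^sup>2 \<le> (r / 2)\<^sup>2"
        using tail[of M m "r / 2"] M that by (simp add: norm_ell2_sq coord_simps coord_Abs_ell2 sy)
      hence "norm (X m - Abs_ell2 y) \<le> r / 2"
        by (rule power2_le_imp_le) (use \<open>r > 0\<close> in simp)
      thus ?thesis using \<open>r > 0\<close> by simp
    qed
    thus "\<exists>no. \<forall>n\<ge>no. norm (X n - Abs_ell2 y) < r" by blast
  qed
  thus "convergent X" by (rule convergentI)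
qed

text \<open>The standard basis \<open>e\<^sub>i\<close>; sequences are indexed from \<open>0\<close>.\<close>

definition unit_vec :: "nat \<Rightarrow> ell2" where
  "unit_vec i = Abs_ell2 (\<lambda>j. if j = i then 1 else 0)"


section \<open>Frames\<close>

text \<open>
  Sums of nonnegative terms are taken in \<^typ>\<open>ennreal\<close>, where they always exist, so that
  convergence is expressed by finiteness.
\<close>

definition frame_with_bounds ::
  "real \<Rightarrow> real \<Rightarrow> 'a :: complex_inner set \<Rightarrow> (nat \<Rightarrow> 'a) \<Rightarrow> bool" where
  "frame_with_bounds A B K f \<longleftrightarrow>
     csubspace K \<and> closed K \<and> (\<forall>i. f i \<in> K) \<and>
     (\<forall>x\<in>K. ennreal (A * (norm x)\<^sup>2) \<le> (\<Sum>i. ennreal ((cmod (cinner x (f i)))\<^sup>2)) \<and>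
             (\<Sum>i. ennreal ((cmod (cinner x (f i)))\<^sup>2)) \<le> ennreal (B * (norm x)\<^sup>2))"

definition frame_in :: "'a :: complex_inner set \<Rightarrow> (nat \<Rightarrow> 'a) \<Rightarrow> bool" where
  "frame_in K f \<longleftrightarrow> (\<exists>A>0. \<exists>B>0. frame_with_bounds A B K f)"

definition parseval_frame_in :: "'a :: complex_inner set \<Rightarrow> (nat \<Rightarrow> 'a) \<Rightarrow> bool" where
  "parseval_frame_in K f \<longleftrightarrow> frame_with_bounds 1 1 K f"

definition sqdist :: "(nat \<Rightarrow> 'a :: complex_inner) \<Rightarrow> (nat \<Rightarrow> 'a) \<Rightarrow> ennreal" where
  "sqdist f g = (\<Sum>i. ennreal ((norm (f i - g i))\<^sup>2))"

definition quadratically_close :: "(nat \<Rightarrow> 'a :: complex_inner) \<Rightarrow> (nat \<Rightarrow> 'a) \<Rightarrow> bool" where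
  "quadratically_close f g \<longleftrightarrow> sqdist f g < \<infinity>"

definition synthesis :: "(nat \<Rightarrow> 'a :: complex_inner) \<Rightarrow> ell2 \<Rightarrow> 'a" where
  "synthesis f = (THE F. bounded_clinear F \<and> (\<forall>i. F (unit_vec i) = f i))"

definition close_parseval_frames :: "(nat \<Rightarrow> 'a :: complex_inner) \<Rightarrow> (nat \<Rightarrow> 'a) set" where
  "close_parseval_frames f = {x. (\<exists>M. parseval_frame_in M x) \<and> quadratically_close f x}"

text \<open>
  The set \<open>Q\<^sub>F\<^sup>k\<close>, where \<open>U\<close> is the partial isometry in the polar decomposition of the synthesis
  operator of \<open>f\<close>. Requiring the Fredholm property states that the index is defined and equal
  to \<open>k\<close>.
\<close>

definition close_parseval_frames_index ::
  "(nat \<Rightarrow> 'a :: complex_inner) \<Rightarrow> (ell2 \<Rightarrow> 'a) \<Rightarrow> int \<Rightarrow> (nat \<Rightarrow> 'a) set" where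
  "close_parseval_frames_index f U k =
     {x \<in> close_parseval_frames f.
        let P = cadjoint U \<circ> U; Q = cadjoint (synthesis x) \<circ> synthesis x
        in fredholm_pair P Q \<and> pair_index P Q = k}"

definition symmetric_approximation ::
  "(nat \<Rightarrow> 'a :: complex_inner) \<Rightarrow> (nat \<Rightarrow> 'a) set \<Rightarrow> (nat \<Rightarrow> 'a) \<Rightarrow> bool" where
  "symmetric_approximation f Qs y \<longleftrightarrow>
     y \<in> Qs \<and> sqdist f y < \<infinity> \<and> (\<forall>x\<in>Qs. sqdist f y \<le> sqdist f x)"

end

theory Submission
  imports Defs
begin

text \<open>
  Let \<open>P = U\<^sup>* U\<close> and \<open>n = - k\<close>. For a Parseval frame with synthesis operator \<open>X\<close>, the operator
  \<open>Q = X\<^sup>* X\<close> is a projection, and the sum of \<open>\<parallel>f\<^sub>i - x\<^sub>i\<parallel>\<^sup>2\<close> is the squared Hilbert-Schmidt norm of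
  \<open>F - X\<close>. If all the spaces were finite dimensional, then
  \<open>\<parallel>F - X\<parallel>\<^sup>2 = tr A\<^sup>2 - 2 Re tr (X\<^sup>* U A) + rank Q\<close>, where \<open>rank Q = rank P + n\<close> and
  \<open>Re tr (X\<^sup>* U A) \<le> tr A\<close>. Hence \<open>\<parallel>F - X\<parallel>\<^sup>2 \<ge> \<parallel>F - U\<parallel>\<^sup>2 + n\<close>, with equality exactly if \<open>X\<close> agrees with
  \<open>U\<close> on the range of \<open>P\<close>. In that case \<open>X\<close> restricts to a partial isometry of rank \<open>n\<close> from
  \<open>ker F\<close> to the orthogonal complement of the range of \<open>F\<close>, and conversely every such partial
  isometry \<open>S\<close> yields the minimiser \<open>U + S (1 - P)\<close>.

  In infinite dimensions these traces diverge, and three facts replace them.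

  First, \<open>F - U\<close> is Hilbert-Schmidt as soon as some \<open>F - X\<close> is (\<open>hilbert_schmidt_F_diff_U\<close>). Then
  \<open>U - X\<close> and \<open>P - Q\<close> are Hilbert-Schmidt too.

  Secondly, the difference of the ranks becomes the index: if \<open>P - Q\<close> is Hilbert-Schmidt then
  \<open>\<parallel>Q (1 - P)\<parallel>\<^sup>2 - \<parallel>(1 - Q) P\<parallel>\<^sup>2 = - j(P, Q)\<close> (\<open>pair_index_eq_trace_difference\<close>). The proof
  avoids the spectral theorem: with \<open>T = P - Q\<close>, the number \<open>\<parallel>T\<^sup>m P\<parallel>\<^sup>2 - \<parallel>T\<^sup>m Q\<parallel>\<^sup>2\<close> is the same for all
  \<open>m \<ge> 1\<close>; it is the left-hand side up to sign for \<open>m = 1\<close>, and it tends to the difference of the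
  dimensions of \<open>ran P \<inter> ker Q\<close> and \<open>ran Q \<inter> ker P\<close>.

  Thirdly, the expansion of \<open>\<parallel>(F - U) + (U - X)\<parallel>\<^sup>2\<close> can be arranged so that
  \<open>\<parallel>F - X\<parallel>\<^sup>2 - \<parallel>F - U\<parallel>\<^sup>2 - n\<close> is a sum of two terms of the form \<open>tr (W A W\<^sup>*)\<close> with
  Hilbert-Schmidt operators \<open>W\<close> (\<open>distance_identity\<close>). These are nonnegative since \<open>A \<ge> 0\<close>
  (\<open>hs_inner_positive\<close>), and the one with \<open>W = (U - X) P\<close> vanishes only if \<open>X P = U\<close>.
\<close>

section \<open>Complex inner product spaces\<close>

lemma cinner_add_right: "cinner x (y + z) = cinner x y + cinner x z"
  by (metis cinner_add_left cinner_commute complex_cnj_add)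

lemma cinner_scaleC_right: "cinner x (c *\<^sub>C y) = cnj c * cinner x y"
  by (metis cinner_scaleC_left cinner_commute complex_cnj_mult)

lemma cinner_zero_left [simp]: "cinner 0 x = 0"
  using cinner_add_left[of 0 0 x] by simp

lemma cinner_zero_right [simp]: "cinner x 0 = 0"
  by (metis cinner_zero_left cinner_commute complex_cnj_zero)

lemma cinner_minus_left: "cinner (- x) y = - cinner x y"
  using cinner_add_left[of x "- x" y] by (simp add: add_eq_0_iff)

lemma cinner_minus_right: "cinner x (- y) = - cinner x y"
  using cinner_add_right[of x y "- y"] by (simp add: add_eq_0_iff)

lemma cinner_diff_left: "cinner (x - y) z = cinner x z - cinner y z"
  using cinner_add_left[of x "- y" z] by (simp add: cinner_minus_left)

lemma cinner_diff_right: "cinner x (y - z) = cinner x y - cinner x z"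
  using cinner_add_right[of x y "- z"] by (simp add: cinner_minus_right)

lemmas cinner_simps = cinner_add_left cinner_add_right cinner_diff_left cinner_diff_right
  cinner_scaleC_left cinner_scaleC_right cinner_minus_left cinner_minus_right

lemma cinner_sum_left: "cinner (\<Sum>i\<in>I. g i) y = (\<Sum>i\<in>I. cinner (g i) y)"
  by (induction I rule: infinite_finite_induct) (auto simp: cinner_add_left)

lemma cinner_sum_right: "cinner y (\<Sum>i\<in>I. g i) = (\<Sum>i\<in>I. cinner y (g i))"
  by (induction I rule: infinite_finite_induct) (auto simp: cinner_add_right)

lemma cinner_self: "cinner x x = complex_of_real ((norm x)\<^sup>2)"
proof (rule complex_eqI)
  show "Re (cinner x x) = Re (complex_of_real ((norm x)\<^sup>2))"
    by (simp add: power2_norm_eq_inner inner_eq_Re_cinner)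
  show "Im (cinner x x) = Im (complex_of_real ((norm x)\<^sup>2))"
    using cinner_commute[of x x] by (metis Im_complex_of_real complex_is_Real_iff Reals_cnj_iff)
qed

lemma cinner_commute_zero: "cinner x y = 0 \<longleftrightarrow> cinner y x = 0"
  by (metis cinner_commute complex_cnj_zero)

lemma scaleC_diff_right: "c *\<^sub>C (x - y) = c *\<^sub>C x - c *\<^sub>C (y :: 'a :: complex_inner)"
  by (rule complex_vector.scale_right_diff_distrib)

lemma norm_scaleC: "norm (c *\<^sub>C x) = cmod c * norm x"
proof -
  have "complex_of_real ((norm (c *\<^sub>C x))\<^sup>2) = c * cnj c * complex_of_real ((norm x)\<^sup>2)"
    by (simp only: cinner_self[symmetric] cinner_scaleC_left cinner_scaleC_right mult_ac)
  also have "\<dots> = complex_of_real ((cmod c * norm x)\<^sup>2)"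
    by (simp add: complex_norm_square[symmetric] power_mult_distrib)
  finally have "(norm (c *\<^sub>C x))\<^sup>2 = (cmod c * norm x)\<^sup>2"
    using of_real_eq_iff by blast
  thus ?thesis by (simp add: power2_eq_iff_nonneg)
qed

lemma cinner_cauchy_schwarz: "cmod (cinner x y) \<le> norm x * norm y"
proof (cases "cinner x y = 0")
  case False
  define c where "c = cnj (cinner x y) / complex_of_real (cmod (cinner x y))"
  have "cmod c = 1" using False by (simp add: c_def norm_divide)
  have "cinner (c *\<^sub>C x) y = complex_of_real (cmod (cinner x y))"
    using False complex_norm_square[of "cinner x y"]
    by (simp add: c_def cinner_scaleC_left field_simps power2_eq_square)
  hence "cmod (cinner x y) = inner (c *\<^sub>C x) y" by (simp add: inner_eq_Re_cinner)
  also have "\<dots> \<le> norm (c *\<^sub>C x) * norm y" by (rule norm_cauchy_schwarz)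
  finally show ?thesis by (simp add: norm_scaleC \<open>cmod c = 1\<close>)
qed simp

lemma bounded_linear_cinner_left: "bounded_linear (\<lambda>x. cinner x y)"
proof (rule bounded_linear_intro[where K = "norm y"])
  fix r x
  show "cinner (r *\<^sub>R x) y = r *\<^sub>R cinner x y"
    by (metis scaleC_of_real cinner_scaleC_left scaleR_conv_of_real)
qed (simp_all add: cinner_add_left cinner_cauchy_schwarz)

lemma tendsto_cinner_left: "(g \<longlongrightarrow> l) G \<Longrightarrow> ((\<lambda>n. cinner (g n) y) \<longlongrightarrow> cinner l y) G"
  by (rule bounded_linear.tendsto[OF bounded_linear_cinner_left])

lemma cinner_i_left: "inner (\<i> *\<^sub>C x) y = - Im (cinner x y)"
  by (simp add: inner_eq_Re_cinner cinner_scaleC_left)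

text \<open>The real inner product determines the complex one, because the imaginary part of
  \<open>cinner x y\<close> is minus the real inner product of \<open>\<i> x\<close> and \<open>y\<close>.\<close>

lemma cinner_eqI:
  assumes "\<And>c. inner (c *\<^sub>C x) y = inner (c *\<^sub>C x') y'"
  shows "cinner x y = cinner x' y'"
  using assms[of 1] assms[of \<i>] by (simp add: complex_eq_iff inner_eq_Re_cinner cinner_scaleC_left)

text \<open>Real orthogonality to a complex subspace is complex orthogonality, as the subspace contains
  \<open>\<i> v\<close> along with \<open>v\<close>.\<close>

lemma inner_zero_cspace:
  assumes "csubspace V" "\<And>v. v \<in> V \<Longrightarrow> inner x v = 0" "v \<in> V"
  shows "cinner x v = 0"
proof -
  have "inner (\<i> *\<^sub>C v) x = 0"
    using assms(2)[OF complex_vector.subspace_scale[OF assms(1,3), of \<i>]] by (simp only: inner_commute)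
  hence "Im (cinner v x) = 0" by (simp add: cinner_i_left)
  moreover have "Re (cinner v x) = 0"
    using assms(2)[OF assms(3)] by (simp add: inner_commute flip: inner_eq_Re_cinner)
  ultimately have "cinner v x = 0" by (simp add: complex_eq_iff)
  thus ?thesis by (simp add: cinner_commute_zero[of x v])
qed

lemma csubspace_iff:
  "csubspace V \<longleftrightarrow> 0 \<in> V \<and> (\<forall>x\<in>V. \<forall>y\<in>V. x + y \<in> V) \<and> (\<forall>c. \<forall>x\<in>V. c *\<^sub>C x \<in> V)"
  by (rule complex_vector.subspace_def)

lemma csubspace_scaleR: "csubspace V \<Longrightarrow> x \<in> V \<Longrightarrow> r *\<^sub>R x \<in> V"
  by (metis complex_vector.subspace_scale scaleC_of_real)

lemma csubspace_ortho_compl: "csubspace (ortho_compl V)"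
  by (auto simp: csubspace_iff ortho_compl_def cinner_simps)

lemma csubspace_closure:
  fixes V :: "'a :: complex_inner set"
  assumes V: "csubspace V"
  shows "csubspace (closure V)"
proof -
  have bl: "bounded_linear (\<lambda>x :: 'a. c *\<^sub>C x)" for c
  proof (rule bounded_linear_intro[where K = "cmod c"])
    fix r :: real and x :: 'a
    show "c *\<^sub>C r *\<^sub>R x = r *\<^sub>R c *\<^sub>C x"
      by (metis scaleC_of_real scaleC_scaleC mult.commute)
  qed (simp_all add: scaleC_add_right norm_scaleC mult.commute)
  show ?thesis
    unfolding csubspace_iff
  proof (intro conjI ballI allI)
    show "0 \<in> closure V"
      using complex_vector.subspace_0[OF V] closure_subset by blast
  next
    fix x y assume "x \<in> closure V" "y \<in> closure V"
    then obtain X Y where "\<forall>n. X n \<in> V" "X \<longlonglongrightarrow> x" "\<forall>n. Y n \<in> V" "Y \<longlonglongrightarrow> y"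
      unfolding closure_sequential by blast
    thus "x + y \<in> closure V"
      using complex_vector.subspace_add[OF V] tendsto_add unfolding closure_sequential
      by (intro exI[of _ "\<lambda>n. X n + Y n"]) blast
  next
    fix c x assume "x \<in> closure V"
    then obtain X where "\<forall>n. X n \<in> V" "X \<longlonglongrightarrow> x" unfolding closure_sequential by blast
    thus "c *\<^sub>C x \<in> closure V"
      using complex_vector.subspace_scale[OF V] bounded_linear.tendsto[OF bl]
      unfolding closure_sequential by (intro exI[of _ "\<lambda>n. c *\<^sub>C X n"]) blast
  qed
qed

text \<open>A minimising sequence for the distance from \<open>x\<close> to \<open>V\<close> is Cauchy by the parallelogram law,
  and the residual of its limit is orthogonal to \<open>V\<close>.\<close>

theorem orthogonal_decomposition:
  fixes V :: "'a :: complex_hilbert set"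
  assumes V: "csubspace V" and cl: "closed V"
  obtains y where "y \<in> V" "x - y \<in> ortho_compl V"
proof -
  define d where "d = (INF v\<in>V. (norm (x - v))\<^sup>2)"
  have ne: "V \<noteq> {}" using V by (metis complex_vector.subspace_0 empty_iff)
  have bdd: "bdd_below ((\<lambda>v. (norm (x - v))\<^sup>2) ` V)" by (rule bdd_belowI[of _ 0]) auto
  have low: "d \<le> (norm (x - v))\<^sup>2" if "v \<in> V" for v
    unfolding d_def using bdd that by (rule cINF_lower)
  have "\<exists>v\<in>V. (norm (x - v))\<^sup>2 < d + inverse (real (Suc n))" for n
    using cINF_less_iff[OF ne bdd, of "d + inverse (real (Suc n))"] unfolding d_def[symmetric] by simp
  then obtain v where v: "\<And>n. v n \<in> V" "\<And>n. (norm (x - v n))\<^sup>2 < d + inverse (real (Suc n))"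
    by metis
  have par: "(norm (v m - v n))\<^sup>2 \<le> 2 * inverse (real (Suc m)) + 2 * inverse (real (Suc n))" for m n
  proof -
    have "(1 / 2) *\<^sub>R (v m + v n) \<in> V"
      using csubspace_scaleR complex_vector.subspace_add V v(1) by metis
    from low[OF this] have "d \<le> (norm (x - (1 / 2) *\<^sub>R (v m + v n)))\<^sup>2" .
    moreover have "(norm (v m - v n))\<^sup>2 + 4 * (norm (x - (1 / 2) *\<^sub>R (v m + v n)))\<^sup>2 =
      2 * (norm (x - v m))\<^sup>2 + 2 * (norm (x - v n))\<^sup>2"
      by (simp add: power2_norm_eq_inner inner_simps inner_commute algebra_simps)
    ultimately show ?thesis using v(2)[of m] v(2)[of n] by linarith
  qed
  have "Cauchy v"
    unfolding Cauchy_def dist_norm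
  proof (intro allI impI)
    fix e :: real assume "e > 0"
    then obtain M where M: "inverse (real (Suc M)) < e\<^sup>2 / 4"
      using reals_Archimedean[of "e\<^sup>2 / 4"] by auto
    show "\<exists>M. \<forall>m\<ge>M. \<forall>n\<ge>M. norm (v m - v n) < e"
    proof (intro exI allI impI)
      fix m n assume "M \<le> m" "M \<le> n"
      hence "inverse (real (Suc m)) \<le> inverse (real (Suc M))"
        "inverse (real (Suc n)) \<le> inverse (real (Suc M))"
        by (auto intro!: le_imp_inverse_le)
      hence "(norm (v m - v n))\<^sup>2 < e\<^sup>2" using par[of m n] M by linarith
      thus "norm (v m - v n) < e" using \<open>e > 0\<close> by (simp add: power_less_imp_less_base)
    qed
  qed
  then obtain y where y: "v \<longlonglongrightarrow> y" by (auto simp: Cauchy_convergent_iff convergent_def)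
  have yV: "y \<in> V" using closed_sequentially[OF cl] v(1) y by blast
  have yd: "(norm (x - y))\<^sup>2 \<le> d"
  proof (rule LIMSEQ_le)
    show "(\<lambda>n. (norm (x - v n))\<^sup>2) \<longlonglongrightarrow> (norm (x - y))\<^sup>2" by (intro tendsto_intros y)
    show "(\<lambda>n. d + inverse (real (Suc n))) \<longlonglongrightarrow> d" using LIMSEQ_inverse_real_of_nat_add by simp
    show "\<exists>N. \<forall>n\<ge>N. (norm (x - v n))\<^sup>2 \<le> d + inverse (real (Suc n))" using v(2) less_imp_le by blast
  qed
  have "inner (x - y) w = 0" if w: "w \<in> V" for w
  proof (cases "w = 0")
    case False
    define t where "t = inner (x - y) w / (norm w)\<^sup>2"
    have "y + t *\<^sub>R w \<in> V" using yV w V csubspace_scaleR complex_vector.subspace_add by metis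
    from low[OF this] have "(norm (x - y))\<^sup>2 \<le> (norm (x - y - t *\<^sub>R w))\<^sup>2"
      using yd unfolding diff_diff_eq by linarith
    also have "\<dots> = (norm (x - y))\<^sup>2 - 2 * t * inner (x - y) w + t\<^sup>2 * (norm w)\<^sup>2"
      unfolding power2_norm_eq_inner by (simp add: inner_diff inner_commute power2_eq_square algebra_simps)
    also have "\<dots> = (norm (x - y))\<^sup>2 - (inner (x - y) w)\<^sup>2 / (norm w)\<^sup>2"
      using False by (simp add: t_def power2_eq_square field_simps)
    finally have "(inner (x - y) w)\<^sup>2 / (norm w)\<^sup>2 \<le> 0" by simp
    thus ?thesis using False by (simp add: divide_le_0_iff)
  qed simp
  hence "x - y \<in> ortho_compl V" unfolding ortho_compl_def using inner_zero_cspace[OF V] by blast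
  with yV show ?thesis by (rule that)
qed

section \<open>Orthonormal families\<close>

text \<open>The zero vector is admitted, so that an orthonormalised sequence keeps the index set of the
  sequence that it comes from.\<close>

definition weakly_orthonormal :: "('i \<Rightarrow> 'a :: complex_inner) \<Rightarrow> 'i set \<Rightarrow> bool" where
  "weakly_orthonormal v J \<longleftrightarrow> (\<forall>i\<in>J. v i = 0 \<or> norm (v i) = 1) \<and>
     (\<forall>i\<in>J. \<forall>j\<in>J. i \<noteq> j \<longrightarrow> cinner (v i) (v j) = 0)"

definition orthonormal :: "('i \<Rightarrow> 'a :: complex_inner) \<Rightarrow> 'i set \<Rightarrow> bool" where
  "orthonormal v J \<longleftrightarrow> (\<forall>i\<in>J. \<forall>j\<in>J. cinner (v i) (v j) = (if i = j then 1 else 0))"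

lemma orthonormal_norm: "orthonormal v J \<Longrightarrow> i \<in> J \<Longrightarrow> norm (v i) = 1"
proof -
  assume "orthonormal v J" "i \<in> J"
  hence "complex_of_real ((norm (v i))\<^sup>2) = 1" by (metis orthonormal_def cinner_self)
  hence "(norm (v i))\<^sup>2 = 1" by (metis of_real_eq_1_iff)
  thus ?thesis by (simp add: power2_eq_1_iff) (metis norm_ge_zero neg_0_le_iff_le not_one_le_zero)
qed

lemma orthonormal_imp_weakly: "orthonormal v J \<Longrightarrow> weakly_orthonormal v J"
  using orthonormal_norm[of v J] by (auto simp: weakly_orthonormal_def orthonormal_def)

lemma weakly_orthonormal_residual:
  assumes v: "weakly_orthonormal v J" and fin: "finite J" and j: "j \<in> J"
  shows "cinner (x - (\<Sum>i\<in>J. cinner x (v i) *\<^sub>C v i)) (v j) = 0"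
proof -
  have "(\<Sum>i\<in>J. cinner x (v i) * cinner (v i) (v j)) = (\<Sum>i\<in>J. if i = j then cinner x (v j) else 0)"
    using v j by (intro sum.cong) (auto simp: weakly_orthonormal_def cinner_self)
  thus ?thesis using fin j by (simp add: cinner_simps cinner_sum_left)
qed

lemma weakly_orthonormal_pythagoras:
  assumes v: "weakly_orthonormal v J" and fin: "finite J"
  shows "(norm x)\<^sup>2 = (\<Sum>j\<in>J. (cmod (cinner x (v j)))\<^sup>2) +
    (norm (x - (\<Sum>j\<in>J. cinner x (v j) *\<^sub>C v j)))\<^sup>2"
proof -
  define s where "s = (\<Sum>j\<in>J. cinner x (v j) *\<^sub>C v j)"
  have "cinner (x - s) s = 0"
    using weakly_orthonormal_residual[OF v fin] unfolding s_def
    by (simp add: cinner_sum_right cinner_scaleC_right)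
  moreover have "cinner x s = (\<Sum>j\<in>J. complex_of_real ((cmod (cinner x (v j)))\<^sup>2))"
    unfolding s_def by (simp only: cinner_sum_right cinner_scaleC_right complex_norm_square mult.commute)
  moreover have "cinner s s = cinner x s" using \<open>cinner (x - s) s = 0\<close> by (simp add: cinner_simps)
  moreover have "cinner s x = cnj (cinner x s)" by (rule cinner_commute)
  ultimately have "cinner x x = (\<Sum>j\<in>J. complex_of_real ((cmod (cinner x (v j)))\<^sup>2)) + cinner (x - s) (x - s)"
    by (simp add: cinner_simps)
  thus ?thesis unfolding cinner_self s_def[symmetric] using of_real_eq_iff by (metis of_real_add of_real_sum)
qed

lemma best_approximation:
  assumes v: "weakly_orthonormal v J" and fin: "finite J" and w: "w \<in> cspan (v ` J)"
  shows "norm (x - (\<Sum>j\<in>J. cinner x (v j) *\<^sub>C v j)) \<le> norm (x - w)"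
proof -
  define s where "s = (\<Sum>j\<in>J. cinner x (v j) *\<^sub>C v j)"
  have "v ` J \<subseteq> {u. cinner (x - s) u = 0}"
    using weakly_orthonormal_residual[OF v fin] by (auto simp: s_def)
  moreover have "csubspace {u. cinner (x - s) u = 0}"
    by (auto simp: csubspace_iff cinner_simps)
  ultimately have span: "cspan (v ` J) \<subseteq> {u. cinner (x - s) u = 0}"
    by (rule complex_vector.span_minimal)
  have "s \<in> cspan (v ` J)"
    unfolding s_def by (intro complex_vector.span_sum complex_vector.span_scale complex_vector.span_base) auto
  hence "cinner (x - s) s = 0" "cinner (x - s) w = 0" using span w by blast+
  hence "cinner (x - s) (s - w) = 0" by (simp only: cinner_diff_right diff_zero)
  hence "inner (x - s) (s - w) = 0" by (simp add: inner_eq_Re_cinner)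
  hence "(norm (x - s + (s - w)))\<^sup>2 = (norm (x - s))\<^sup>2 + (norm (s - w))\<^sup>2"
    by (simp only: power2_norm_eq_inner inner_add inner_commute)
  hence "(norm (x - s))\<^sup>2 \<le> (norm (x - w))\<^sup>2" by simp
  thus ?thesis unfolding s_def by (metis norm_ge_zero power2_le_imp_le)
qed

text \<open>The \<open>n\<close>-th vector is the normalised residual of \<open>g n\<close>, and is \<open>0\<close> if \<open>g n\<close> depends
  linearly on its predecessors, because \<open>sgn 0 = 0\<close>.\<close>

context
  notes sum.cong [fundef_cong]
begin

fun gram_schmidt :: "(nat \<Rightarrow> 'a :: complex_inner) \<Rightarrow> nat \<Rightarrow> 'a" where
  "gram_schmidt g n =
     sgn (g n - (\<Sum>j\<in>{..<n}. cinner (g n) (gram_schmidt g j) *\<^sub>C gram_schmidt g j))"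

end

declare gram_schmidt.simps [simp del]

lemma weakly_orthonormal_gram_schmidt: "weakly_orthonormal (gram_schmidt g) UNIV"
proof -
  define v where "v = gram_schmidt g"
  have v: "v n = sgn (g n - (\<Sum>j\<in>{..<n}. cinner (g n) (v j) *\<^sub>C v j))" for n
    unfolding v_def by (rule gram_schmidt.simps)
  have *: "weakly_orthonormal v {..<n}" for n
  proof (induction n)
    case (Suc n)
    define r where "r = g n - (\<Sum>j\<in>{..<n}. cinner (g n) (v j) *\<^sub>C v j)"
    have "cinner r (v j) = 0" if "j < n" for j
      using weakly_orthonormal_residual[OF Suc] that by (simp add: r_def)
    moreover have "v n = complex_of_real (inverse (norm r)) *\<^sub>C r"
      using v[of n] unfolding r_def[symmetric] sgn_div_norm scaleC_of_real by simp
    ultimately have "cinner (v n) (v j) = 0" "cinner (v j) (v n) = 0" if "j < n" for j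
      using that cinner_commute_zero[of r "v j"] by (simp_all add: cinner_simps)
    moreover have "v n = 0 \<or> norm (v n) = 1"
      using v[of n] unfolding r_def[symmetric] by (metis norm_sgn sgn_zero)
    ultimately show ?case
      using Suc by (auto simp: weakly_orthonormal_def less_Suc_eq)
  qed (simp add: weakly_orthonormal_def)
  show ?thesis
    unfolding v_def[symmetric] weakly_orthonormal_def
  proof (intro conjI ballI impI)
    fix i j :: nat assume "i \<noteq> j"
    thus "cinner (v i) (v j) = 0"
      using *[of "Suc (max i j)"] by (auto simp: weakly_orthonormal_def)
  qed (use * in \<open>auto simp: weakly_orthonormal_def\<close>)
qed

lemma gram_schmidt_span: "g n \<in> cspan (gram_schmidt g ` {..<Suc n})"
proof -
  define v where "v = gram_schmidt g"
  define s where "s = (\<Sum>j\<in>{..<n}. cinner (g n) (v j) *\<^sub>C v j)"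
  have "v n = sgn (g n - s)" unfolding v_def s_def by (rule gram_schmidt.simps)
  hence "g n = s + complex_of_real (norm (g n - s)) *\<^sub>C v n"
    by (cases "g n - s = 0") (simp_all add: scaleC_of_real sgn_div_norm)
  moreover have "s \<in> cspan (v ` {..<Suc n})"
    unfolding s_def by (intro complex_vector.span_sum complex_vector.span_scale complex_vector.span_base) auto
  ultimately show ?thesis
    unfolding v_def[symmetric]
    by (metis complex_vector.span_add complex_vector.span_scale complex_vector.span_base imageI lessI lessThan_iff)
qed

text \<open>An orthonormalised sequence satisfies Parseval's identity on the closed span of the original
  sequence, since the Fourier sums are best approximations.\<close>

lemma gram_schmidt_parseval:
  assumes y: "y \<in> closure (cspan (range g))"
  shows "(\<lambda>j. (cmod (cinner y (gram_schmidt g j)))\<^sup>2) sums (norm y)\<^sup>2"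
  unfolding sums_def
proof (rule LIMSEQ_I)
  define v where "v = gram_schmidt g"
  define s where "s = (\<lambda>n. \<Sum>j\<in>{..<n}. cinner y (v j) *\<^sub>C v j)"
  have v: "weakly_orthonormal v {..<n}" for n
    using weakly_orthonormal_gram_schmidt[of g] by (auto simp: v_def weakly_orthonormal_def)
  have mono: "cspan (v ` {..<m}) \<subseteq> cspan (v ` {..<n})" if "m \<le> n" for m n
    using that by (intro complex_vector.span_mono) auto
  have "cspan (range g) \<subseteq> {z. \<exists>N. z \<in> cspan (v ` {..<N})}"
  proof (rule complex_vector.span_minimal)
    show "range g \<subseteq> {z. \<exists>N. z \<in> cspan (v ` {..<N})}"
      using gram_schmidt_span unfolding v_def by blast
    show "csubspace {z. \<exists>N. z \<in> cspan (v ` {..<N})}"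
      unfolding csubspace_iff
    proof (intro conjI ballI allI)
      fix x z assume "x \<in> {z. \<exists>N. z \<in> cspan (v ` {..<N})}" "z \<in> {z. \<exists>N. z \<in> cspan (v ` {..<N})}"
      then obtain M N where "x \<in> cspan (v ` {..<M})" "z \<in> cspan (v ` {..<N})" by blast
      hence "x + z \<in> cspan (v ` {..<max M N})"
        using mono[of M "max M N"] mono[of N "max M N"] by (intro complex_vector.span_add) auto
      thus "x + z \<in> {z. \<exists>N. z \<in> cspan (v ` {..<N})}" by blast
    qed (auto intro: complex_vector.span_zero complex_vector.span_scale)
  qed
  hence span: "\<exists>N. z \<in> cspan (v ` {..<N})" if "z \<in> cspan (range g)" for z using that by blast
  fix r :: real assume "r > 0"
  hence "sqrt r > 0" by simp
  with y obtain z where z: "z \<in> cspan (range g)" "dist z y < sqrt r"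
    unfolding closure_approachable by blast
  from span[OF z(1)] obtain N where N: "z \<in> cspan (v ` {..<N})" by blast
  show "\<exists>N. \<forall>n\<ge>N. norm ((\<Sum>j<n. (cmod (cinner y (gram_schmidt g j)))\<^sup>2) - (norm y)\<^sup>2) < r"
  proof (intro exI allI impI)
    fix n assume "N \<le> n"
    hence "norm (y - s n) \<le> norm (y - z)"
      using best_approximation[OF v] N mono unfolding s_def by blast
    also have "\<dots> < sqrt r" using z(2) by (simp add: dist_norm norm_minus_commute)
    finally have "(norm (y - s n))\<^sup>2 < r"
      using \<open>r > 0\<close> by (metis norm_ge_zero power_strict_mono real_sqrt_pow2 less_imp_le zero_less_numeral)
    moreover have "(norm y)\<^sup>2 = (\<Sum>j<n. (cmod (cinner y (v j)))\<^sup>2) + (norm (y - s n))\<^sup>2"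
      unfolding s_def by (rule weakly_orthonormal_pythagoras[OF v]) simp
    ultimately show "norm ((\<Sum>j<n. (cmod (cinner y (gram_schmidt g j)))\<^sup>2) - (norm y)\<^sup>2) < r"
      by (simp add: v_def)
  qed
qed

section \<open>Bounded operators and adjoints\<close>

lemma bounded_clinearI:
  assumes "\<And>x y. T (x + y) = T x + T y" "\<And>c x. T (c *\<^sub>C x) = c *\<^sub>C T x"
    "\<And>x. norm (T x) \<le> norm x * C"
  shows "bounded_clinear T"
  unfolding bounded_clinear_def
proof
  show "bounded_linear T"
    by (rule bounded_linear_intro[where K = C]) (use assms in \<open>auto simp flip: scaleC_of_real\<close>)
qed (use assms(2) in auto)

lemma bounded_clinear_bounded: "bounded_clinear T \<Longrightarrow> bounded_linear T"
  by (simp add: bounded_clinear_def)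

lemma bounded_clinear_simps:
  assumes "bounded_clinear T"
  shows "T (x + y) = T x + T y" "T (x - y) = T x - T y" "T (- x) = - T x" "T 0 = 0"
    "T (c *\<^sub>C x) = c *\<^sub>C T x" "T (r *\<^sub>R x) = r *\<^sub>R T x"
  using assms by (auto simp: bounded_clinear_def linear_simps)

lemma bounded_clinear_pos_bound:
  assumes "bounded_clinear T"
  obtains b where "b > 0" "\<And>x. norm (T x) \<le> b * norm x"
  using bounded_linear.pos_bounded[OF bounded_clinear_bounded[OF assms]] by (metis mult.commute)

lemma bounded_clinear_comp:
  assumes "bounded_clinear T" "bounded_clinear S" shows "bounded_clinear (\<lambda>x. T (S x))"
  using assms by (auto simp: bounded_clinear_def intro: bounded_linear_compose)

lemma bounded_clinear_add:
  assumes "bounded_clinear T" "bounded_clinear S" shows "bounded_clinear (\<lambda>x. T x + S x)"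
  using assms by (auto simp: bounded_clinear_def scaleC_add_right intro: bounded_linear_add)

lemma bounded_clinear_diff:
  assumes "bounded_clinear T" "bounded_clinear S" shows "bounded_clinear (\<lambda>x. T x - S x)"
  using assms by (auto simp: bounded_clinear_def scaleC_diff_right intro: bounded_linear_sub)

lemma bounded_clinear_ident: "bounded_clinear (\<lambda>x. x)"
  by (simp add: bounded_clinear_def bounded_linear_ident)

lemma bounded_clinear_scaleC:
  assumes "bounded_clinear T" shows "bounded_clinear (\<lambda>x. c *\<^sub>C T x)"
proof -
  obtain b where b: "\<And>x. norm (T x) \<le> b * norm x" using bounded_clinear_pos_bound[OF assms] by blast
  show ?thesis
  proof (rule bounded_clinearI[where C = "cmod c * b"])
    fix x show "norm (c *\<^sub>C T x) \<le> norm x * (cmod c * b)"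
      using mult_left_mono[OF b norm_ge_zero[of c], of x] by (simp add: norm_scaleC mult_ac)
  qed (simp_all add: bounded_clinear_simps[OF assms] scaleC_add_right mult.commute)
qed

lemmas bounded_clinear_intros = bounded_clinear_add bounded_clinear_diff
  bounded_clinear_ident

lemma csubspace_ker: "bounded_clinear T \<Longrightarrow> csubspace (ker T)"
  by (auto simp: csubspace_iff ker_def bounded_clinear_simps)

lemma csubspace_range: 
  assumes "bounded_clinear T" shows "csubspace (range T)"
  unfolding csubspace_iff
  by (metis (no_types, lifting) assms bounded_clinear_simps(1,4,5) rangeE rangeI)

lemma closed_ker:
  assumes "bounded_clinear T" shows "closed (ker T)"
proof -
  have "closed {x. T x = 0}"
    using bounded_linear.continuous_on[OF bounded_clinear_bounded[OF assms] continuous_on_id]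
    by (intro closed_Collect_eq continuous_on_const) auto
  thus ?thesis by (simp add: ker_def)
qed

text \<open>Adjoints enter as pairs of operators. The adjoint of a composite is then found by composing rules,
  and its existence is a question only for operators on \<open>\<ell>\<^sup>2\<close>.\<close>

definition is_adjoint :: "('a :: complex_inner \<Rightarrow> 'b :: complex_inner) \<Rightarrow> ('b \<Rightarrow> 'a) \<Rightarrow> bool" where
  "is_adjoint T S \<longleftrightarrow> bounded_clinear T \<and> bounded_clinear S \<and> (\<forall>x y. cinner (T x) y = cinner x (S y))"

lemma is_adjointD:
  assumes "is_adjoint T S"
  shows "bounded_clinear T" "bounded_clinear S" "cinner (T x) y = cinner x (S y)"
    "cinner (S y) x = cinner y (T x)" "inner (T x) y = inner x (S y)" "inner (S y) x = inner y (T x)"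
proof -
  show "cinner (S y) x = cinner y (T x)"
    using assms by (metis cinner_commute is_adjoint_def)
qed (use assms in \<open>auto simp: is_adjoint_def inner_eq_Re_cinner\<close>,
     metis assms cinner_commute is_adjoint_def complex_cnj_cancel_iff cnj.sel(1))

lemma is_adjoint_sym: "is_adjoint T S \<Longrightarrow> is_adjoint S T"
  unfolding is_adjoint_def[of S T] using is_adjointD by blast

lemma is_adjointI_inner:
  assumes "bounded_clinear T" "bounded_clinear S" "\<And>x y. inner (T x) y = inner x (S y)"
  shows "is_adjoint T S"
  unfolding is_adjoint_def
proof (intro conjI allI assms cinner_eqI)
  fix x y c show "inner (c *\<^sub>C T x) y = inner (c *\<^sub>C x) (S y)"
    using assms(3)[of "c *\<^sub>C x" y] by (simp add: bounded_clinear_simps[OF assms(1)])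
qed

lemma is_adjoint_comp: "is_adjoint T T' \<Longrightarrow> is_adjoint S S' \<Longrightarrow> is_adjoint (\<lambda>x. T (S x)) (\<lambda>y. S' (T' y))"
  by (auto simp: is_adjoint_def bounded_clinear_comp)

lemma is_adjoint_add: "is_adjoint T T' \<Longrightarrow> is_adjoint S S' \<Longrightarrow> is_adjoint (\<lambda>x. T x + S x) (\<lambda>y. T' y + S' y)"
  by (auto simp: is_adjoint_def bounded_clinear_add cinner_simps)

lemma is_adjoint_diff: "is_adjoint T T' \<Longrightarrow> is_adjoint S S' \<Longrightarrow> is_adjoint (\<lambda>x. T x - S x) (\<lambda>y. T' y - S' y)"
  by (auto simp: is_adjoint_def bounded_clinear_diff cinner_simps)

lemma is_adjoint_ident: "is_adjoint (\<lambda>x. x) (\<lambda>x. x)"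
  by (simp add: is_adjoint_def bounded_clinear_ident)

lemmas is_adjoint_intros = is_adjoint_add is_adjoint_diff is_adjoint_ident

lemma cinner_ext: "(\<And>x. cinner x y = cinner x z) \<Longrightarrow> y = z"
proof -
  assume "\<And>x. cinner x y = cinner x z"
  hence "cinner (y - z) (y - z) = 0" by (simp add: cinner_diff_right)
  thus "y = z" by (simp add: cinner_self)
qed

lemma cadjoint_eq:
  assumes "is_adjoint T S" shows "cadjoint T = S"
  unfolding cadjoint_def
proof (rule the_equality)
  fix S' assume "\<forall>x y. cinner (T x) y = cinner x (S' y)"
  thus "S' = S" using assms by (metis cinner_ext is_adjointD(3) ext)
qed (use assms in \<open>auto simp: is_adjoint_def\<close>)

lemma adjoint_bound:
  assumes "is_adjoint T S" "\<And>x. norm (T x) \<le> b * norm x" "b \<ge> 0"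
  shows "norm (S y) \<le> b * norm y"
proof (cases "S y = 0")
  case False
  have "(norm (S y))\<^sup>2 = inner (T (S y)) y"
    by (simp add: is_adjointD(5)[OF assms(1)] power2_norm_eq_inner)
  also have "\<dots> \<le> norm (T (S y)) * norm y" by (rule norm_cauchy_schwarz)
  also have "\<dots> \<le> b * norm (S y) * norm y" by (intro mult_right_mono assms) simp
  finally have "norm (S y) * norm (S y) \<le> norm (S y) * (b * norm y)"
    by (simp add: power2_eq_square mult_ac)
  thus ?thesis using False by (simp add: mult_le_cancel_left)
qed (use assms(3) in simp)

section \<open>The standard basis\<close>

lemma coord_unit_vec: "coord (unit_vec i) j = (if j = i then 1 else 0)"
proof -
  have "summable (\<lambda>j. (cmod (if j = i then 1 else 0))\<^sup>2)"
    by (rule summable_finite[where N = "{i}"]) auto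
  thus ?thesis by (simp add: unit_vec_def coord_Abs_ell2)
qed

lemma cinner_unit_vec: "cinner x (unit_vec i) = coord x i"
proof -
  have "(\<lambda>j. coord x j * cnj (coord (unit_vec i) j)) sums (\<Sum>j\<in>{i}. coord x j * cnj (coord (unit_vec i) j))"
    by (rule sums_finite) (auto simp: coord_unit_vec)
  thus ?thesis by (simp add: cinner_ell2_def sums_iff coord_unit_vec)
qed

lemma coord_sum: "coord (\<Sum>i\<in>I. g i) j = (\<Sum>i\<in>I. coord (g i) j)"
  by (simp add: cinner_sum_left flip: cinner_unit_vec)

lemma sums_coord_norm: "(\<lambda>i. (cmod (coord x i))\<^sup>2) sums (norm x)\<^sup>2"
  unfolding norm_ell2_sq by (rule summable_sums[OF summable_coord])

lemma unit_vec_expansion: "(\<lambda>i. coord x i *\<^sub>C unit_vec i) sums x"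
  unfolding sums_def
proof (rule LIMSEQ_I)
  have tail: "(norm ((\<Sum>i<n. coord x i *\<^sub>C unit_vec i) - x))\<^sup>2 = (norm x)\<^sup>2 - (\<Sum>i<n. (cmod (coord x i))\<^sup>2)" for n
  proof -
    define y where "y = (\<Sum>i<n. coord x i *\<^sub>C unit_vec i) - x"
    have "coord y j = (if j < n then 0 else - coord x j)" for j
      by (simp add: y_def coord_diff coord_sum coord_scaleC coord_unit_vec if_distrib cong: if_cong)
    hence "(\<lambda>j. (cmod (coord y (j + n)))\<^sup>2) sums (norm y)\<^sup>2"
      using sums_split_initial_segment[OF sums_coord_norm[of y], of n] by simp
    moreover have "(\<lambda>j. (cmod (coord y (j + n)))\<^sup>2) sums ((norm x)\<^sup>2 - (\<Sum>i<n. (cmod (coord x i))\<^sup>2))"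
      using sums_split_initial_segment[OF sums_coord_norm[of x], of n]
        \<open>\<And>j. coord y j = (if j < n then 0 else - coord x j)\<close> by simp
    ultimately show ?thesis unfolding y_def[symmetric] by (rule sums_unique2)
  qed
  have lim: "(\<lambda>n. (norm x)\<^sup>2 - (\<Sum>i<n. (cmod (coord x i))\<^sup>2)) \<longlonglongrightarrow> (norm x)\<^sup>2 - (norm x)\<^sup>2"
    by (intro tendsto_diff tendsto_const sums_coord_norm[unfolded sums_def])
  fix r :: real assume "r > 0"
  hence "r\<^sup>2 > 0" by simp
  from LIMSEQ_D[OF lim this] obtain no
    where "\<forall>n\<ge>no. \<bar>(norm x)\<^sup>2 - (\<Sum>i<n. (cmod (coord x i))\<^sup>2)\<bar> < r\<^sup>2" by auto
  hence "\<forall>n\<ge>no. (norm ((\<Sum>i<n. coord x i *\<^sub>C unit_vec i) - x))\<^sup>2 < r\<^sup>2"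
    unfolding tail by auto
  thus "\<exists>no. \<forall>n\<ge>no. norm ((\<Sum>i<n. coord x i *\<^sub>C unit_vec i) - x) < r"
    using \<open>r > 0\<close> power_less_imp_less_base by (metis less_imp_le)
qed

lemma bounded_clinear_unit_vec_expansion:
  assumes "bounded_clinear T" shows "(\<lambda>i. coord x i *\<^sub>C T (unit_vec i)) sums T x"
  using bounded_linear.sums[OF bounded_clinear_bounded[OF assms] unit_vec_expansion[of x]]
  by (simp add: bounded_clinear_simps[OF assms])

lemma bounded_clinear_eqI:
  assumes "bounded_clinear T" "bounded_clinear S" "\<And>i. T (unit_vec i) = S (unit_vec i)"
  shows "T = S"
proof
  fix x show "T x = S x"
    using bounded_clinear_unit_vec_expansion[OF assms(1), of x]
      bounded_clinear_unit_vec_expansion[OF assms(2), of x] by (simp add: assms(3) sums_unique2)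
qed

text \<open>This closed span is where the orthonormalised images of the standard basis satisfy Parseval's
  identity.\<close>

lemma bounded_clinear_range_closure:
  assumes T: "bounded_clinear T"
  shows "T x \<in> closure (cspan (range (\<lambda>i. T (unit_vec i))))"
  unfolding closure_sequential
proof (intro exI conjI allI)
  show "(\<lambda>n. \<Sum>i<n. coord x i *\<^sub>C T (unit_vec i)) \<longlonglongrightarrow> T x"
    using bounded_clinear_unit_vec_expansion[OF T] by (simp add: sums_def)
  show "(\<Sum>i<n. coord x i *\<^sub>C T (unit_vec i)) \<in> cspan (range (\<lambda>i. T (unit_vec i)))" for n
    by (intro complex_vector.span_sum complex_vector.span_scale complex_vector.span_base) auto
qed

text \<open>The adjoint of an operator on \<open>\<ell>\<^sup>2\<close> is the analysis operator of the images of the standard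
  basis; testing \<open>T\<close> on the truncated coefficient sequence itself gives square summability.\<close>

lemma adjoint_exists:
  fixes T :: "ell2 \<Rightarrow> 'a :: complex_inner"
  assumes T: "bounded_clinear T"
  obtains S where "is_adjoint T S"
proof -
  obtain b where b: "b > 0" "\<And>x. norm (T x) \<le> b * norm x" by (rule bounded_clinear_pos_bound[OF T]) blast
  have fin: "(\<Sum>i<n. (cmod (cinner y (T (unit_vec i))))\<^sup>2) \<le> (b * norm y)\<^sup>2" for y n
  proof -
    define s where "s = (\<Sum>i<n. (cmod (cinner y (T (unit_vec i))))\<^sup>2)"
    define z where "z = (\<Sum>i<n. cinner y (T (unit_vec i)) *\<^sub>C unit_vec i)"
    have s0: "s \<ge> 0" unfolding s_def by (intro sum_nonneg) auto
    have Tz: "T z = (\<Sum>i<n. cinner y (T (unit_vec i)) *\<^sub>C T (unit_vec i))"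
      by (simp add: z_def bounded_clinear_simps[OF T]
          linear_sum[OF bounded_linear.linear[OF bounded_clinear_bounded[OF T]]])
    have "cinner z z = (\<Sum>i<n. complex_of_real ((cmod (cinner y (T (unit_vec i))))\<^sup>2))"
      unfolding z_def cinner_sum_right cinner_scaleC_right cinner_unit_vec coord_sum
      by (simp add: coord_scaleC coord_unit_vec if_distrib complex_norm_square mult.commute del: of_real_power cong: if_cong)
    hence nz: "(norm z)\<^sup>2 = s" unfolding cinner_self s_def by (metis of_real_eq_iff of_real_sum)
    have "cinner y (T z) = (\<Sum>i<n. complex_of_real ((cmod (cinner y (T (unit_vec i))))\<^sup>2))"
      unfolding Tz cinner_sum_right cinner_scaleC_right by (simp add: complex_norm_square mult.commute del: of_real_power)
    hence "cinner y (T z) = complex_of_real s" by (simp add: s_def)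
    hence "s = cmod (cinner y (T z))" using s0 by simp
    also have "\<dots> \<le> norm y * norm (T z)" by (rule cinner_cauchy_schwarz)
    also have "\<dots> \<le> norm y * (b * norm z)" by (intro mult_left_mono b) simp
    finally have *: "s \<le> b * norm y * norm z" by (simp add: mult_ac)
    have "s \<le> (b * norm y)\<^sup>2"
    proof (cases "norm z = 0")
      case False
      have "norm z * norm z \<le> (b * norm y) * norm z" using * nz by (simp add: power2_eq_square)
      hence "norm z \<le> b * norm y" using False by (simp add: mult_right_le_imp_le)
      thus ?thesis unfolding nz[symmetric] by (simp add: power_mono)
    qed (use nz in auto)
    thus ?thesis by (simp add: s_def)
  qed
  have sm: "summable (\<lambda>i. (cmod (cinner y (T (unit_vec i))))\<^sup>2)" for y
    using fin by (intro summableI_nonneg_bounded) auto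
  define S where "S = (\<lambda>y. Abs_ell2 (\<lambda>i. cinner y (T (unit_vec i))))"
  have coordS: "coord (S y) i = cinner y (T (unit_vec i))" for y i
    using sm by (simp add: S_def coord_Abs_ell2)
  have "is_adjoint T S"
    unfolding is_adjoint_def
  proof (intro conjI allI T)
    show "bounded_clinear S"
    proof (rule bounded_clinearI[where C = b])
      fix y
      have "(norm (S y))\<^sup>2 \<le> (b * norm y)\<^sup>2"
        unfolding norm_ell2_sq coordS by (rule suminf_le_const[OF sm fin])
      thus "norm (S y) \<le> norm y * b"
        by (metis b(1) less_imp_le mult.commute mult_nonneg_nonneg norm_ge_zero power2_le_imp_le)
    qed (auto intro!: ell2_eqI simp: coordS coord_simps cinner_simps)
    fix x y
    have "(\<lambda>i. cinner (coord x i *\<^sub>C T (unit_vec i)) y) sums cinner (T x) y"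
      by (rule bounded_linear.sums[OF bounded_linear_cinner_left bounded_clinear_unit_vec_expansion[OF T]])
    hence "(\<lambda>i. coord x i * cnj (coord (S y) i)) sums cinner (T x) y"
      by (simp add: cinner_scaleC_left coordS cinner_commute[of y] )
    thus "cinner (T x) y = cinner x (S y)" by (simp add: cinner_ell2_def sums_iff)
  qed
  thus ?thesis by (rule that)
qed

text \<open>The bound on finite combinations, applied to the tails of a square summable sequence, makes the
  series for \<open>F x\<close> Cauchy.\<close>

lemma operator_from_basis_images:
  fixes f :: "nat \<Rightarrow> 'a :: complex_hilbert"
  assumes bound: "\<And>I c. finite I \<Longrightarrow> (norm (\<Sum>i\<in>I. c i *\<^sub>C f i))\<^sup>2 \<le> B * (\<Sum>i\<in>I. (cmod (c i))\<^sup>2)"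
    and B: "B > 0"
  obtains F where "bounded_clinear F" "\<And>i. F (unit_vec i) = f i"
proof -
  have sm: "summable (\<lambda>i. coord x i *\<^sub>C f i)" for x
    unfolding summable_Cauchy
  proof (intro allI impI)
    fix e :: real assume "e > 0"
    hence "e\<^sup>2 / B > 0" using B by simp
    then obtain N where N: "\<forall>m\<ge>N. \<forall>n. norm (\<Sum>i=m..<n. (cmod (coord x i))\<^sup>2) < e\<^sup>2 / B"
      using summable_coord[of x] unfolding summable_Cauchy by blast
    show "\<exists>N. \<forall>m\<ge>N. \<forall>n. norm (\<Sum>i=m..<n. coord x i *\<^sub>C f i) < e"
    proof (intro exI allI impI)
      fix m n assume "N \<le> m"
      hence "(\<Sum>i=m..<n. (cmod (coord x i))\<^sup>2) < e\<^sup>2 / B" using N abs_ge_self le_less_trans unfolding real_norm_def by blast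
      hence "B * (\<Sum>i=m..<n. (cmod (coord x i))\<^sup>2) < e\<^sup>2" using B by (simp add: field_simps)
      hence "(norm (\<Sum>i=m..<n. coord x i *\<^sub>C f i))\<^sup>2 < e\<^sup>2"
        using bound[of "{m..<n}" "coord x"] by simp
      thus "norm (\<Sum>i=m..<n. coord x i *\<^sub>C f i) < e" using \<open>e > 0\<close> power_less_imp_less_base by (metis less_imp_le)
    qed
  qed
  define F where "F = (\<lambda>x. \<Sum>i. coord x i *\<^sub>C f i)"
  have F: "(\<lambda>i. coord x i *\<^sub>C f i) sums F x" for x using sm by (simp add: F_def summable_sums)
  show ?thesis
  proof
    show "bounded_clinear F"
    proof (rule bounded_clinearI[where C = "sqrt B"])
      fix x y c
      show "F (x + y) = F x + F y"
        using sums_add[OF F[of x] F[of y]] F[of "x + y"] by (simp add: coord_simps scaleC_add_left sums_unique2)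
      have "bounded_linear (\<lambda>y :: 'a. c *\<^sub>C y)"
        using bounded_clinear_scaleC[OF bounded_clinear_ident] by (rule bounded_clinear_bounded)
      from bounded_linear.sums[OF this F[of x]] show "F (c *\<^sub>C x) = c *\<^sub>C F x"
        using F[of "c *\<^sub>C x"] by (simp add: coord_simps sums_unique2)
      have "(norm (F x))\<^sup>2 \<le> B * (norm x)\<^sup>2"
      proof (rule LIMSEQ_le_const2)
        show "(\<lambda>n. (norm (\<Sum>i<n. coord x i *\<^sub>C f i))\<^sup>2) \<longlonglongrightarrow> (norm (F x))\<^sup>2"
          by (intro tendsto_intros F[unfolded sums_def])
        have "(norm (\<Sum>i<n. coord x i *\<^sub>C f i))\<^sup>2 \<le> B * (norm x)\<^sup>2" for n
          using bound[of "{..<n}" "coord x"] sum_coord_le_norm[of x n] B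
          by (meson finite_lessThan less_imp_le mult_left_mono order_trans)
        thus "\<exists>N. \<forall>n\<ge>N. (norm (\<Sum>i<n. coord x i *\<^sub>C f i))\<^sup>2 \<le> B * (norm x)\<^sup>2" by blast
      qed
      hence "sqrt ((norm (F x))\<^sup>2) \<le> sqrt (B * (norm x)\<^sup>2)" by (rule real_sqrt_le_mono)
      thus "norm (F x) \<le> norm x * sqrt B" by (simp add: real_sqrt_mult mult.commute)
    qed
    fix i
    have "(\<lambda>j. coord (unit_vec i) j *\<^sub>C f j) sums (\<Sum>j\<in>{i}. coord (unit_vec i) j *\<^sub>C f j)"
      by (rule sums_finite) (auto simp: coord_unit_vec)
    thus "F (unit_vec i) = f i" using F[of "unit_vec i"] by (simp add: coord_unit_vec sums_unique2)
  qed
qed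

lemma synthesis_eq:
  assumes "bounded_clinear F" "\<And>i. F (unit_vec i) = f i"
  shows "synthesis f = F"
  unfolding synthesis_def using assms by (intro the_equality) (auto intro: bounded_clinear_eqI)

section \<open>Hilbert-Schmidt operators\<close>

definition hs_ennreal :: "(ell2 \<Rightarrow> 'a :: complex_inner) \<Rightarrow> ennreal" where
  "hs_ennreal T = (\<Sum>i. ennreal ((norm (T (unit_vec i)))\<^sup>2))"

definition hilbert_schmidt :: "(ell2 \<Rightarrow> 'a :: complex_inner) \<Rightarrow> bool" where
  "hilbert_schmidt T \<longleftrightarrow> summable (\<lambda>i. (norm (T (unit_vec i)))\<^sup>2)"

definition hs_sq :: "(ell2 \<Rightarrow> 'a :: complex_inner) \<Rightarrow> real" where
  "hs_sq T = (\<Sum>i. (norm (T (unit_vec i)))\<^sup>2)"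

text \<open>This is the real part of the trace of \<open>N\<^sup>* M\<close>; all the estimates below are about real parts.\<close>

definition hs_inner :: "(ell2 \<Rightarrow> 'a :: complex_inner) \<Rightarrow> (ell2 \<Rightarrow> 'a) \<Rightarrow> real" where
  "hs_inner M N = (\<Sum>i. inner (M (unit_vec i)) (N (unit_vec i)))"

lemma hs_ennreal_eq: "hilbert_schmidt T \<Longrightarrow> hs_ennreal T = ennreal (hs_sq T)"
  unfolding hs_ennreal_def hs_sq_def hilbert_schmidt_def by (rule suminf_ennreal2) auto

lemma hilbert_schmidt_iff: "hilbert_schmidt T \<longleftrightarrow> hs_ennreal T < \<infinity>"
proof
  assume "hs_ennreal T < \<infinity>"
  thus "hilbert_schmidt T"
    unfolding hs_ennreal_def hilbert_schmidt_def by (intro summable_suminf_not_top) auto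
qed (simp add: hs_ennreal_eq)

lemma hs_sq_nonneg: "hilbert_schmidt T \<Longrightarrow> 0 \<le> hs_sq T"
  unfolding hs_sq_def hilbert_schmidt_def by (rule suminf_nonneg) auto

lemma hs_sq_eqI: "hs_ennreal T = hs_ennreal S \<Longrightarrow> hilbert_schmidt T \<Longrightarrow> hs_sq T = hs_sq S"
  using hs_ennreal_eq[of T] hs_ennreal_eq[of S] hilbert_schmidt_iff hs_sq_nonneg
  by (metis ennreal_inj)

lemma suminf_swap_ennreal:
  fixes h :: "nat \<Rightarrow> nat \<Rightarrow> ennreal"
  shows "(\<Sum>i. \<Sum>j. h i j) = (\<Sum>j. \<Sum>i. h i j)"
  using nn_integral_suminf[of "\<lambda>i j. h i j" "count_space UNIV"]
  by (simp add: nn_integral_count_space_nat)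

text \<open>Both sides are the sum of \<open>\<bar>\<langle>T e\<^sub>i, v\<^sub>j\<rangle>\<bar>\<^sup>2\<close> over all \<open>i\<close> and \<open>j\<close>.\<close>

lemma hs_ennreal_eq_adjoint:
  assumes adj: "is_adjoint T S"
    and v: "\<And>x. (\<lambda>j. (cmod (cinner (T x) (v j)))\<^sup>2) sums (norm (T x))\<^sup>2"
  shows "hs_ennreal T = (\<Sum>j. ennreal ((norm (S (v j)))\<^sup>2))"
proof -
  define h where "h i j = (cmod (cinner (T (unit_vec i)) (v j)))\<^sup>2" for i j :: nat
  have "(\<Sum>j. ennreal (h i j)) = ennreal ((norm (T (unit_vec i)))\<^sup>2)" for i
    unfolding h_def by (rule suminf_ennreal_eq[OF _ v]) auto
  moreover have "(\<Sum>i. ennreal (h i j)) = ennreal ((norm (S (v j)))\<^sup>2)" for j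
  proof -
    have "h i j = (cmod (coord (S (v j)) i))\<^sup>2" for i
      unfolding h_def is_adjointD(3)[OF adj]
      using cinner_commute[of "unit_vec i" "S (v j)"] by (simp add: cinner_unit_vec)
    hence "(\<Sum>i. ennreal (h i j)) = (\<Sum>i. ennreal ((cmod (coord (S (v j)) i))\<^sup>2))" by simp
    also have "\<dots> = ennreal ((norm (S (v j)))\<^sup>2)"
      by (rule suminf_ennreal_eq[OF _ sums_coord_norm]) simp
    finally show ?thesis .
  qed
  ultimately show ?thesis
    unfolding hs_ennreal_def using suminf_swap_ennreal[of "\<lambda>i j. ennreal (h i j)"] by simp
qed

lemma hs_ennreal_adjoint:
  fixes T :: "ell2 \<Rightarrow> ell2"
  assumes "is_adjoint T S"
  shows "hs_ennreal T = hs_ennreal S"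
  unfolding hs_ennreal_def[of S]
  by (rule hs_ennreal_eq_adjoint[OF assms]) (simp add: cinner_unit_vec sums_coord_norm)

lemma hilbert_schmidt_adjoint:
  fixes T :: "ell2 \<Rightarrow> ell2"
  shows "is_adjoint T S \<Longrightarrow> hilbert_schmidt T \<Longrightarrow> hilbert_schmidt S"
  by (simp add: hilbert_schmidt_iff hs_ennreal_adjoint)

lemma hs_sq_adjoint:
  fixes T :: "ell2 \<Rightarrow> ell2"
  shows "is_adjoint T S \<Longrightarrow> hilbert_schmidt T \<Longrightarrow> hs_sq T = hs_sq S"
  by (intro hs_sq_eqI hs_ennreal_adjoint)

lemma hilbert_schmidt_dominated:
  assumes "hilbert_schmidt S" "\<And>x. norm (T x) \<le> c * norm (S x)"
  shows "hilbert_schmidt T"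
  unfolding hilbert_schmidt_def
proof (rule summable_comparison_test'[where N = 0 and g = "\<lambda>i. c\<^sup>2 * (norm (S (unit_vec i)))\<^sup>2"])
  show "summable (\<lambda>i. c\<^sup>2 * (norm (S (unit_vec i)))\<^sup>2)"
    using assms(1) by (intro summable_mult) (simp add: hilbert_schmidt_def)
  show "norm ((norm (T (unit_vec n)))\<^sup>2) \<le> c\<^sup>2 * (norm (S (unit_vec n)))\<^sup>2" for n
    using power_mono[OF assms(2)[of "unit_vec n"] norm_ge_zero, of 2] by (simp add: power_mult_distrib)
qed

lemma hilbert_schmidt_comp_left:
  assumes "bounded_clinear A" "hilbert_schmidt T"
  shows "hilbert_schmidt (\<lambda>x. A (T x))"
  using bounded_clinear_pos_bound[OF assms(1)] hilbert_schmidt_dominated[OF assms(2)] by metis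

text \<open>The operator \<open>T B\<close> is compared with \<open>T\<close> through the adjoints: \<open>(T B)\<^sup>* = B\<^sup>* T\<^sup>*\<close>, where
  the bounded factor acts from the left. The vectors \<open>v\<^sub>j\<close> are an orthonormalisation of the \<open>T e\<^sub>i\<close>
  and satisfy Parseval's identity on the range of \<open>T\<close>.\<close>

lemma hs_ennreal_comp_right:
  fixes T :: "ell2 \<Rightarrow> 'a :: complex_inner"
  assumes T: "bounded_clinear T" and B: "bounded_clinear B" "\<And>x. norm (B x) \<le> b * norm x" "b \<ge> 0"
  shows "hs_ennreal (\<lambda>x. T (B x)) \<le> ennreal (b\<^sup>2) * hs_ennreal T"
proof -
  obtain T' where T': "is_adjoint T T'" by (rule adjoint_exists[OF T])
  obtain B' where B': "is_adjoint B B'" by (rule adjoint_exists[OF B(1)])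
  define v where "v = gram_schmidt (\<lambda>i. T (unit_vec i))"
  have v: "(\<lambda>j. (cmod (cinner (T x) (v j)))\<^sup>2) sums (norm (T x))\<^sup>2" for x
    unfolding v_def by (rule gram_schmidt_parseval[OF bounded_clinear_range_closure[OF T]])
  have "hs_ennreal (\<lambda>x. T (B x)) = (\<Sum>j. ennreal ((norm (B' (T' (v j))))\<^sup>2))"
    by (rule hs_ennreal_eq_adjoint[OF is_adjoint_comp[OF T' B'] v])
  also have "\<dots> \<le> (\<Sum>j. ennreal (b\<^sup>2) * ennreal ((norm (T' (v j)))\<^sup>2))"
  proof (intro suminf_le summableI)
    fix j
    have "(norm (B' (T' (v j))))\<^sup>2 \<le> (b * norm (T' (v j)))\<^sup>2"
      by (intro power_mono adjoint_bound[OF B'] B) auto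
    thus "ennreal ((norm (B' (T' (v j))))\<^sup>2) \<le> ennreal (b\<^sup>2) * ennreal ((norm (T' (v j)))\<^sup>2)"
      by (simp add: power_mult_distrib flip: ennreal_mult)
  qed
  also have "\<dots> = ennreal (b\<^sup>2) * hs_ennreal T"
    unfolding ennreal_suminf_cmult hs_ennreal_eq_adjoint[OF T' v] ..
  finally show ?thesis .
qed

lemma hilbert_schmidt_comp_right:
  fixes T :: "ell2 \<Rightarrow> 'a :: complex_inner"
  assumes "bounded_clinear T" "hilbert_schmidt T" "bounded_clinear B"
  shows "hilbert_schmidt (\<lambda>x. T (B x))"
proof -
  obtain b where b: "b > 0" "\<And>x. norm (B x) \<le> b * norm x"
    by (rule bounded_clinear_pos_bound[OF assms(3)]) blast
  have "hs_ennreal (\<lambda>x. T (B x)) \<le> ennreal (b\<^sup>2) * hs_ennreal T"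
    using b by (intro hs_ennreal_comp_right assms) auto
  also have "\<dots> < \<infinity>" using assms(2) by (simp add: hilbert_schmidt_iff ennreal_mult_less_top)
  finally show ?thesis by (simp add: hilbert_schmidt_iff)
qed

lemma hs_sq_comp_contraction:
  fixes T :: "ell2 \<Rightarrow> 'a :: complex_inner"
  assumes "bounded_clinear T" "hilbert_schmidt T" "bounded_clinear B" "\<And>x. norm (B x) \<le> norm x"
  shows "hs_sq (\<lambda>x. T (B x)) \<le> hs_sq T"
proof -
  have "hs_ennreal (\<lambda>x. T (B x)) \<le> ennreal (1\<^sup>2) * hs_ennreal T"
    using assms by (intro hs_ennreal_comp_right) auto
  thus ?thesis
    using hs_ennreal_eq[OF assms(2)] hs_ennreal_eq[OF hilbert_schmidt_comp_right[OF assms(1-3)]]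
      hs_sq_nonneg[OF assms(2)] by (simp add: ennreal_le_iff)
qed

lemma summable_hs_inner:
  assumes "hilbert_schmidt M" "hilbert_schmidt N"
  shows "summable (\<lambda>i. inner (M (unit_vec i)) (N (unit_vec i)))"
proof (rule summable_comparison_test'[where N = 0 and
      g = "\<lambda>i. (norm (M (unit_vec i)))\<^sup>2 + (norm (N (unit_vec i)))\<^sup>2"])
  show "summable (\<lambda>i. (norm (M (unit_vec i)))\<^sup>2 + (norm (N (unit_vec i)))\<^sup>2)"
    using assms by (intro summable_add) (auto simp: hilbert_schmidt_def)
  fix i
  have "\<bar>inner x y\<bar> \<le> (norm x)\<^sup>2 + (norm y)\<^sup>2" for x y :: 'a
  proof -
    have "\<bar>inner x y\<bar> \<le> norm x * norm y" by (rule Cauchy_Schwarz_ineq2)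
    also have "\<dots> \<le> (norm x)\<^sup>2 + (norm y)\<^sup>2"
      using zero_le_power2[of "norm x - norm y"] mult_nonneg_nonneg[OF norm_ge_zero[of x] norm_ge_zero[of y]]
      unfolding power2_diff by linarith
    finally show ?thesis .
  qed
  thus "norm (inner (M (unit_vec i)) (N (unit_vec i))) \<le> (norm (M (unit_vec i)))\<^sup>2 + (norm (N (unit_vec i)))\<^sup>2"
    by simp
qed

lemma sums_hs_inner:
  assumes "hilbert_schmidt M" "hilbert_schmidt N"
  shows "(\<lambda>i. inner (M (unit_vec i)) (N (unit_vec i))) sums hs_inner M N"
  unfolding hs_inner_def by (rule summable_sums[OF summable_hs_inner[OF assms]])

lemma sums_hs_sq: "hilbert_schmidt T \<Longrightarrow> (\<lambda>i. (norm (T (unit_vec i)))\<^sup>2) sums hs_sq T"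
  unfolding hs_sq_def hilbert_schmidt_def by (rule summable_sums)

lemma hs_inner_self: "hs_inner T T = hs_sq T"
  by (simp add: hs_inner_def hs_sq_def power2_norm_eq_inner)

lemma hs_inner_commute: "hs_inner M N = hs_inner N M"
  by (simp add: hs_inner_def inner_commute)

lemma hilbert_schmidt_add:
  assumes "hilbert_schmidt M" "hilbert_schmidt N"
  shows "hilbert_schmidt (\<lambda>x. M x + N x)"
    and "hs_sq (\<lambda>x. M x + N x) = hs_sq M + 2 * hs_inner M N + hs_sq N"
proof -
  have "(\<lambda>i. (norm (M (unit_vec i)))\<^sup>2 + 2 * inner (M (unit_vec i)) (N (unit_vec i)) + (norm (N (unit_vec i)))\<^sup>2)
    sums (hs_sq M + 2 * hs_inner M N + hs_sq N)"
    by (intro sums_add sums_mult sums_hs_inner sums_hs_sq assms)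
  hence "(\<lambda>i. (norm (M (unit_vec i) + N (unit_vec i)))\<^sup>2) sums (hs_sq M + 2 * hs_inner M N + hs_sq N)"
    by (simp add: power2_norm_eq_inner inner_add inner_commute algebra_simps)
  thus "hilbert_schmidt (\<lambda>x. M x + N x)"
    and "hs_sq (\<lambda>x. M x + N x) = hs_sq M + 2 * hs_inner M N + hs_sq N"
    by (auto simp: hilbert_schmidt_def hs_sq_def sums_iff)
qed

lemma hilbert_schmidt_scaleR:
  assumes "hilbert_schmidt M"
  shows "hilbert_schmidt (\<lambda>x. r *\<^sub>R M x)" and "hs_sq (\<lambda>x. r *\<^sub>R M x) = r\<^sup>2 * hs_sq M"
  using sums_mult[OF sums_hs_sq[OF assms], of "r\<^sup>2"]
  by (auto simp: hilbert_schmidt_def hs_sq_def sums_iff power_mult_distrib)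

lemma hs_inner_add_left:
  assumes "hilbert_schmidt L" "hilbert_schmidt M" "hilbert_schmidt N"
  shows "hs_inner (\<lambda>x. L x + M x) N = hs_inner L N + hs_inner M N"
  using sums_add[OF sums_hs_inner[OF assms(1,3)] sums_hs_inner[OF assms(2,3)]]
  by (simp add: hs_inner_def sums_iff inner_add_left)

lemma hs_inner_scaleR_right:
  assumes "hilbert_schmidt M" "hilbert_schmidt N"
  shows "hs_inner M (\<lambda>x. r *\<^sub>R N x) = r * hs_inner M N"
  using sums_mult[OF sums_hs_inner[OF assms], of r] by (simp add: hs_inner_def sums_iff)

lemma hs_inner_add_right:
  assumes "hilbert_schmidt L" "hilbert_schmidt M" "hilbert_schmidt N"
  shows "hs_inner N (\<lambda>x. L x + M x) = hs_inner N L + hs_inner N M"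
  using hs_inner_add_left[OF assms] by (simp add: hs_inner_commute)

lemma hilbert_schmidt_diff:
  assumes "hilbert_schmidt M" "hilbert_schmidt N"
  shows "hilbert_schmidt (\<lambda>x. M x - N x)"
    and "hs_sq (\<lambda>x. M x - N x) = hs_sq M - 2 * hs_inner M N + hs_sq N"
  using hilbert_schmidt_add[OF assms(1) hilbert_schmidt_scaleR(1)[OF assms(2), of "-1"]]
    hilbert_schmidt_scaleR(2)[OF assms(2), of "-1"] hs_inner_scaleR_right[OF assms, of "-1"]
  by simp_all

text \<open>This is the polarised form of the invariance of the Hilbert-Schmidt norm under adjoints.\<close>

lemma hs_inner_adjoint:
  fixes M N :: "ell2 \<Rightarrow> ell2"
  assumes "is_adjoint M M'" "is_adjoint N N'" "hilbert_schmidt M" "hilbert_schmidt N"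
  shows "hs_inner M N = hs_inner M' N'"
proof -
  have hs': "hilbert_schmidt M'" "hilbert_schmidt N'" using assms hilbert_schmidt_adjoint by blast+
  have "hs_sq (\<lambda>x. M x + N x) = hs_sq (\<lambda>x. M' x + N' x)"
    by (intro hs_sq_adjoint is_adjoint_add hilbert_schmidt_add assms)
  thus ?thesis
    using hs_sq_adjoint[OF assms(1,3)] hs_sq_adjoint[OF assms(2,4)]
    unfolding hilbert_schmidt_add(2)[OF assms(3,4)] hilbert_schmidt_add(2)[OF hs'] by simp
qed

section \<open>Orthogonal projections\<close>

definition is_projection :: "('a :: complex_inner \<Rightarrow> 'a) \<Rightarrow> bool" where
  "is_projection P \<longleftrightarrow> is_adjoint P P \<and> (\<forall>x. P (P x) = P x)"

lemma is_projectionD: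
  assumes "is_projection P"
  shows "is_adjoint P P" "P (P x) = P x" "bounded_clinear P"
  using assms by (auto simp: is_projection_def is_adjoint_def)

lemma projection_pythagoras:
  assumes P: "is_projection P" shows "(norm x)\<^sup>2 = (norm (P x))\<^sup>2 + (norm (x - P x))\<^sup>2"
proof -
  have "inner (P x) (P x) = inner (P x) x" "inner x (P x) = inner (P x) x"
    using is_adjointD(5)[OF is_projectionD(1)[OF P]] is_projectionD(2)[OF P] inner_commute by metis+
  thus ?thesis by (simp add: power2_norm_eq_inner inner_diff)
qed

lemma projection_norm_le: "is_projection P \<Longrightarrow> norm (P x) \<le> norm x"
  using projection_pythagoras[of P x] by (metis le_add_same_cancel1 norm_ge_zero power2_le_imp_le zero_le_power2)

lemma projection_norm_eq: "is_projection P \<Longrightarrow> norm (P x) = norm x \<Longrightarrow> P x = x"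
  using projection_pythagoras[of P x] by simp

lemma projection_complement: "is_projection P \<Longrightarrow> is_projection (\<lambda>x. x - P x)"
  unfolding is_projection_def
  by (auto intro: is_adjoint_intros simp: bounded_clinear_simps(2)[OF is_adjointD(1)])

lemma projection_range_iff: "is_projection P \<Longrightarrow> x \<in> range P \<longleftrightarrow> P x = x"
  by (metis is_projectionD(2) rangeE rangeI)

lemma closed_projection_range:
  assumes P: "is_projection P" shows "closed (range P)"
proof -
  have "range P = ker (\<lambda>x. x - P x)" 
    by (rule set_eqI, simp only: projection_range_iff[OF P]) (auto simp: ker_def)
  thus ?thesis using closed_ker[OF is_projectionD(3)[OF projection_complement[OF P]]] by simp
qed

text \<open>The reflection \<open>2 P - 1\<close> is isometric, so composing with it leaves the Hilbert-Schmidt norm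
  unchanged; this forces the mixed terms to cancel.\<close>

lemma hs_inner_projection_complement:
  fixes M N :: "ell2 \<Rightarrow> 'a :: complex_inner"
  assumes P: "is_projection P" and M: "bounded_clinear M" "hilbert_schmidt M"
    and N: "bounded_clinear N" "hilbert_schmidt N"
  shows "hs_inner (\<lambda>x. M (P x)) (\<lambda>x. N (x - P x)) = 0"
proof -
  note Pb = is_projectionD(3)[OF P] and PP = is_projectionD(2)[OF P]
  note lin = bounded_clinear_simps[OF Pb] bounded_clinear_simps[OF M(1)] bounded_clinear_simps[OF N(1)]
  have Cb: "bounded_clinear (\<lambda>x. x - P x)" by (intro bounded_clinear_intros Pb bounded_clinear_ident)
  define J where "J x = P x - (x - P x)" for x
  have J: "bounded_clinear J" unfolding J_def by (intro bounded_clinear_intros Pb bounded_clinear_ident)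
  have "(norm (J x))\<^sup>2 = (norm x)\<^sup>2" for x
  proof -
    have "inner (P x) (x - P x) = 0"
      using is_adjointD(5)[OF is_projectionD(1)[OF P], of x "x - P x"] by (simp add: lin PP)
    thus ?thesis
      unfolding projection_pythagoras[OF P, of x] J_def
      by (simp only: power2_norm_eq_inner inner_diff[of "P x" "x - P x"] inner_commute)
        (simp add: inner_diff inner_commute)
  qed
  hence Jn: "norm (J x) \<le> norm x" for x by (metis norm_ge_zero order_refl power2_le_imp_le)
  define T where "T x = M (P x) + N (x - P x)" for x
  have MP: "hilbert_schmidt (\<lambda>x. M (P x))" and NC: "hilbert_schmidt (\<lambda>x. N (x - P x))"
    using hilbert_schmidt_comp_right[OF M Pb] hilbert_schmidt_comp_right[OF N Cb] .
  have T: "bounded_clinear T" "hilbert_schmidt T"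
    unfolding T_def by (intro bounded_clinear_add bounded_clinear_comp[OF M(1) Pb] bounded_clinear_comp[OF N(1) Cb])
      (rule hilbert_schmidt_add(1)[OF MP NC])
  have TJ: "T (J x) = M (P x) - N (x - P x)" for x by (simp add: T_def J_def lin PP)
  have "hs_sq (\<lambda>x. T (J x)) \<le> hs_sq T" by (rule hs_sq_comp_contraction[OF T J Jn])
  moreover have "hs_sq (\<lambda>x. T (J (J x))) \<le> hs_sq (\<lambda>x. T (J x))"
    using hs_sq_comp_contraction[OF bounded_clinear_comp[OF T(1) J] hilbert_schmidt_comp_right[OF T J] J Jn] .
  moreover have "J (J x) = x" for x by (simp add: J_def lin PP)
  ultimately have "hs_sq (\<lambda>x. T (J x)) = hs_sq T" by simp
  thus ?thesis
    unfolding TJ hilbert_schmidt_diff(2)[OF MP NC] unfolding T_def hilbert_schmidt_add(2)[OF MP NC] by simp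
qed

text \<open>The standard basis need not be adapted to \<open>P\<close>, so the splitting holds for the sums and not term by
  term.\<close>

lemma hs_sq_projection_split:
  fixes T :: "ell2 \<Rightarrow> 'a :: complex_inner"
  assumes P: "is_projection P" and T: "bounded_clinear T" "hilbert_schmidt T"
  shows "hs_sq T = hs_sq (\<lambda>x. T (P x)) + hs_sq (\<lambda>x. T (x - P x))"
proof -
  have hs: "hilbert_schmidt (\<lambda>x. T (P x))" "hilbert_schmidt (\<lambda>x. T (x - P x))"
    using hilbert_schmidt_comp_right[OF T] is_projectionD(3)[OF P]
      is_projectionD(3)[OF projection_complement[OF P]] by blast+
  have "T = (\<lambda>x. T (P x) + T (x - P x))" by (simp add: bounded_clinear_simps[OF T(1)])
  thus ?thesis
    using hilbert_schmidt_add(2)[OF hs] hs_inner_projection_complement[OF P T T] by simp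
qed

section \<open>Positive operators\<close>

lemma positive_operator_self_adjoint:
  assumes A: "positive_operator A" shows "is_adjoint A A"
proof -
  have Ab: "bounded_clinear A" and real: "Im (cinner (A x) x) = 0" for x
    using A by (auto simp: positive_operator_def complex_is_Real_iff)
  note lin = bounded_clinear_simps[OF Ab]
  have im: "Im (cinner (A x) y) + Im (cinner (A y) x) = 0" for x y
    using real[of "x + y"] real[of x] real[of y] by (simp add: lin cinner_simps)
  show ?thesis
  proof (rule is_adjointI_inner[OF Ab Ab])
    fix x y
    show "inner (A x) y = inner x (A y)"
      using im[of x "\<i> *\<^sub>C y"] cinner_commute[of x "A y"]
      by (simp add: lin cinner_simps inner_eq_Re_cinner)
  qed
qed

text \<open>Expand \<open>\<langle>A z, z\<rangle> \<ge> 0\<close> at \<open>z = x - A x / b\<close>.\<close>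

lemma positive_operator_norm_sq_le:
  assumes A: "positive_operator A" and b: "b > 0" "\<And>x. norm (A x) \<le> b * norm x"
  shows "(norm (A x))\<^sup>2 \<le> b * inner (A x) x"
proof -
  note adj = positive_operator_self_adjoint[OF A]
  note lin = bounded_clinear_simps[OF is_adjointD(1)[OF adj]]
  have pos: "0 \<le> inner (A z) z" for z using A by (simp add: positive_operator_def inner_eq_Re_cinner)
  have "inner (A (A x)) (A x) \<le> norm (A (A x)) * norm (A x)" by (rule norm_cauchy_schwarz)
  also have "\<dots> \<le> b * norm (A x) * norm (A x)" by (intro mult_right_mono b) simp
  finally have *: "inner (A (A x)) (A x) \<le> b * (norm (A x))\<^sup>2" by (simp add: power2_eq_square mult_ac)
  define t where "t = 1 / b"
  have t: "t > 0" "b * t = 1" using b(1) by (auto simp: t_def)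
  have "0 \<le> inner (A (x - t *\<^sub>R A x)) (x - t *\<^sub>R A x)" by (rule pos)
  also have "\<dots> = inner (A x) x - 2 * t * (norm (A x))\<^sup>2 + t\<^sup>2 * inner (A (A x)) (A x)"
    unfolding power2_norm_eq_inner
    by (simp add: lin inner_diff_left inner_diff_right power2_eq_square
        is_adjointD(5)[OF adj, of "A x" x] algebra_simps)
  also have "\<dots> \<le> inner (A x) x - 2 * t * (norm (A x))\<^sup>2 + t\<^sup>2 * (b * (norm (A x))\<^sup>2)"
    by (intro add_left_mono mult_left_mono *) simp
  also have "t\<^sup>2 * (b * (norm (A x))\<^sup>2) = t * (b * t) * (norm (A x))\<^sup>2"
    by (simp add: power2_eq_square)
  finally have "0 \<le> inner (A x) x - t * (norm (A x))\<^sup>2" by (simp add: t)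
  hence "0 \<le> b * (inner (A x) x - t * (norm (A x))\<^sup>2)" using b(1) by simp
  also have "\<dots> = b * inner (A x) x - (b * t) * (norm (A x))\<^sup>2" by (simp add: right_diff_distrib)
  finally show ?thesis by (simp add: t)
qed

text \<open>The operator \<open>1 - A / b\<close> is a contraction, so \<open>T (1 - A / b)\<close> has at most the Hilbert-Schmidt
  norm of \<open>T\<close>. In this form the positivity of the trace of \<open>T A T\<^sup>*\<close> comes without a square root of
  \<open>A\<close>, and it is quantitative.\<close>

lemma hs_inner_positive:
  fixes T :: "ell2 \<Rightarrow> 'a :: complex_inner"
  assumes A: "positive_operator A" and b: "b > 0" "\<And>x. norm (A x) \<le> b * norm x"
    and T: "bounded_clinear T" "hilbert_schmidt T"
  shows "hs_sq (\<lambda>x. T (A x)) \<le> 2 * b * hs_inner (\<lambda>x. T (A x)) T"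
proof -
  have Ab: "bounded_clinear A" using A by (simp add: positive_operator_def)
  define t where "t = 1 / b"
  have t: "t > 0" "b * t = 1" using b(1) by (auto simp: t_def)
  define B where "B x = x - t *\<^sub>R A x" for x
  have B: "bounded_clinear B"
    unfolding B_def using bounded_clinear_diff[OF bounded_clinear_ident bounded_clinear_scaleC[OF Ab, of "of_real t"]]
    by (simp only: scaleC_of_real)
  have Bn: "norm (B x) \<le> norm x" for x
  proof -
    have "(norm (B x))\<^sup>2 = (norm x)\<^sup>2 - 2 * t * inner (A x) x + t\<^sup>2 * (norm (A x))\<^sup>2"
      unfolding power2_norm_eq_inner B_def
      by (simp add: inner_diff_left inner_diff_right inner_commute[of x "A x"]
          power2_eq_square algebra_simps)
    also have "\<dots> \<le> (norm x)\<^sup>2 - 2 * t * inner (A x) x + t\<^sup>2 * (b * inner (A x) x)"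
      by (intro add_left_mono mult_left_mono positive_operator_norm_sq_le[OF A b]) simp
    also have "t\<^sup>2 * (b * inner (A x) x) = t * (b * t) * inner (A x) x" by (simp add: power2_eq_square)
    also have "(norm x)\<^sup>2 - 2 * t * inner (A x) x + t * (b * t) * inner (A x) x =
      (norm x)\<^sup>2 - t * inner (A x) x" by (simp add: t)
    also have "\<dots> \<le> (norm x)\<^sup>2"
      using A t(1) by (simp add: positive_operator_def inner_eq_Re_cinner)
    finally show ?thesis by (rule power2_le_imp_le) simp
  qed
  have TA: "hilbert_schmidt (\<lambda>x. T (A x))" by (rule hilbert_schmidt_comp_right[OF T Ab])
  have TB: "T (B x) = T x - t *\<^sub>R T (A x)" for x by (simp add: B_def bounded_clinear_simps[OF T(1)])
  have "hs_sq (\<lambda>x. T (B x)) \<le> hs_sq T" by (rule hs_sq_comp_contraction[OF T B Bn])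
  hence "hs_sq T - 2 * (t * hs_inner T (\<lambda>x. T (A x))) + t\<^sup>2 * hs_sq (\<lambda>x. T (A x)) \<le> hs_sq T"
    unfolding TB hilbert_schmidt_diff(2)[OF T(2) hilbert_schmidt_scaleR(1)[OF TA]]
      hilbert_schmidt_scaleR(2)[OF TA] hs_inner_scaleR_right[OF T(2) TA] .
  hence "t * (t * hs_sq (\<lambda>x. T (A x))) \<le> t * (2 * hs_inner (\<lambda>x. T (A x)) T)"
    by (simp add: power2_eq_square hs_inner_commute[of T])
  hence "t * hs_sq (\<lambda>x. T (A x)) \<le> 2 * hs_inner (\<lambda>x. T (A x)) T"
    using t(1) by (simp only: mult_le_cancel_left_pos)
  hence "b * (t * hs_sq (\<lambda>x. T (A x))) \<le> b * (2 * hs_inner (\<lambda>x. T (A x)) T)"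
    using b(1) by (simp only: mult_le_cancel_left_pos)
  thus ?thesis using t(2) by (simp add: mult.assoc[symmetric])
qed

section \<open>Dimension and trace\<close>

lemma orthonormal_independent:
  assumes v: "orthonormal v J" and fin: "finite J"
  shows "inj_on v J" "\<not> cdependent (v ` J)"
proof -
  show inj: "inj_on v J"
  proof (rule inj_onI)
    fix i j assume "i \<in> J" "j \<in> J" "v i = v j"
    thus "i = j" using v unfolding orthonormal_def by (metis zero_neq_one)
  qed
  show "\<not> cdependent (v ` J)"
  proof (rule complex_vector.independent_if_scalars_zero)
    show "finite (v ` J)" using fin by simp
    fix c x assume c: "(\<Sum>y\<in>v ` J. c y *\<^sub>C y) = 0" and "x \<in> v ` J"
    then obtain j where j: "j \<in> J" "x = v j" by blast
    have "0 = cinner (\<Sum>i\<in>J. c (v i) *\<^sub>C v i) (v j)"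
      using c by (simp add: sum.reindex[OF inj])
    also have "\<dots> = (\<Sum>i\<in>J. if i = j then c (v i) else 0)"
      unfolding cinner_sum_left cinner_scaleC_left
      using v j by (intro sum.cong) (auto simp: orthonormal_def)
    also have "\<dots> = c x" using fin j by simp
    finally show "c x = 0" ..
  qed
qed

lemma finite_cdim_basis:
  assumes "finite_cdim V"
  obtains B where "finite B" "B \<subseteq> V" "V \<subseteq> cspan B" "card B = cdim V" "\<not> cdependent B"
proof -
  obtain C where C: "finite C" "V \<subseteq> cspan C" using assms unfolding finite_cdim_def by blast
  obtain B where B: "B \<subseteq> V" "\<not> cdependent B" "V \<subseteq> cspan B" "card B = cdim V"
    using complex_vector.basis_exists by blast
  have "finite B"
    using complex_vector.independent_span_bound[OF C(1) B(2)] B(1) C(2) by blast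
  thus ?thesis using that B by blast
qed

lemma independent_card_le_cdim:
  assumes "finite_cdim V" "S \<subseteq> V" "\<not> cdependent S"
  shows "finite S" "card S \<le> cdim V"
proof -
  obtain B where B: "finite B" "B \<subseteq> V" "V \<subseteq> cspan B" "card B = cdim V" "\<not> cdependent B"
    by (rule finite_cdim_basis[OF assms(1)])
  have "finite S \<and> card S \<le> card B"
    by (rule complex_vector.independent_span_bound[OF B(1) assms(3) order_trans[OF assms(2) B(3)]])
  thus "finite S" "card S \<le> cdim V" by (simp_all add: B(4))
qed

text \<open>As long as fewer than \<open>ecdim V\<close> vectors have been chosen, their span misses a vector of \<open>V\<close>, and
  the normalised residual of that vector continues the family.\<close>

lemma orthonormal_family_exists:
  assumes V: "csubspace V"
  shows "enat m \<le> ecdim V \<Longrightarrow> \<exists>v. orthonormal v {..<m} \<and> v ` {..<m} \<subseteq> V"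
proof (induction m)
  case (Suc m)
  hence "enat m \<le> ecdim V" using order_trans[of "enat m" "enat (Suc m)"] by simp
  with Suc.IH obtain v where v: "orthonormal v {..<m}" "v ` {..<m} \<subseteq> V" by blast
  have "\<not> V \<subseteq> cspan (v ` {..<m})"
  proof
    assume *: "V \<subseteq> cspan (v ` {..<m})"
    hence "finite_cdim V" unfolding finite_cdim_def by blast
    moreover have "cdim V \<le> card (v ` {..<m})" using complex_vector.dim_le_card[OF *] by simp
    hence "cdim V \<le> m" using card_image_le[of "{..<m}" v] by simp
    ultimately show False using Suc.prems by (simp add: ecdim_def)
  qed
  then obtain x where x: "x \<in> V" "x \<notin> cspan (v ` {..<m})" by blast
  define s where "s = (\<Sum>j\<in>{..<m}. cinner x (v j) *\<^sub>C v j)"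
  define w where "w = sgn (x - s)"
  have "s \<in> cspan (v ` {..<m})" unfolding s_def
    by (intro complex_vector.span_sum complex_vector.span_scale complex_vector.span_base) auto
  hence ne: "x - s \<noteq> 0" using x(2) by auto
  have "s \<in> V" unfolding s_def
    using v(2) by (intro complex_vector.subspace_sum[OF V] complex_vector.subspace_scale[OF V]) auto
  have w: "w = complex_of_real (inverse (norm (x - s))) *\<^sub>C (x - s)"
    unfolding w_def sgn_div_norm scaleC_of_real ..
  have "w \<in> V"
    unfolding w by (intro complex_vector.subspace_scale[OF V] complex_vector.subspace_diff[OF V] x \<open>s \<in> V\<close>)
  have "cinner (x - s) (v j) = 0" if "j < m" for j
    unfolding s_def using that by (intro weakly_orthonormal_residual orthonormal_imp_weakly v) auto
  hence o: "cinner w (v j) = 0" "cinner (v j) w = 0" if "j < m" for j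
    using that cinner_commute_zero[of w "v j"] by (simp_all add: w cinner_scaleC_left)
  have "norm w = 1" using ne by (simp add: w_def norm_sgn)
  hence "cinner w w = 1" by (simp add: cinner_self)
  hence "orthonormal (v(m := w)) {..<Suc m}"
    using v(1) o by (auto simp: orthonormal_def less_Suc_eq)
  moreover have "(v(m := w)) ` {..<Suc m} \<subseteq> V" using v(2) \<open>w \<in> V\<close> by (auto simp: less_Suc_eq)
  ultimately show ?case by blast
qed (simp add: orthonormal_def)

text \<open>An orthonormal family that does not span could be enlarged by one vector to an independent set
  with more elements than the dimension.\<close>

lemma orthonormal_family_spans:
  assumes V: "finite_cdim V" and v: "orthonormal v {..<cdim V}" "v ` {..<cdim V} \<subseteq> V"
  shows "V \<subseteq> cspan (v ` {..<cdim V})"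
proof (rule ccontr)
  assume "\<not> V \<subseteq> cspan (v ` {..<cdim V})"
  then obtain x where x: "x \<in> V" "x \<notin> cspan (v ` {..<cdim V})" by blast
  note ind = orthonormal_independent[OF v(1) finite_lessThan]
  have "\<not> cdependent (insert x (v ` {..<cdim V}))"
    using ind(2) x(2) by (simp add: complex_vector.independent_insertI)
  moreover have "x \<notin> v ` {..<cdim V}"
    using x(2) complex_vector.span_base[of x "v ` {..<cdim V}"] by (rule contrapos_nn)
  ultimately show False
    using independent_card_le_cdim(2)[OF V, of "insert x (v ` {..<cdim V})"] x(1) v(2) card_image[OF ind(1)]
    by simp
qed

text \<open>The map \<open>G\<close> is the orthogonal projection onto \<open>V\<close>. For each vector \<open>v\<^sub>l\<close> of an orthonormal
  family in \<open>V\<close>, the sum of \<open>\<bar>\<langle>G e\<^sub>i, v\<^sub>l\<rangle>\<bar>\<^sup>2 = \<bar>\<langle>e\<^sub>i, v\<^sub>l\<rangle>\<bar>\<^sup>2\<close> over \<open>i\<close> is \<open>1\<close>; Bessel's inequality bounds the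
  number of such vectors, and a basis of \<open>V\<close> attains the bound.\<close>

lemma projection_hilbert_schmidt_dim:
  fixes G :: "ell2 \<Rightarrow> ell2"
  assumes V: "csubspace V" and G: "\<And>x. G x \<in> V" "\<And>x y. y \<in> V \<Longrightarrow> cinner (G x) y = cinner x y"
  shows "hilbert_schmidt G \<longleftrightarrow> finite_cdim V" "finite_cdim V \<Longrightarrow> hs_sq G = real (cdim V)"
proof -
  have trace: "(\<lambda>i. \<Sum>l<m. (cmod (cinner (G (unit_vec i)) (v l)))\<^sup>2) sums real m"
    if v: "orthonormal v {..<m}" "v ` {..<m} \<subseteq> V" for v and m :: nat
  proof -
    have "cinner (G (unit_vec i)) (v l) = cnj (coord (v l) i)" if "l < m" for i l
      using G(2)[of "v l"] v(2) that cinner_commute[of "unit_vec i"] by (auto simp: cinner_unit_vec)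
    hence "(\<Sum>l<m. (cmod (cinner (G (unit_vec i)) (v l)))\<^sup>2) = (\<Sum>l<m. (cmod (coord (v l) i))\<^sup>2)" for i
      by (intro sum.cong) auto
    moreover have "(\<lambda>i. \<Sum>l<m. (cmod (coord (v l) i))\<^sup>2) sums (\<Sum>l<m. (norm (v l))\<^sup>2)"
      by (intro sums_sum sums_coord_norm)
    moreover have "(\<Sum>l<m. (norm (v l))\<^sup>2) = real m"
      using orthonormal_norm[OF v(1)] by simp
    ultimately show ?thesis by simp
  qed
  have fin: "finite_cdim V" if hs: "hilbert_schmidt G"
  proof (rule ccontr)
    assume "\<not> finite_cdim V"
    hence inf: "enat m \<le> ecdim V" for m by (simp add: ecdim_def)
    obtain m where m: "hs_sq G < real m" using reals_Archimedean2 by blast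
    obtain v where v: "orthonormal v {..<m}" "v ` {..<m} \<subseteq> V"
      using orthonormal_family_exists[OF V inf[of m]] by blast
    have "real m \<le> hs_sq G"
    proof (rule sums_le[OF _ trace[OF v] sums_hs_sq[OF hs]])
      fix i
      show "(\<Sum>l<m. (cmod (cinner (G (unit_vec i)) (v l)))\<^sup>2) \<le> (norm (G (unit_vec i)))\<^sup>2"
        using weakly_orthonormal_pythagoras[OF orthonormal_imp_weakly[OF v(1)], of "G (unit_vec i)"] by simp
    qed
    thus False using m by simp
  qed
  have sums: "(\<lambda>i. (norm (G (unit_vec i)))\<^sup>2) sums real (cdim V)" if fin: "finite_cdim V"
  proof -
    define m where "m = cdim V"
    have "enat m \<le> ecdim V" using fin by (simp add: m_def ecdim_def)
    then obtain v where v: "orthonormal v {..<m}" "v ` {..<m} \<subseteq> V"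
      using orthonormal_family_exists[OF V] by blast
    have span: "V \<subseteq> cspan (v ` {..<m})" using orthonormal_family_spans[OF fin] v by (simp add: m_def)
    note w = orthonormal_imp_weakly[OF v(1)]
    have "(\<Sum>l<m. (cmod (cinner y (v l)))\<^sup>2) = (norm y)\<^sup>2" if "y \<in> V" for y
      using weakly_orthonormal_pythagoras[OF w, of y] best_approximation[OF w, of y y] span that by auto
    thus ?thesis using trace[OF v] G(1) by (simp add: m_def)
  qed
  show "hilbert_schmidt G \<longleftrightarrow> finite_cdim V" using fin sums by (auto simp: hilbert_schmidt_def sums_iff)
  show "finite_cdim V \<Longrightarrow> hs_sq G = real (cdim V)" using sums by (simp add: hs_sq_def sums_iff)
qed

lemma finite_cdim_image:
  assumes T: "bounded_clinear T" and V: "finite_cdim V"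
  shows "finite_cdim (T ` V)" "cdim (T ` V) \<le> cdim V"
proof -
  obtain B where B: "finite B" "B \<subseteq> V" "V \<subseteq> cspan B" "card B = cdim V" "\<not> cdependent B"
    by (rule finite_cdim_basis[OF V])
  have "B \<subseteq> {x. T x \<in> cspan (T ` B)}" by (auto intro: complex_vector.span_base)
  moreover have "csubspace {x. T x \<in> cspan (T ` B)}"
    by (auto simp: csubspace_iff bounded_clinear_simps[OF T]
        intro: complex_vector.span_zero complex_vector.span_add complex_vector.span_scale)
  ultimately have "cspan B \<subseteq> {x. T x \<in> cspan (T ` B)}" by (rule complex_vector.span_minimal)
  hence *: "T ` V \<subseteq> cspan (T ` B)" using B(3) by blast
  thus "finite_cdim (T ` V)" unfolding finite_cdim_def using B(1) by blast
  have "cdim (T ` V) \<le> card (T ` B)" using complex_vector.dim_le_card[OF *] B(1) by simp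
  thus "cdim (T ` V) \<le> cdim V" using card_image_le[OF B(1), of T] B(4) by simp
qed

text \<open>For \<open>T\<close> a partial isometry with initial space \<open>V\<close> and \<open>S\<close> its adjoint, this says that \<open>T\<close> preserves
  the dimension of its initial space.\<close>

lemma ecdim_eqI:
  assumes "bounded_clinear T" "bounded_clinear S" "T ` V = W" "S ` W = V"
  shows "ecdim V = ecdim W"
proof -
  have "finite_cdim V \<longleftrightarrow> finite_cdim W"
    using finite_cdim_image(1)[OF assms(1), of V] finite_cdim_image(1)[OF assms(2), of W] assms(3,4) by auto
  moreover have "cdim V = cdim W" if "finite_cdim V" "finite_cdim W"
    using finite_cdim_image(2)[OF assms(1) that(1)] finite_cdim_image(2)[OF assms(2) that(2)] assms(3,4)
    by simp
  ultimately show ?thesis by (simp add: ecdim_def)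
qed

section \<open>Powers of a self-adjoint contraction\<close>

lemma is_adjoint_funpow: "is_adjoint T T \<Longrightarrow> is_adjoint (T ^^ m) (T ^^ m)"
proof (induction m)
  case 0
  thus ?case using is_adjoint_ident by (simp add: id_def)
next
  case (Suc m)
  have "is_adjoint (\<lambda>x. T ((T ^^ m) x)) (\<lambda>x. (T ^^ m) (T x))"
    by (rule is_adjoint_comp[OF Suc.prems Suc.IH[OF Suc.prems]])
  thus ?case by (simp add: o_def funpow_swap1)
qed

lemma hilbert_schmidt_funpow:
  fixes T :: "ell2 \<Rightarrow> ell2"
  assumes "bounded_clinear T" "hilbert_schmidt T"
  shows "hilbert_schmidt (T ^^ Suc m)"
proof (induction m)
  case (Suc m)
  have "hilbert_schmidt (\<lambda>x. T ((T ^^ Suc m) x))" by (rule hilbert_schmidt_comp_left[OF assms(1) Suc])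
  thus ?case by (simp add: o_def)
qed (use assms(2) in simp)

text \<open>Here \<open>E\<close> is the orthogonal projection onto the fixed vectors of \<open>T\<^sup>2\<close>. Convergence holds since
  \<open>\<langle>T\<^bsup>2m\<^esup> x, T\<^bsup>2n\<^esup> x\<rangle> = \<parallel>T\<^bsup>m+n\<^esup> x\<parallel>\<^sup>2\<close>, where the right-hand side decreases.\<close>

lemma self_adjoint_contraction_powers:
  fixes T :: "'a :: complex_hilbert \<Rightarrow> 'a"
  assumes T: "is_adjoint T T" "\<And>x. norm (T x) \<le> norm x"
  obtains E where "\<And>x. (\<lambda>m. (T ^^ (2 * m)) x) \<longlonglongrightarrow> E x" "\<And>x. T (T (E x)) = E x"
    "\<And>x y. T (T y) = y \<Longrightarrow> cinner (E x) y = cinner x y"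
    "\<And>x. (\<lambda>m. norm ((T ^^ m) x)) \<longlonglongrightarrow> norm (E x)"
proof -
  note Tb = is_adjointD(1)[OF T(1)]
  define c where "c x m = (norm ((T ^^ m) x))\<^sup>2" for x m
  have prod: "inner ((T ^^ (2 * m)) x) ((T ^^ (2 * n)) x) = c x (m + n)" for x m n
  proof -
    have "inner ((T ^^ (2 * m)) x) ((T ^^ (2 * n)) x) = inner ((T ^^ (2 * n)) ((T ^^ (2 * m)) x)) x"
      by (rule is_adjointD(5)[OF is_adjoint_funpow[OF T(1)], symmetric])
    also have "\<dots> = inner ((T ^^ (2 * n + 2 * m)) x) x" by (simp only: funpow_add o_def)
    also have "2 * n + 2 * m = (m + n) + (m + n)" by simp
    also have "inner ((T ^^ ((m + n) + (m + n))) x) x = inner ((T ^^ (m + n)) ((T ^^ (m + n)) x)) x"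
      by (simp only: funpow_add o_def)
    also have "\<dots> = c x (m + n)"
      unfolding c_def power2_norm_eq_inner by (rule is_adjointD(5)[OF is_adjoint_funpow[OF T(1)]])
    finally show ?thesis .
  qed
  have dec: "decseq (c x)" for x
    unfolding decseq_Suc_iff c_def using T(2) by (auto intro!: power_mono)
  have "\<exists>L. c x \<longlonglongrightarrow> L \<and> (\<forall>m. L \<le> c x m)" for x
    using decseq_convergent[OF dec[of x], of 0] by (metis c_def zero_le_power2)
  then obtain L where L: "\<And>x. c x \<longlonglongrightarrow> L x" "\<And>x m. L x \<le> c x m" by metis
  have "Cauchy (\<lambda>m. (T ^^ (2 * m)) x)" for x
    unfolding Cauchy_def dist_norm
  proof (intro allI impI)
    fix e :: real assume "e > 0"
    hence "e\<^sup>2 / 4 > 0" by simp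
    from LIMSEQ_D[OF L(1) this] obtain N where N: "\<forall>n\<ge>N. \<bar>c x n - L x\<bar> < e\<^sup>2 / 4" by auto
    have "norm ((T ^^ (2 * m)) x - (T ^^ (2 * n)) x) < e" if "N \<le> m" "N \<le> n" for m n
    proof -
      have "(norm ((T ^^ (2 * m)) x - (T ^^ (2 * n)) x))\<^sup>2 = c x (m + m) - 2 * c x (m + n) + c x (n + n)"
        unfolding power2_norm_eq_inner inner_diff_left inner_diff_right prod by (simp add: add.commute)
      also have "\<dots> < e\<^sup>2"
        using N[rule_format, of "m + m"] N[rule_format, of "n + n"] L(2)[of x "m + n"] that
        by (auto simp: abs_if split: if_splits)
      finally show ?thesis using \<open>e > 0\<close> power_less_imp_less_base by (metis less_imp_le)
    qed
    thus "\<exists>N. \<forall>m\<ge>N. \<forall>n\<ge>N. norm ((T ^^ (2 * m)) x - (T ^^ (2 * n)) x) < e" by blast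
  qed
  hence "\<forall>x. \<exists>y. (\<lambda>m. (T ^^ (2 * m)) x) \<longlonglongrightarrow> y" by (simp add: Cauchy_convergent_iff convergent_def)
  then obtain E where E: "\<And>x. (\<lambda>m. (T ^^ (2 * m)) x) \<longlonglongrightarrow> E x" by metis
  show ?thesis
  proof
    fix x y
    show "(\<lambda>m. (T ^^ (2 * m)) x) \<longlonglongrightarrow> E x" by (rule E)
    have "(\<lambda>m. T (T ((T ^^ (2 * m)) x))) \<longlonglongrightarrow> T (T (E x))"
      by (intro bounded_linear.tendsto[OF bounded_clinear_bounded[OF Tb]] E)
    moreover have "(\<lambda>m. (T ^^ (2 * Suc m)) x) \<longlonglongrightarrow> E x" by (rule LIMSEQ_Suc[OF E])
    ultimately show "T (T (E x)) = E x" by (simp add: LIMSEQ_unique)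
    show "cinner (E x) y = cinner x y" if y: "T (T y) = y"
    proof -
      have fix_y: "(T ^^ (2 * m)) y = y" for m by (induction m) (auto simp: y)
      have "cinner ((T ^^ (2 * m)) x) y = cinner x y" for m
        using is_adjointD(3)[OF is_adjoint_funpow[OF T(1)], of "2 * m" x y] by (simp only: fix_y)
      moreover have "(\<lambda>m. cinner ((T ^^ (2 * m)) x) y) \<longlonglongrightarrow> cinner (E x) y" by (rule tendsto_cinner_left[OF E])
      ultimately show ?thesis by (simp add: LIMSEQ_const_iff)
    qed
    have "(\<lambda>m. c x (2 * m)) \<longlonglongrightarrow> L x"
      using LIMSEQ_subseq_LIMSEQ[OF L(1), of "\<lambda>m. 2 * m"] by (simp add: o_def strict_mono_def)
    moreover have "(\<lambda>m. c x (2 * m)) \<longlonglongrightarrow> (norm (E x))\<^sup>2"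
      unfolding c_def by (intro tendsto_intros E)
    ultimately have "L x = (norm (E x))\<^sup>2" by (rule LIMSEQ_unique)
    with L(1)[of x] have "c x \<longlonglongrightarrow> (norm (E x))\<^sup>2" by simp
    hence "(\<lambda>m. sqrt (c x m)) \<longlonglongrightarrow> sqrt ((norm (E x))\<^sup>2)" by (rule tendsto_real_sqrt)
    thus "(\<lambda>m. norm ((T ^^ m) x)) \<longlonglongrightarrow> norm (E x)" by (simp add: c_def)
  qed
qed

section \<open>The index of a pair of projections as a difference of traces\<close>

text \<open>In operator form, \<open>T\<^sup>2 + R\<^sup>2 = 1\<close> for \<open>T = P - Q\<close> and \<open>R = 1 - P - Q\<close>. In particular \<open>T\<close> is a
  contraction.\<close>

lemma projection_difference_identity:
  assumes P: "is_projection P" and Q: "is_projection Q"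
  shows "(norm x)\<^sup>2 = (norm (P x - Q x))\<^sup>2 + (norm (x - P x - Q x))\<^sup>2"
proof -
  have "inner x (P x) = inner (P x) (P x)" "inner x (Q x) = inner (Q x) (Q x)"
    using is_adjointD(5)[OF is_projectionD(1)[OF P], of x "P x"] is_projectionD(2)[OF P]
      is_adjointD(5)[OF is_projectionD(1)[OF Q], of x "Q x"] is_projectionD(2)[OF Q]
    by (simp_all add: inner_commute)
  thus ?thesis
    unfolding power2_norm_eq_inner
    by (simp add: inner_diff_left inner_diff_right inner_commute[of "P x" x] inner_commute[of "Q x" x]
        inner_commute[of "Q x" "P x"])
qed

lemma tendsto_suminf_dominated:
  fixes h :: "nat \<Rightarrow> nat \<Rightarrow> real"
  assumes lim: "\<And>i. (\<lambda>m. h m i) \<longlonglongrightarrow> l i" and dom: "\<And>m i. \<bar>h m i\<bar> \<le> b i" and b: "summable b"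
  shows "summable l" "(\<lambda>m. \<Sum>i. h m i) \<longlonglongrightarrow> (\<Sum>i. l i)"
proof -
  have b0: "0 \<le> b i" for i using dom[of 0 i] by simp
  have bl: "\<bar>l i\<bar> \<le> b i" for i
    by (rule LIMSEQ_le_const2[OF tendsto_rabs[OF lim]]) (use dom in blast)
  show sl: "summable l" by (rule summable_comparison_test'[OF b]) (use bl in auto)
  have sh: "summable (\<lambda>i. \<bar>h m i\<bar>)" for m
    by (rule summable_comparison_test'[OF b]) (use dom in auto)
  have sal: "summable (\<lambda>i. \<bar>l i\<bar>)" by (rule summable_comparison_test'[OF b]) (use bl in auto)
  have ib: "integrable (count_space UNIV) b" using b b0 by (simp add: integrable_count_space_nat_iff)
  have "(\<lambda>m. \<integral>i. h m i \<partial>count_space UNIV) \<longlonglongrightarrow> (\<integral>i. l i \<partial>count_space UNIV)"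
    by (rule integral_dominated_convergence[OF _ _ ib]) (use lim dom in auto)
  thus "(\<lambda>m. \<Sum>i. h m i) \<longlonglongrightarrow> (\<Sum>i. l i)"
    using sh sal by (simp add: integral_count_space_nat integrable_count_space_nat_iff)
qed

text \<open>Since \<open>T\<^sup>2\<close> commutes with \<open>P\<close>, the limit of its powers on \<open>ran P\<close> is the projection onto the
  fixed vectors there, and these are the vectors of \<open>ran P\<close> that \<open>Q\<close> annihilates.\<close>

lemma projection_pair_powers_tendsto:
  fixes P Q :: "ell2 \<Rightarrow> ell2"
  assumes P: "is_projection P" and Q: "is_projection Q" and hs: "hilbert_schmidt (\<lambda>x. P x - Q x)"
  shows "finite_cdim (ker Q \<inter> range P)"
    and "(\<lambda>m. hs_sq (\<lambda>x. ((\<lambda>x. P x - Q x) ^^ m) (P x))) \<longlonglongrightarrow> real (cdim (ker Q \<inter> range P))"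
proof -
  note Pb = is_projectionD(3)[OF P] and Qb = is_projectionD(3)[OF Q]
  note PP = is_projectionD(2)[OF P] is_projectionD(2)[OF Q]
  note lin = bounded_clinear_simps[OF Pb] bounded_clinear_simps[OF Qb]
  define T where "T x = P x - Q x" for x
  have T: "is_adjoint T T"
    unfolding T_def by (intro is_adjoint_diff is_projectionD(1) P Q)
  have Tb: "bounded_clinear T" by (rule is_adjointD(1)[OF T])
  have contr: "norm (T x) \<le> norm x" for x
    using projection_difference_identity[OF P Q, of x] unfolding T_def
    by (metis le_add_same_cancel1 norm_ge_zero power2_le_imp_le zero_le_power2)
  have hsT: "hilbert_schmidt T" using hs by (simp add: T_def[abs_def])
  obtain E where E: "\<And>x. (\<lambda>m. (T ^^ (2 * m)) x) \<longlonglongrightarrow> E x" "\<And>x. T (T (E x)) = E x"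
    "\<And>x y. T (T y) = y \<Longrightarrow> cinner (E x) y = cinner x y"
    "\<And>x. (\<lambda>m. norm ((T ^^ m) x)) \<longlonglongrightarrow> norm (E x)"
    using self_adjoint_contraction_powers[OF T contr] by blast
  define V where "V = ker Q \<inter> range P"
  have V: "csubspace V"
    unfolding V_def by (intro complex_vector.subspace_inter csubspace_ker csubspace_range Pb Qb)
  have TTP: "T (T (P x)) = P (T (T x))" for x by (simp add: T_def lin PP)
  have "(T ^^ (2 * m)) (P x) = P ((T ^^ (2 * m)) x)" for m x
    by (induction m) (simp_all add: TTP)
  hence "(T ^^ (2 * m)) (P x) \<in> range P" for m x by simp
  hence EP: "E (P x) \<in> range P" for x
    by (rule closed_sequentially[OF closed_projection_range[OF P] _ E(1)])
  have EQ: "E (P x) \<in> ker Q" for x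
  proof -
    define y where "y = E (P x)"
    have "P y = y" using EP projection_range_iff[OF P] by (simp add: y_def)
    have "norm y \<le> norm (T y)" using contr[of "T y"] E(2)[of "P x"] by (simp add: y_def)
    hence "norm y \<le> norm (y - Q y)" by (simp add: T_def \<open>P y = y\<close>)
    hence "(norm y)\<^sup>2 \<le> (norm (y - Q y))\<^sup>2" by (intro power_mono) auto
    hence "Q y = 0" using projection_pythagoras[OF Q, of y] by simp
    thus ?thesis by (simp add: ker_def y_def)
  qed
  have EV: "E (P x) \<in> V" for x using EP EQ by (simp add: V_def)
  have EPc: "cinner (E (P x)) y = cinner x y" if "y \<in> V" for x y
  proof -
    have "P y = y" "Q y = 0" using that projection_range_iff[OF P] by (auto simp: V_def ker_def)
    hence "T (T y) = y" by (simp add: T_def)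
    thus ?thesis
      using E(3)[of y "P x"] is_adjointD(3)[OF is_projectionD(1)[OF P], of x y] \<open>P y = y\<close> by simp
  qed
  define h where "h m i = (norm ((T ^^ Suc m) (P (unit_vec i))))\<^sup>2" for m i
  define l where "l i = (norm (E (P (unit_vec i))))\<^sup>2" for i
  have hsTP: "hilbert_schmidt (\<lambda>x. T (P x))" by (rule hilbert_schmidt_comp_right[OF Tb hsT Pb])
  have "(\<lambda>m. h m i) \<longlonglongrightarrow> l i" for i
    unfolding h_def l_def by (intro tendsto_power LIMSEQ_Suc E(4))
  moreover have "\<bar>h m i\<bar> \<le> (norm (T (P (unit_vec i))))\<^sup>2" for m i
  proof (induction m)
    case (Suc m)
    have "h (Suc m) i \<le> h m i" unfolding h_def using contr by (auto intro!: power_mono)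
    moreover have "0 \<le> h (Suc m) i" "0 \<le> h m i" by (simp_all add: h_def)
    ultimately show ?case using Suc by linarith
  qed (simp add: h_def)
  moreover have "summable (\<lambda>i. (norm (T (P (unit_vec i))))\<^sup>2)" using hsTP by (simp add: hilbert_schmidt_def)
  ultimately have lim: "summable l" "(\<lambda>m. \<Sum>i. h m i) \<longlonglongrightarrow> (\<Sum>i. l i)"
    by (rule tendsto_suminf_dominated)+
  have hsE: "hilbert_schmidt (\<lambda>x. E (P x))" using lim(1) by (simp add: hilbert_schmidt_def l_def[abs_def])
  have finV: "finite_cdim V" using projection_hilbert_schmidt_dim(1)[OF V EV EPc] hsE by blast
  have dim: "hs_sq (\<lambda>x. E (P x)) = real (cdim V)"
    by (rule projection_hilbert_schmidt_dim(2)[OF V EV EPc finV])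
  show "finite_cdim (ker Q \<inter> range P)" using finV by (simp add: V_def)
  have "(\<lambda>m. hs_sq (\<lambda>x. (T ^^ Suc m) (P x))) \<longlonglongrightarrow> hs_sq (\<lambda>x. E (P x))"
    using lim(2) by (simp only: hs_sq_def h_def l_def)
  hence "(\<lambda>m. hs_sq (\<lambda>x. (T ^^ m) (P x))) \<longlonglongrightarrow> hs_sq (\<lambda>x. E (P x))" by (rule LIMSEQ_imp_Suc)
  thus "(\<lambda>m. hs_sq (\<lambda>x. ((\<lambda>x. P x - Q x) ^^ m) (P x))) \<longlonglongrightarrow> real (cdim (ker Q \<inter> range P))"
    by (simp only: dim) (simp add: V_def T_def[abs_def])
qed

text \<open>Cyclicity of the trace, \<open>tr (C\<^sup>* H\<^sup>2 C) = tr (H C\<^sup>* C H) = tr (C H\<^sup>2 C\<^sup>*)\<close>, with every trace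
  written as a Hilbert-Schmidt norm or inner product.\<close>

lemma hs_sq_swap_adjoint:
  fixes H C :: "ell2 \<Rightarrow> ell2"
  assumes H: "is_adjoint H H" "hilbert_schmidt H" and C: "is_adjoint C C'"
    and comm: "\<And>x. H (H (C x)) = C (H (H x))"
  shows "hs_sq (\<lambda>x. H (C x)) = hs_sq (\<lambda>x. H (C' x))"
proof -
  note Hb = is_adjointD(1)[OF H(1)] and Cb = is_adjointD(1)[OF C] and C'b = is_adjointD(2)[OF C]
  have 1: "is_adjoint (\<lambda>x. C' (C x)) (\<lambda>x. C' (C x))" by (rule is_adjoint_comp[OF is_adjoint_sym[OF C] C])
  have 2: "is_adjoint (\<lambda>x. H (C' (C x))) (\<lambda>x. C' (C (H x)))" by (rule is_adjoint_comp[OF H(1) 1])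
  have "inner (H (C x)) (H (C x)) = inner (H x) (H (C' (C x)))" for x
  proof -
    have "inner (H (C x)) (H (C x)) = inner (C x) (H (H (C x)))" by (rule is_adjointD(5)[OF H(1)])
    also have "\<dots> = inner (C (H (H x))) (C x)" by (simp only: comm inner_commute)
    also have "\<dots> = inner (H (H x)) (C' (C x))" by (rule is_adjointD(5)[OF C])
    also have "\<dots> = inner (H x) (H (C' (C x)))" by (rule is_adjointD(5)[OF H(1)])
    finally show ?thesis .
  qed
  hence "hs_sq (\<lambda>x. H (C x)) = hs_inner H (\<lambda>x. H (C' (C x)))"
    by (simp add: hs_sq_def hs_inner_def power2_norm_eq_inner)
  also have "\<dots> = hs_inner H (\<lambda>x. C' (C (H x)))"
    by (rule hs_inner_adjoint[OF H(1) 2 H(2)])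
      (rule hilbert_schmidt_comp_right[OF Hb H(2) is_adjointD(1)[OF 1]])
  also have "\<dots> = hs_sq (\<lambda>x. C (H x))"
    by (simp add: hs_sq_def hs_inner_def power2_norm_eq_inner is_adjointD(5)[OF C])
  also have "\<dots> = hs_sq (\<lambda>x. H (C' x))"
    by (rule hs_sq_adjoint[OF is_adjoint_comp[OF C H(1)] hilbert_schmidt_comp_left[OF Cb H(2)]])
  finally show ?thesis .
qed

text \<open>By the identity above the left-hand side is the squared norm of \<open>R T\<^sup>m P\<close> with \<open>R = 1 - P - Q\<close>.
  Here \<open>R\<close> anticommutes with \<open>T\<close>, and \<open>R P = - Q P\<close>.\<close>

lemma projection_pair_power_step:
  fixes P Q :: "ell2 \<Rightarrow> ell2"
  assumes P: "is_projection P" and Q: "is_projection Q" and hs: "hilbert_schmidt (\<lambda>x. P x - Q x)"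
    and m: "m > 0"
  defines "T \<equiv> \<lambda>x. P x - Q x"
  shows "hs_sq (\<lambda>x. (T ^^ m) (P x)) - hs_sq (\<lambda>x. (T ^^ Suc m) (P x)) = hs_sq (\<lambda>x. (T ^^ m) (Q (P x)))"
proof -
  note Pb = is_projectionD(3)[OF P] and Qb = is_projectionD(3)[OF Q]
  note PP = is_projectionD(2)[OF P] is_projectionD(2)[OF Q]
  note lin = bounded_clinear_simps[OF Pb] bounded_clinear_simps[OF Qb]
  have T: "is_adjoint T T" unfolding T_def by (intro is_adjoint_diff is_projectionD(1) P Q)
  note Tb = is_adjointD(1)[OF T]
  note Tmb = is_adjointD(1)[OF is_adjoint_funpow[OF T]]
  define R where "R x = x - P x - Q x" for x
  have Rn: "R (- x) = - R x" for x by (simp add: R_def lin)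
  have RT: "R (T x) = - T (R x)" for x by (simp add: R_def T_def lin PP)
  have "norm (R ((T ^^ j) x)) = norm ((T ^^ j) (R x))" for j x
  proof -
    have "R ((T ^^ j) x) = (T ^^ j) (R x) \<or> R ((T ^^ j) x) = - (T ^^ j) (R x)"
      by (induction j) (auto simp: RT bounded_clinear_simps[OF Tb])
    thus ?thesis by auto
  qed
  moreover have "R (P x) = - Q (P x)" for x by (simp add: R_def PP)
  ultimately have norm_R: "norm (R ((T ^^ m) (P x))) = norm ((T ^^ m) (Q (P x)))" for x
    by (simp add: bounded_clinear_simps[OF Tmb])
  have hsTj: "hilbert_schmidt (T ^^ Suc j)" for j
    by (rule hilbert_schmidt_funpow[OF Tb hs[folded T_def]])
  then have hsTm: "hilbert_schmidt (T ^^ m)" using m by (cases m) auto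
  have "(\<lambda>i. (norm ((T ^^ m) (P (unit_vec i))))\<^sup>2 - (norm ((T ^^ Suc m) (P (unit_vec i))))\<^sup>2)
    sums (hs_sq (\<lambda>x. (T ^^ m) (P x)) - hs_sq (\<lambda>x. (T ^^ Suc m) (P x)))"
    by (intro sums_diff sums_hs_sq hilbert_schmidt_comp_right[OF Tmb hsTm Pb] hilbert_schmidt_comp_right[OF Tmb hsTj Pb])
  moreover have "(norm ((T ^^ m) (P x)))\<^sup>2 - (norm ((T ^^ Suc m) (P x)))\<^sup>2 = (norm ((T ^^ m) (Q (P x))))\<^sup>2" for x
    using projection_difference_identity[OF P Q, of "(T ^^ m) (P x)"] norm_R[of x]
    by (simp add: T_def R_def)
  ultimately show ?thesis by (simp add: hs_sq_def sums_iff)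
qed

text \<open>With \<open>T = P - Q\<close>, the two terms are the squared Hilbert-Schmidt norms of \<open>T Q\<close> and of \<open>T P\<close>, that
  is, the traces of \<open>Q (1 - P) Q\<close> and of \<open>P (1 - Q) P\<close>. Passing from \<open>m\<close> to \<open>m + 1\<close> lowers the squared
  norms of \<open>T\<^sup>m P\<close> and \<open>T\<^sup>m Q\<close> by those of \<open>T\<^sup>m Q P\<close> and \<open>T\<^sup>m P Q\<close>, and these agree. So the difference
  does not depend on \<open>m \<ge> 1\<close>, and for \<open>m \<longrightarrow> \<infinity>\<close> only the two intersections survive.\<close>

theorem pair_index_eq_trace_difference:
  fixes P Q :: "ell2 \<Rightarrow> ell2"
  assumes P: "is_projection P" and Q: "is_projection Q" and hs: "hilbert_schmidt (\<lambda>x. P x - Q x)"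
  shows "hs_sq (\<lambda>x. Q (x - P x)) - hs_sq (\<lambda>x. P x - Q (P x)) = - real_of_int (pair_index P Q)"
proof -
  note Pa = is_projectionD(1)[OF P] and Qa = is_projectionD(1)[OF Q]
  note Pb = is_projectionD(3)[OF P] and Qb = is_projectionD(3)[OF Q]
  note PP = is_projectionD(2)[OF P] is_projectionD(2)[OF Q]
  note lin = bounded_clinear_simps[OF Pb] bounded_clinear_simps[OF Qb]
  define T where "T x = P x - Q x" for x
  define T' where "T' x = Q x - P x" for x
  have T: "is_adjoint T T" unfolding T_def by (intro is_adjoint_diff Pa Qa)
  note Tb = is_adjointD(1)[OF T]
  have hsT: "hilbert_schmidt T" using hs by (simp add: T_def[abs_def])
  have hsT': "hilbert_schmidt T'"
    by (rule hilbert_schmidt_dominated[OF hsT, of _ 1]) (simp add: T_def T'_def norm_minus_commute)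
  have "(T' ^^ m) x = (T ^^ m) x \<or> (T' ^^ m) x = - (T ^^ m) x" for m x
  proof (induction m)
    case (Suc m)
    have "T' y = - T y" for y by (simp add: T_def T'_def)
    thus ?case using Suc by (auto simp: bounded_clinear_simps[OF Tb])
  qed simp
  hence "norm ((T' ^^ m) x) = norm ((T ^^ m) x)" for m x by (metis norm_minus_cancel)
  hence T'T: "hs_sq (\<lambda>x. (T' ^^ m) (S x)) = hs_sq (\<lambda>x. (T ^^ m) (S x))" for m and S :: "ell2 \<Rightarrow> ell2"
    by (simp add: hs_sq_def)
  define a where "a m = hs_sq (\<lambda>x. (T ^^ m) (P x))" for m
  define b where "b m = hs_sq (\<lambda>x. (T ^^ m) (Q x))" for m
  have hsTj: "hilbert_schmidt (T ^^ Suc j)" for j by (rule hilbert_schmidt_funpow[OF Tb hsT])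
  have step: "a (Suc m) - b (Suc m) = a (Suc (Suc m)) - b (Suc (Suc m))" for m
  proof -
    define H where "H = T ^^ Suc m"
    have "a (Suc m) - a (Suc (Suc m)) = hs_sq (\<lambda>x. H (Q (P x)))"
      using projection_pair_power_step[OF P Q hs, of "Suc m"] unfolding a_def H_def T_def[abs_def] by simp
    moreover have "b (Suc m) - b (Suc (Suc m)) = hs_sq (\<lambda>x. H (P (Q x)))"
      using projection_pair_power_step[OF Q P hsT'[unfolded T'_def[abs_def]], of "Suc m"]
      unfolding T'_def[abs_def, symmetric] T'T b_def H_def by simp
    moreover have "hs_sq (\<lambda>x. H (Q (P x))) = hs_sq (\<lambda>x. H (P (Q x)))"
    proof (rule hs_sq_swap_adjoint[where H = H and C = "\<lambda>x. Q (P x)" and C' = "\<lambda>x. P (Q x)"])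
      show "is_adjoint H H" unfolding H_def by (rule is_adjoint_funpow[OF T])
      show "hilbert_schmidt H" unfolding H_def by (rule hsTj)
      show "is_adjoint (\<lambda>x. Q (P x)) (\<lambda>x. P (Q x))" by (rule is_adjoint_comp[OF Qa Pa])
      have TTC: "T (T (Q (P x))) = Q (P (T (T x)))" for x by (simp add: T_def lin PP)
      have "(T ^^ (2 * j)) (Q (P x)) = Q (P ((T ^^ (2 * j)) x))" for j x
        by (induction j) (simp_all add: TTC)
      moreover have "H (H x) = (T ^^ (2 * Suc m)) x" for x
        unfolding H_def mult_2 by (simp only: funpow_add o_def)
      ultimately show "H (H (Q (P x))) = Q (P (H (H x)))" for x by (simp only:)
    qed
    ultimately show ?thesis by simp
  qed
  have const: "a (Suc m) - b (Suc m) = a 1 - b 1" for m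
    by (induction m) (auto simp flip: step)
  have "a \<longlonglongrightarrow> real (cdim (ker Q \<inter> range P))"
    using projection_pair_powers_tendsto(2)[OF P Q hs] unfolding a_def T_def[abs_def] .
  moreover have "b \<longlonglongrightarrow> real (cdim (ker P \<inter> range Q))"
    using projection_pair_powers_tendsto(2)[OF Q P hsT'[unfolded T'_def[abs_def]]]
    unfolding T'_def[abs_def, symmetric] T'T b_def .
  ultimately have "(\<lambda>m. a m - b m) \<longlonglongrightarrow> real (cdim (ker Q \<inter> range P)) - real (cdim (ker P \<inter> range Q))"
    by (rule tendsto_diff)
  hence "(\<lambda>m. a (Suc m) - b (Suc m)) \<longlonglongrightarrow> real (cdim (ker Q \<inter> range P)) - real (cdim (ker P \<inter> range Q))"
    by (rule LIMSEQ_Suc)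
  hence "a 1 - b 1 = real (cdim (ker Q \<inter> range P)) - real (cdim (ker P \<inter> range Q))"
    unfolding const by (simp add: LIMSEQ_const_iff)
  also have "\<dots> = real_of_int (pair_index P Q)" by (simp add: pair_index_def Int_commute)
  finally have ab: "a 1 - b 1 = real_of_int (pair_index P Q)" .
  have "a 1 = hs_sq (\<lambda>x. P x - Q (P x))" by (simp add: a_def T_def PP)
  moreover have "b 1 = hs_sq (\<lambda>x. Q (x - P x))"
  proof -
    have "b 1 = hs_sq (\<lambda>x. T (Q x))" by (simp add: b_def)
    also have "\<dots> = hs_sq (\<lambda>x. Q (T x))"
      by (rule hs_sq_adjoint[OF is_adjoint_comp[OF T Qa] hilbert_schmidt_comp_right[OF Tb hsT Qb]])
    also have "\<dots> = hs_sq (\<lambda>x. Q (x - P x))"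
      by (simp add: hs_sq_def T_def lin PP norm_minus_commute)
    finally show ?thesis .
  qed
  ultimately show ?thesis using ab by simp
qed

section \<open>Synthesis operators and partial isometries\<close>

lemma is_adjoint_cadjoint:
  fixes T :: "ell2 \<Rightarrow> 'a :: complex_inner"
  assumes "bounded_clinear T" shows "is_adjoint T (cadjoint T)"
proof -
  obtain S where "is_adjoint T S" by (rule adjoint_exists[OF assms])
  thus ?thesis using cadjoint_eq by metis
qed

lemma norm_sq_adjoint_sums:
  assumes "is_adjoint T T'"
  shows "(\<lambda>i. (cmod (cinner y (T (unit_vec i))))\<^sup>2) sums (norm (T' y))\<^sup>2"
  using sums_coord_norm[of "T' y"] is_adjointD(4)[OF assms]
  by (simp flip: cinner_unit_vec)

text \<open>The upper frame bound controls the analysis operator on \<open>K\<close>. By duality it controls finite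
  combinations of frame vectors, since these lie in \<open>K\<close>.\<close>

lemma frame_synthesis:
  fixes f :: "nat \<Rightarrow> 'a :: complex_hilbert"
  assumes fr: "frame_with_bounds a b K f" and b: "b > 0"
  shows "bounded_clinear (synthesis f)" "synthesis f (unit_vec i) = f i" "synthesis f x \<in> K"
    "\<And>y. y \<in> K \<Longrightarrow> a * (norm y)\<^sup>2 \<le> (norm (cadjoint (synthesis f) y))\<^sup>2"
    "\<And>y. y \<in> K \<Longrightarrow> (norm (cadjoint (synthesis f) y))\<^sup>2 \<le> b * (norm y)\<^sup>2"
proof -
  have K: "csubspace K" "closed K" and fK: "\<And>i. f i \<in> K"
    and bounds: "\<And>y. y \<in> K \<Longrightarrow> ennreal (a * (norm y)\<^sup>2) \<le> (\<Sum>i. ennreal ((cmod (cinner y (f i)))\<^sup>2)) \<and>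
      (\<Sum>i. ennreal ((cmod (cinner y (f i)))\<^sup>2)) \<le> ennreal (b * (norm y)\<^sup>2)"
    using fr by (auto simp: frame_with_bounds_def)
  have bessel: "(\<Sum>i\<in>I. (cmod (cinner y (f i)))\<^sup>2) \<le> b * (norm y)\<^sup>2" if "y \<in> K" "finite I" for y I
  proof -
    have "ennreal (\<Sum>i\<in>I. (cmod (cinner y (f i)))\<^sup>2) = (\<Sum>i\<in>I. ennreal ((cmod (cinner y (f i)))\<^sup>2))"
      by (simp add: sum_ennreal)
    also have "\<dots> \<le> (\<Sum>i. ennreal ((cmod (cinner y (f i)))\<^sup>2))"
      by (rule sum_le_suminf) (use that in auto)
    also have "\<dots> \<le> ennreal (b * (norm y)\<^sup>2)" using bounds[OF that(1)] by blast
    finally show ?thesis using b by (simp add: ennreal_le_iff)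
  qed
  have "(norm (\<Sum>i\<in>I. c i *\<^sub>C f i))\<^sup>2 \<le> b * (\<Sum>i\<in>I. (cmod (c i))\<^sup>2)" if I: "finite I" for I c
  proof -
    define z where "z = (\<Sum>i\<in>I. c i *\<^sub>C f i)"
    define s where "s = (\<Sum>i\<in>I. (cmod (c i))\<^sup>2)"
    have s0: "s \<ge> 0" unfolding s_def by (intro sum_nonneg) auto
    have zK: "z \<in> K"
      unfolding z_def using K fK by (intro complex_vector.subspace_sum complex_vector.subspace_scale)
    have "(norm z)\<^sup>2 = cmod (cinner z z)" by (simp add: cinner_self norm_power)
    also have "cinner z z = (\<Sum>i\<in>I. cnj (c i) * cinner z (f i))"
      by (subst (2) z_def) (simp add: cinner_sum_right cinner_scaleC_right)
    also have "cmod \<dots> \<le> (\<Sum>i\<in>I. cmod (c i) * cmod (cinner z (f i)))"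
      by (rule order_trans[OF norm_sum]) (simp add: norm_mult)
    finally have "((norm z)\<^sup>2)\<^sup>2 \<le> (\<Sum>i\<in>I. cmod (c i) * cmod (cinner z (f i)))\<^sup>2"
      by (rule power_mono) simp
    also have "\<dots> \<le> s * (\<Sum>i\<in>I. (cmod (cinner z (f i)))\<^sup>2)"
      unfolding s_def by (rule Cauchy_Schwarz_ineq_sum)
    also have "\<dots> \<le> s * (b * (norm z)\<^sup>2)" by (intro mult_left_mono bessel zK I s0)
    finally have "(norm z)\<^sup>2 * (norm z)\<^sup>2 \<le> (norm z)\<^sup>2 * (b * s)" by (simp add: power2_eq_square mult_ac)
    hence "(norm z)\<^sup>2 \<le> b * s"
    proof (cases "z = 0")
      case False
      hence "(norm z)\<^sup>2 > 0" by simp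
      thus ?thesis using \<open>(norm z)\<^sup>2 * (norm z)\<^sup>2 \<le> (norm z)\<^sup>2 * (b * s)\<close>
        by (simp only: mult_le_cancel_left_pos)
    qed (use s0 b in simp)
    thus ?thesis by (simp add: z_def s_def)
  qed
  then obtain F where F: "bounded_clinear F" "\<And>i. F (unit_vec i) = f i"
    using operator_from_basis_images[of f b] b by blast
  have eq: "synthesis f = F" by (rule synthesis_eq[OF F])
  show "bounded_clinear (synthesis f)" "synthesis f (unit_vec i) = f i" using F by (simp_all add: eq)
  have "cspan (range f) \<subseteq> K" using K(1) fK by (intro complex_vector.span_minimal) auto
  hence "closure (cspan (range f)) \<subseteq> K" using K(2) by (rule closure_minimal)
  thus "synthesis f x \<in> K" using bounded_clinear_range_closure[OF F(1), of x] by (auto simp: eq F(2))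
  fix y assume "y \<in> K"
  have "(\<Sum>i. ennreal ((cmod (cinner y (f i)))\<^sup>2)) = ennreal ((norm (cadjoint F y))\<^sup>2)"
    using norm_sq_adjoint_sums[OF is_adjoint_cadjoint[OF F(1)], of y]
    by (intro suminf_ennreal_eq) (simp_all add: F(2))
  with bounds[OF \<open>y \<in> K\<close>]
  show "a * (norm y)\<^sup>2 \<le> (norm (cadjoint (synthesis f) y))\<^sup>2"
    "(norm (cadjoint (synthesis f) y))\<^sup>2 \<le> b * (norm y)\<^sup>2"
    using b by (simp_all add: eq ennreal_le_iff)
qed

text \<open>On \<open>M\<close> the operator \<open>X X\<^sup>*\<close> is isometric and contractive, hence the identity.\<close>

lemma parseval_frame_projection:
  fixes x :: "nat \<Rightarrow> 'a :: complex_hilbert"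
  assumes "parseval_frame_in M x"
  shows "is_projection (\<lambda>y. cadjoint (synthesis x) (synthesis x y))"
proof -
  define X where "X = synthesis x"
  have fr: "frame_with_bounds 1 1 M x" using assms by (simp add: parseval_frame_in_def)
  note X = frame_synthesis[OF fr zero_less_one, folded X_def]
  have adj: "is_adjoint X (cadjoint X)" by (rule is_adjoint_cadjoint[OF X(1)])
  have iso: "norm (cadjoint X y) = norm y" if "y \<in> M" for y
    using X(4,5)[OF that] by (simp add: power2_le_iff_abs_le order_antisym)
  have XX: "X (cadjoint X y) = y" if y: "y \<in> M" for y
  proof -
    define z where "z = X (cadjoint X y)"
    have "norm z \<le> norm y"
    proof -
      have "(norm z)\<^sup>2 = inner (cadjoint X y) (cadjoint X z)"
        unfolding z_def power2_norm_eq_inner by (rule is_adjointD(5)[OF adj])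
      also have "\<dots> \<le> norm (cadjoint X y) * norm (cadjoint X z)" by (rule norm_cauchy_schwarz)
      also have "\<dots> = norm y * norm z" using iso y X(3) by (simp add: z_def)
      finally have "norm z * norm z \<le> norm y * norm z" by (simp add: power2_eq_square)
      thus ?thesis by (cases "norm z = 0") (auto simp: mult_le_cancel_right)
    qed
    hence "(norm z)\<^sup>2 \<le> (norm y)\<^sup>2" by (intro power_mono) auto
    moreover have "inner z y = (norm y)\<^sup>2"
      unfolding z_def is_adjointD(5)[OF adj] power2_norm_eq_inner[symmetric] by (simp add: iso y)
    hence "(norm (z - y))\<^sup>2 = (norm z)\<^sup>2 - (norm y)\<^sup>2"
      by (simp add: power2_norm_eq_inner inner_diff inner_commute)
    ultimately have "(norm (z - y))\<^sup>2 \<le> 0" by linarith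
    thus ?thesis unfolding z_def[symmetric] by simp
  qed
  show ?thesis
    unfolding is_projection_def X_def[symmetric]
    using is_adjoint_comp[OF is_adjoint_sym[OF adj] adj] X(3) XX by simp
qed

text \<open>If \<open>T\<^sup>* T\<close> is a projection then \<open>T\<close> is a partial isometry whose initial space is the range of
  \<open>T\<^sup>* T\<close>.\<close>

lemma adjoint_norm_projection:
  assumes adj: "is_adjoint T T'" and P: "is_projection (\<lambda>x. T' (T x))"
  shows "norm (T x) = norm (T' (T x))" "T (T' (T x)) = T x"
proof -
  have eq: "(norm (T x))\<^sup>2 = (norm (T' (T x)))\<^sup>2" for x
  proof -
    have "(norm (T x))\<^sup>2 = inner (T' (T x)) x"
      unfolding power2_norm_eq_inner by (simp add: is_adjointD(6)[OF adj])
    also have "\<dots> = inner (T' (T x)) (T' (T x))"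
      using is_adjointD(5)[OF is_projectionD(1)[OF P], of "T' (T x)" x] is_projectionD(2)[OF P, of x] by simp
    finally show ?thesis by (simp add: power2_norm_eq_inner)
  qed
  thus "norm (T x) = norm (T' (T x))" by (simp add: power2_eq_iff_nonneg)
  have "(norm (T (x - T' (T x))))\<^sup>2 = 0"
    unfolding eq using is_projectionD(2)[OF P, of x]
    by (simp add: bounded_clinear_simps[OF is_adjointD(1)[OF adj]] bounded_clinear_simps[OF is_adjointD(2)[OF adj]])
  thus "T (T' (T x)) = T x" by (simp add: bounded_clinear_simps[OF is_adjointD(1)[OF adj]])
qed

text \<open>The range of a partial isometry consists of the fixed vectors of \<open>T T\<^sup>*\<close>; hence it is closed, and
  \<open>T\<^sup>*\<close> is isometric there.\<close>

lemma parseval_frame_of_partial_isometry: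
  fixes T :: "ell2 \<Rightarrow> 'a :: complex_hilbert"
  assumes adj: "is_adjoint T T'" and P: "is_projection (\<lambda>x. T' (T x))"
  shows "parseval_frame_in (range T) (\<lambda>i. T (unit_vec i))"
proof -
  note Tb = is_adjointD(1)[OF adj] and T'b = is_adjointD(2)[OF adj]
  have range_T: "range T = ker (\<lambda>y. y - T (T' y))"
  proof (rule set_eqI)
    fix y show "y \<in> range T \<longleftrightarrow> y \<in> ker (\<lambda>y. y - T (T' y))"
      using adjoint_norm_projection(2)[OF adj P] by (auto simp: ker_def)
  qed
  have "closed (range T)"
    unfolding range_T
    by (intro closed_ker bounded_clinear_diff bounded_clinear_ident bounded_clinear_comp[OF Tb T'b])
  moreover have "(\<Sum>i. ennreal ((cmod (cinner y (T (unit_vec i))))\<^sup>2)) = ennreal ((norm y)\<^sup>2)" if "y \<in> range T" for y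
  proof -
    have "T (T' y) = y" using that range_T by (auto simp: ker_def)
    hence "(norm (T' y))\<^sup>2 = (norm y)\<^sup>2"
      using is_adjointD(6)[OF adj, of y "T' y"] by (simp add: power2_norm_eq_inner)
    thus ?thesis using norm_sq_adjoint_sums[OF adj, of y] by (intro suminf_ennreal_eq) auto
  qed
  ultimately show ?thesis
    unfolding parseval_frame_in_def frame_with_bounds_def using csubspace_range[OF Tb] by (simp del: suminf_ennreal)
qed

text \<open>On the orthogonal complement of \<open>ker T\<close>, where \<open>T\<close> is isometric, the vector \<open>T\<^sup>* T x\<close> has norm at
  most \<open>\<parallel>x\<parallel>\<close> and inner product \<open>\<parallel>x\<parallel>\<^sup>2\<close> with \<open>x\<close>, so that it equals \<open>x\<close>.\<close>

lemma partial_isometry_projection: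
  fixes T :: "'a :: complex_hilbert \<Rightarrow> 'b :: complex_inner"
  assumes adj: "is_adjoint T T'" and iso: "\<And>x. x \<in> ortho_compl (ker T) \<Longrightarrow> norm (T x) = norm x"
  shows "is_projection (\<lambda>x. T' (T x))" "T' (T x) = 0 \<longleftrightarrow> T x = 0"
proof -
  note Tb = is_adjointD(1)[OF adj] and T'b = is_adjointD(2)[OF adj]
  note lin = bounded_clinear_simps[OF Tb] bounded_clinear_simps[OF T'b]
  have decomp: "\<exists>y. T y = 0 \<and> x - y \<in> ortho_compl (ker T)" for x
    using orthogonal_decomposition[OF csubspace_ker[OF Tb] closed_ker[OF Tb], of x]
    unfolding ker_def by blast
  have contr: "norm (T x) \<le> norm x" for x
  proof -
    obtain y where y: "T y = 0" "x - y \<in> ortho_compl (ker T)" using decomp by blast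
    have "cinner (x - y) y = 0" using y by (simp add: ortho_compl_def ker_def)
    hence "inner (x - y) y = 0" by (simp add: inner_eq_Re_cinner)
    hence "(norm (x - y + y))\<^sup>2 = (norm (x - y))\<^sup>2 + (norm y)\<^sup>2"
      by (simp only: power2_norm_eq_inner inner_add inner_commute)
    hence "(norm (x - y))\<^sup>2 \<le> (norm x)\<^sup>2" by simp
    hence "norm (x - y) \<le> norm x" by (rule power2_le_imp_le) simp
    thus ?thesis using iso[OF y(2)] y(1) by (simp add: lin)
  qed
  have contr': "norm (T' y) \<le> norm y" for y using adjoint_bound[OF adj, of 1] contr by simp
  have fixed: "T' (T x) = x" if "x \<in> ortho_compl (ker T)" for x
  proof -
    have "norm (T' (T x)) \<le> norm x" using contr'[of "T x"] contr[of x] by linarith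
    hence "(norm (T' (T x)))\<^sup>2 \<le> (norm x)\<^sup>2" by (intro power_mono) auto
    moreover have "inner (T' (T x)) x = (norm x)\<^sup>2"
      using is_adjointD(6)[OF adj, of "T x" x] iso[OF that] by (simp add: power2_norm_eq_inner[symmetric])
    hence "(norm (T' (T x) - x))\<^sup>2 = (norm (T' (T x)))\<^sup>2 - (norm x)\<^sup>2"
      by (simp add: power2_norm_eq_inner inner_diff inner_commute)
    ultimately have "(norm (T' (T x) - x))\<^sup>2 \<le> 0" by linarith
    thus ?thesis by simp
  qed
  have "T' (T (T' (T x))) = T' (T x)" for x
  proof -
    obtain y where y: "T y = 0" "x - y \<in> ortho_compl (ker T)" using decomp by blast
    have "T' (T x) = x - y" using fixed[OF y(2)] y(1) by (simp add: lin)
    thus ?thesis using fixed[OF y(2)] by simp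
  qed
  thus P: "is_projection (\<lambda>x. T' (T x))"
    unfolding is_projection_def using is_adjoint_comp[OF is_adjoint_sym[OF adj] adj] by blast
  show "T' (T x) = 0 \<longleftrightarrow> T x = 0" using adjoint_norm_projection(1)[OF adj P, of x] by (auto simp: lin)
qed

section \<open>The polar decomposition\<close>

text \<open>The hypotheses extract from the frame \<open>f\<close> what the estimates use: its synthesis operator maps into
  \<open>K\<close>, and the last assumption is the lower frame bound, because the coefficients of \<open>F\<^sup>* y\<close> are
  \<open>\<langle>y, f\<^sub>i\<rangle>\<close>.\<close>

locale frame_polar_decomposition =
  fixes F U :: "ell2 \<Rightarrow> 'a :: complex_hilbert" and A :: "ell2 \<Rightarrow> ell2" and K :: "'a set" and a :: real
  assumes F: "bounded_clinear F" and polar: "polar_decomposition F U A"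
    and K: "csubspace K" and FK: "F x \<in> K"
    and a: "a > 0" and lower: "y \<in> K \<Longrightarrow> a * (norm y)\<^sup>2 \<le> (norm (cadjoint F y))\<^sup>2"
begin

abbreviation "F' \<equiv> cadjoint F"
abbreviation "U' \<equiv> cadjoint U"
abbreviation "P \<equiv> \<lambda>x. U' (U x)"

lemma adj_F: "is_adjoint F F'"
  by (rule is_adjoint_cadjoint[OF F])

lemma bounded_U: "bounded_clinear U"
proof -
  obtain C where "\<forall>x\<in>UNIV. norm (U x) \<le> C * norm x"
    using polar unfolding polar_decomposition_def partial_isometry_between_def by blast
  thus ?thesis
    using polar unfolding polar_decomposition_def partial_isometry_between_def
    by (intro bounded_clinearI[where C = C]) (auto simp: mult.commute)
qed

lemma adj_U: "is_adjoint U U'"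
  by (rule is_adjoint_cadjoint[OF bounded_U])

lemma positive_A: "positive_operator A"
  using polar by (simp add: polar_decomposition_def)

lemma adj_A: "is_adjoint A A"
  by (rule positive_operator_self_adjoint[OF positive_A])

lemma F_eq: "F x = U (A x)"
  using polar by (simp add: polar_decomposition_def)

lemma A_A: "A (A x) = F' (F x)"
  using polar unfolding polar_decomposition_def by (metis comp_apply)

lemma isometric_U: "x \<in> ortho_compl (ker U) \<Longrightarrow> norm (U x) = norm x"
  using polar by (simp add: polar_decomposition_def partial_isometry_between_def)

lemma projection_P: "is_projection P"
  by (rule partial_isometry_projection(1)[OF adj_U isometric_U])

lemmas adj_P = is_projectionD(1)[OF projection_P]
lemmas bounded_A = is_adjointD(1)[OF adj_A]
lemmas bounded_P = is_projectionD(3)[OF projection_P]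
lemmas bounded_U' = is_adjointD(2)[OF adj_U]
lemmas bounded_F' = is_adjointD(2)[OF adj_F]
lemmas lin = bounded_clinear_simps[OF F] bounded_clinear_simps[OF bounded_U]
  bounded_clinear_simps[OF bounded_A] bounded_clinear_simps[OF bounded_U']
  bounded_clinear_simps[OF bounded_F']

lemma norm_U: "norm (U x) = norm (P x)" and U_P: "U (P x) = U x"
  by (rule adjoint_norm_projection[OF adj_U projection_P])+

lemma P_P: "P (P x) = P x"
  by (simp add: U_P)

lemma norm_A: "norm (A x) = norm (F x)"
proof -
  have "(norm (A x))\<^sup>2 = (norm (F x))\<^sup>2"
    unfolding power2_norm_eq_inner using is_adjointD(5)[OF adj_A, of "x" "A x"] is_adjointD(6)[OF adj_F, of "F x" x]
    by (simp add: A_A inner_commute)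
  thus ?thesis by (simp add: power2_eq_iff_nonneg)
qed

lemma U_zero_iff: "U x = 0 \<longleftrightarrow> P x = 0"
  using norm_U by (metis norm_eq_zero)

lemma ker_F: "ker F = ker P"
  using polar U_zero_iff by (auto simp: polar_decomposition_def ker_def)

lemma F_zero_iff: "F x = 0 \<longleftrightarrow> P x = 0"
  using ker_F by (auto simp: ker_def)

lemma A_zero_iff: "A x = 0 \<longleftrightarrow> P x = 0"
  using norm_A F_zero_iff by (metis norm_eq_zero)

lemma A_P: "A (P x) = A x"
  using A_zero_iff[of "x - P x"] by (simp add: lin U_P)

lemma P_A: "P (A x) = A x"
proof (rule cinner_ext)
  fix y show "cinner y (P (A x)) = cinner y (A x)"
    using is_adjointD(3)[OF adj_P, of y "A x"] is_adjointD(3)[OF adj_A, of "P y" x] is_adjointD(3)[OF adj_A, of y x]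
    by (simp add: A_P)
qed

lemma P_U': "P (U' y) = U' y"
proof (rule cinner_ext)
  fix x show "cinner x (P (U' y)) = cinner x (U' y)"
    using is_adjointD(3)[OF adj_P, of x "U' y"] is_adjointD(3)[OF adj_U, of "P x" y] is_adjointD(3)[OF adj_U, of x y]
    by (simp add: U_P)
qed

lemma U_diff_P: "U (x - P x) = 0"
  by (simp add: lin U_P)

text \<open>The ranges of \<open>F\<close> and \<open>U\<close> have the same orthogonal complement: a vector orthogonal to
  \<open>F x = U A x\<close> for all \<open>x\<close> satisfies \<open>A U\<^sup>* y = 0\<close>, and \<open>A\<close> is injective on the range of \<open>U\<^sup>*\<close>.\<close>

lemma U'_orthogonal:
  assumes "y \<in> ortho_compl (range F)" shows "U' y = 0"
proof -
  have "A (U' y) = 0"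
  proof (rule cinner_ext)
    fix x
    have "cinner x (A (U' y)) = cinner (F x) y"
      using is_adjointD(3)[OF adj_A, of x "U' y"] is_adjointD(3)[OF adj_U, of "A x" y] by (simp add: F_eq)
    also have "\<dots> = 0" using assms cinner_commute_zero[of y "F x"] by (simp add: ortho_compl_def)
    finally show "cinner x (A (U' y)) = cinner x 0" by simp
  qed
  thus ?thesis using A_zero_iff[of "U' y"] P_U'[of y] by simp
qed

text \<open>The lower frame bound gives the estimate on the range of \<open>F\<^sup>*\<close>, which is dense in the
  orthogonal complement of \<open>ker F\<close>.\<close>

lemma A_bounded_below:
  assumes x: "P x = x" shows "sqrt a * norm x \<le> norm (A x)"
proof -
  have on_range: "sqrt a * norm (F' y) \<le> norm (F (F' y))" if y: "y \<in> K" for y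
  proof -
    have "sqrt a * norm y \<le> norm (F' y)"
      using real_sqrt_le_mono[OF lower[OF y]] by (simp add: real_sqrt_mult)
    moreover have "norm (F' y) * norm (F' y) \<le> norm (F (F' y)) * norm y"
      using norm_cauchy_schwarz[of "F (F' y)" y] is_adjointD(5)[OF adj_F, of "F' y" y]
      by (simp add: power2_norm_eq_inner[symmetric] power2_eq_square)
    ultimately have "norm (F' y) * (sqrt a * norm (F' y)) \<le> sqrt a * (norm (F (F' y)) * norm y)"
      "sqrt a * (norm (F (F' y)) * norm y) \<le> norm (F (F' y)) * norm (F' y)"
      using a mult_left_mono[of "norm (F' y) * norm (F' y)" "norm (F (F' y)) * norm y" "sqrt a"]
        mult_left_mono[of "sqrt a * norm y" "norm (F' y)" "norm (F (F' y))"] by (simp_all add: mult_ac)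
    hence "norm (F' y) * (sqrt a * norm (F' y)) \<le> norm (F' y) * norm (F (F' y))" by (simp add: mult.commute)
    thus ?thesis by (cases "norm (F' y) = 0") (auto simp: mult_le_cancel_left)
  qed
  have F'K: "csubspace (F' ` K)"
    unfolding csubspace_iff
  proof (intro conjI ballI allI)
    show "0 \<in> F' ` K" using complex_vector.subspace_0[OF K] lin by (metis imageI)
  next
    fix u v assume "u \<in> F' ` K" "v \<in> F' ` K"
    then obtain y z where "y \<in> K" "z \<in> K" "u + v = F' (y + z)" by (auto simp: lin)
    thus "u + v \<in> F' ` K" using complex_vector.subspace_add[OF K] by blast
  next
    fix c u assume "u \<in> F' ` K"
    then obtain y where "y \<in> K" "c *\<^sub>C u = F' (c *\<^sub>C y)" by (auto simp: lin)
    thus "c *\<^sub>C u \<in> F' ` K" using complex_vector.subspace_scale[OF K] by blast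
  qed
  obtain v where v: "v \<in> closure (F' ` K)" "x - v \<in> ortho_compl (closure (F' ` K))"
    using orthogonal_decomposition[OF csubspace_closure[OF F'K] closed_closure] by blast
  \<comment> \<open>A vector orthogonal to the range of \<open>F\<^sup>*\<close> lies in \<open>ker F\<close>, to which \<open>x\<close> is orthogonal.\<close>
  define w where "w = x - v"
  have "cinner w (F' (F w)) = 0"
    using v(2) FK closure_subset[of "F' ` K"] by (auto simp: w_def ortho_compl_def)
  hence "cinner (F w) (F w) = 0" by (simp add: is_adjointD(3)[OF adj_F])
  hence Pw: "P w = 0" using F_zero_iff by (simp add: cinner_self)
  have "cinner w x = cinner (P w) x" using is_adjointD(3)[OF adj_P, of w x] x by simp
  moreover have "cinner w v = 0" using v by (simp add: w_def ortho_compl_def)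
  moreover have "cinner w w = cinner w x - cinner w v" by (subst (2) w_def) (rule cinner_diff_right)
  ultimately have "cinner w w = 0" using Pw by simp
  hence "x = v" by (simp add: cinner_self w_def)
  have "closed {u. sqrt a * norm u \<le> norm (F u)}"
    by (intro closed_Collect_le continuous_intros bounded_linear.continuous_on[OF bounded_clinear_bounded[OF F]])
  moreover have "F' ` K \<subseteq> {u. sqrt a * norm u \<le> norm (F u)}" using on_range by blast
  ultimately have "closure (F' ` K) \<subseteq> {u. sqrt a * norm u \<le> norm (F u)}" by (rule closure_minimal[rotated])
  thus ?thesis using v(1) \<open>x = v\<close> by (auto simp: norm_A)
qed

text \<open>Let \<open>Q = X\<^sup>* X\<close>. The difference \<open>A\<^sup>2 - Q\<close> is Hilbert-Schmidt and \<open>Q\<^sup>2 = Q\<close>, so \<open>A\<^sup>2 (1 - A\<^sup>2)\<close> is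
  Hilbert-Schmidt. On the range of \<open>P\<close> both \<open>A\<^sup>2\<close> and \<open>1 + A\<close> are bounded below, and therefore
  \<open>P - A\<close> is Hilbert-Schmidt as well.\<close>

lemma hilbert_schmidt_F_diff_U:
  assumes X: "is_adjoint X X'" and Q: "is_projection (\<lambda>x. X' (X x))"
    and hs: "hilbert_schmidt (\<lambda>x. F x - X x)"
  shows "hilbert_schmidt (\<lambda>x. F x - U x)"
proof -
  note X'b = is_adjointD(2)[OF X] and Xb = is_adjointD(1)[OF X]
  define G where "G x = A (A x) - X' (X x)" for x
  define B where "B x = A (A x)" for x
  have Bb: "bounded_clinear B" unfolding B_def by (rule bounded_clinear_comp[OF bounded_A bounded_A])
  have Gb: "bounded_clinear G"
    unfolding G_def by (rule bounded_clinear_diff[OF Bb[unfolded B_def] is_projectionD(3)[OF Q]])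
  have "is_adjoint (\<lambda>x. X' (F x - X x)) (\<lambda>x. F' (X x) - X' (X x))"
    by (rule is_adjoint_comp[OF is_adjoint_sym[OF X] is_adjoint_diff[OF adj_F X]])
  hence "hilbert_schmidt (\<lambda>x. F' (X x) - X' (X x))"
    by (rule hilbert_schmidt_adjoint) (rule hilbert_schmidt_comp_left[OF X'b hs])
  hence "hilbert_schmidt (\<lambda>x. F' (F x - X x) + (F' (X x) - X' (X x)))"
    by (rule hilbert_schmidt_add(1)[OF hilbert_schmidt_comp_left[OF bounded_F' hs]])
  hence hsG: "hilbert_schmidt G" by (simp add: G_def[abs_def] A_A lin)
  \<comment> \<open>Substitute \<open>B = G + Q\<close> and use \<open>Q\<^sup>2 = Q\<close>.\<close>
  have "B x - B (B x) = G x - B (G x) - G (X' (X x))" for x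
    by (simp add: G_def B_def lin is_projectionD(2)[OF Q])
  moreover have "hilbert_schmidt (\<lambda>x. G x - B (G x) - G (X' (X x)))"
    by (rule hilbert_schmidt_diff(1)[OF hilbert_schmidt_diff(1)[OF hsG hilbert_schmidt_comp_left[OF Bb hsG]]
          hilbert_schmidt_comp_right[OF Gb hsG is_projectionD(3)[OF Q]]])
  ultimately have hsB: "hilbert_schmidt (\<lambda>x. B x - B (B x))" by simp
  show ?thesis
  proof (rule hilbert_schmidt_dominated[OF hsB, of _ "1 / a"])
    fix x
    define y where "y = P x - A x"
    define w where "w = P x - B x"
    have Pw: "P w = w" by (simp add: w_def B_def lin P_P P_A U_P)
    have Py: "P y = y" by (simp add: y_def lin P_P P_A U_P)
    have "F x - U x = - U y" by (simp add: y_def F_eq lin U_P)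
    hence "norm (F x - U x) = norm y" using norm_U[of y] Py by simp
    also have "\<dots> \<le> norm w"
    proof -
      have w: "w = y + A y" by (simp add: w_def y_def B_def lin A_P)
      have "0 \<le> inner (A y) y" using positive_A by (simp add: positive_operator_def inner_eq_Re_cinner)
      moreover have "(norm w)\<^sup>2 = (norm y)\<^sup>2 + 2 * inner (A y) y + (norm (A y))\<^sup>2"
        unfolding w by (simp add: power2_norm_eq_inner inner_add inner_commute)
      ultimately have "(norm y)\<^sup>2 \<le> (norm w)\<^sup>2" by (metis add_increasing2 add_mono_thms_linordered_semiring(1)
          mult_nonneg_nonneg order_refl zero_le_numeral zero_le_power2 add.right_neutral)
      thus ?thesis by (rule power2_le_imp_le) simp
    qed
    also have "\<dots> \<le> 1 / a * norm (B x - B (B x))"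
    proof -
      have "sqrt a * (sqrt a * norm w) \<le> sqrt a * norm (A w)"
        using A_bounded_below[OF Pw] a by (intro mult_left_mono) auto
      also have "\<dots> \<le> norm (A (A w))" by (rule A_bounded_below[OF P_A])
      also have "A (A w) = B x - B (B x)" by (simp add: w_def B_def lin A_P)
      finally have "sqrt a * (sqrt a * norm w) \<le> norm (B x - B (B x))" .
      hence "a * norm w \<le> norm (B x - B (B x))" using a by (simp add: mult.assoc[symmetric])
      thus ?thesis using a by (simp add: field_simps)
    qed
    finally show "norm (F x - U x) \<le> 1 / a * norm (B x - B (B x))" .
  qed
qed

end

section \<open>The distance from a frame to a Parseval frame\<close>

context frame_polar_decomposition
begin

text \<open>Here \<open>P - Q = U\<^sup>* (U - X) + (U - X)\<^sup>* X\<close>, and the second summand is the adjoint of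
  \<open>X\<^sup>* (U - X)\<close>.\<close>

lemma hilbert_schmidt_projection_difference:
  assumes X: "is_adjoint X X'" and hs: "hilbert_schmidt (\<lambda>x. U x - X x)"
  shows "hilbert_schmidt (\<lambda>x. P x - X' (X x))"
proof -
  have "is_adjoint (\<lambda>x. X' (U x - X x)) (\<lambda>x. U' (X x) - X' (X x))"
    by (rule is_adjoint_comp[OF is_adjoint_sym[OF X] is_adjoint_diff[OF adj_U X]])
  hence "hilbert_schmidt (\<lambda>x. U' (X x) - X' (X x))"
    by (rule hilbert_schmidt_adjoint) (rule hilbert_schmidt_comp_left[OF is_adjointD(2)[OF X] hs])
  from hilbert_schmidt_add(1)[OF hilbert_schmidt_comp_left[OF bounded_U' hs] this]
  show ?thesis by (simp add: lin)
qed

text \<open>Put \<open>W = (U - X) P\<close> and \<open>N = (1 - Q) P\<close>. Expanding the square of \<open>F - X = (F - U) + (U - X)\<close> and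
  evaluating the index as a difference of traces leaves \<open>tr (W A W\<^sup>*) + tr (N A N\<^sup>*)\<close> as the defect in
  the estimate: the mixed term is \<open>\<langle>A - P, Z\<rangle>\<close> with \<open>Z = U\<^sup>* W\<close>, only the self-adjoint part of \<open>Z\<close>
  contributes to it, and \<open>Z + Z\<^sup>* = W\<^sup>* W + N\<^sup>* N\<close>.\<close>

lemma distance_identity:
  assumes X: "is_adjoint X X'" and Q: "is_projection (\<lambda>x. X' (X x))"
    and hs: "hilbert_schmidt (\<lambda>x. F x - X x)"
  defines "W \<equiv> \<lambda>x. U x - X (P x)" and "N \<equiv> \<lambda>x. P x - X' (X (P x))"
  shows "hilbert_schmidt W" "hilbert_schmidt N"
    "hs_sq (\<lambda>x. F x - X x) = hs_sq (\<lambda>x. F x - U x) - real_of_int (pair_index P (\<lambda>x. X' (X x)))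
      + hs_inner (\<lambda>x. W (A x)) W + hs_inner (\<lambda>x. N (A x)) N"
proof -
  note Xb = is_adjointD(1)[OF X] and X'b = is_adjointD(2)[OF X]
  note linX = bounded_clinear_simps[OF Xb] bounded_clinear_simps[OF X'b]
  note Qb = is_projectionD(3)[OF Q] and QQ = is_projectionD(2)[OF Q] and Qa = is_projectionD(1)[OF Q]
  have Cb: "bounded_clinear (\<lambda>x. x - P x)" by (rule bounded_clinear_diff[OF bounded_clinear_ident bounded_P])
  define M where "M x = F x - U x" for x
  define V where "V x = U x - X x" for x
  define D where "D x = A x - P x" for x
  have hsM: "hilbert_schmidt M" unfolding M_def by (rule hilbert_schmidt_F_diff_U[OF X Q hs])
  have Mb: "bounded_clinear M" unfolding M_def by (rule bounded_clinear_diff[OF F bounded_U])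
  have Vb: "bounded_clinear V" unfolding V_def by (rule bounded_clinear_diff[OF bounded_U Xb])
  have "hilbert_schmidt (\<lambda>x. (F x - X x) - M x)" by (rule hilbert_schmidt_diff(1)[OF hs hsM])
  hence hsV: "hilbert_schmidt V" by (simp add: M_def V_def[abs_def])
  have WV: "W x = V (P x)" for x by (simp add: W_def V_def U_P)
  have Wb: "bounded_clinear W"
    unfolding W_def by (rule bounded_clinear_diff[OF bounded_U bounded_clinear_comp[OF Xb bounded_P]])
  show hsW: "hilbert_schmidt W"
    using hilbert_schmidt_comp_right[OF Vb hsV bounded_P] by (simp add: WV[abs_def])
  have hsD: "hilbert_schmidt D"
  proof -
    have "U' (M x) = D x" for x by (simp add: M_def D_def F_eq lin P_A)
    thus ?thesis using hilbert_schmidt_comp_left[OF bounded_U' hsM] by simp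
  qed

  have hsPQ: "hilbert_schmidt (\<lambda>x. P x - X' (X x))"
    by (rule hilbert_schmidt_projection_difference[OF X hsV[unfolded V_def[abs_def]]])
  have Nb: "bounded_clinear N"
    unfolding N_def by (rule bounded_clinear_diff[OF bounded_P bounded_clinear_comp[OF Qb bounded_P]])
  show hsN: "hilbert_schmidt N"
  proof -
    have "N = (\<lambda>x. P (P x) - X' (X (P x)))" unfolding N_def by (simp add: U_P)
    thus ?thesis
      using hilbert_schmidt_comp_right[OF bounded_clinear_diff[OF bounded_P Qb] hsPQ bounded_P]
      by (simp only:)
  qed
  have index: "hs_sq (\<lambda>x. X' (X (x - P x))) - hs_sq N = - real_of_int (pair_index P (\<lambda>x. X' (X x)))"
    using pair_index_eq_trace_difference[OF projection_P Q hsPQ] by (simp add: N_def)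

  have "(\<lambda>x. F x - X x) = (\<lambda>x. M x + V x)" by (simp add: M_def V_def)
  hence 1: "hs_sq (\<lambda>x. F x - X x) = hs_sq M + 2 * hs_inner M V + hs_sq V"
    using hilbert_schmidt_add(2)[OF hsM hsV] by simp
  have 2: "hs_sq V = hs_sq W + hs_sq (\<lambda>x. X' (X (x - P x)))"
  proof -
    have "norm (V (x - P x)) = norm (X' (X (x - P x)))" for x
      using adjoint_norm_projection(1)[OF X Q, of "x - P x"] U_diff_P[of x] by (simp add: V_def)
    thus ?thesis
      using hs_sq_projection_split[OF projection_P Vb hsV] by (simp add: hs_sq_def WV)
  qed
  have 3: "hs_inner M V = hs_inner M W"
  proof -
    have hsVC: "hilbert_schmidt (\<lambda>x. V (x - P x))" by (rule hilbert_schmidt_comp_right[OF Vb hsV Cb])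
    have "M (P x) = M x" for x by (simp add: M_def F_eq A_P U_P)
    hence "hs_inner M (\<lambda>x. V (x - P x)) = 0"
      using hs_inner_projection_complement[OF projection_P Mb hsM Vb hsV] by simp
    moreover have "V = (\<lambda>x. W x + V (x - P x))" by (simp add: WV bounded_clinear_simps[OF Vb])
    ultimately show ?thesis using hs_inner_add_right[OF hsW hsVC hsM] by simp
  qed
  define Z where "Z x = U' (W x)" for x
  have 4: "hs_inner M W = hs_inner D Z"
  proof -
    have "inner (M x) (W x) = inner (D x) (Z x)" for x
    proof -
      have "M x = U (D x)" by (simp add: M_def D_def F_eq lin U_P)
      thus ?thesis by (simp add: is_adjointD(5)[OF adj_U] Z_def)
    qed
    thus ?thesis by (simp add: hs_inner_def)
  qed
  define W' where "W' y = U' y - P (X' y)" for y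
  define N' where "N' x = P x - P (X' (X x))" for x
  have adj_W: "is_adjoint W W'"
    unfolding W_def W'_def by (rule is_adjoint_diff[OF adj_U is_adjoint_comp[OF X adj_P]])
  have adj_N: "is_adjoint N N'"
    unfolding N_def N'_def by (rule is_adjoint_diff[OF adj_P is_adjoint_comp[OF Qa adj_P]])
  note W'b = is_adjointD(2)[OF adj_W] and N'b = is_adjointD(2)[OF adj_N]
  have adj_Z: "is_adjoint Z (\<lambda>x. W' (U x))"
    unfolding Z_def by (rule is_adjoint_comp[OF is_adjoint_sym[OF adj_U] adj_W])
  have adj_D: "is_adjoint D D" unfolding D_def by (rule is_adjoint_diff[OF adj_A adj_P])
  have hsZ: "hilbert_schmidt Z" unfolding Z_def by (rule hilbert_schmidt_comp_left[OF bounded_U' hsW])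
  have hsZ': "hilbert_schmidt (\<lambda>x. W' (U x))" by (rule hilbert_schmidt_adjoint[OF adj_Z hsZ])
  have hsWW: "hilbert_schmidt (\<lambda>x. W' (W x))" by (rule hilbert_schmidt_comp_left[OF W'b hsW])
  have hsNN: "hilbert_schmidt (\<lambda>x. N' (N x))" by (rule hilbert_schmidt_comp_left[OF N'b hsN])
  have "Z x + W' (U x) = W' (W x) + N' (N x)" for x
    by (simp add: Z_def W_def W'_def N_def N'_def lin linX P_P U_P QQ)
  moreover have "hs_inner D Z = hs_inner D (\<lambda>x. W' (U x))"
    by (rule hs_inner_adjoint[OF adj_D adj_Z hsD hsZ])
  ultimately have 5: "2 * hs_inner D Z = hs_inner D (\<lambda>x. W' (W x)) + hs_inner D (\<lambda>x. N' (N x))"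
    using hs_inner_add_right[OF hsZ hsZ' hsD] hs_inner_add_right[OF hsWW hsNN hsD] by simp
  \<comment> \<open>Adding \<open>\<parallel>T\<parallel>\<^sup>2 = \<langle>T P, T\<rangle>\<close> turns \<open>D = A - P\<close> back into \<open>A\<close>.\<close>
  have A_split: "hs_inner D (\<lambda>x. T' (T x)) + hs_sq T = hs_inner (\<lambda>x. T (A x)) T"
    if T: "is_adjoint T T'" "hilbert_schmidt T" "\<And>x. T (P x) = T x" for T :: "ell2 \<Rightarrow> 'b :: complex_inner" and T'
  proof -
    note Tb = is_adjointD(1)[OF T(1)]
    have "hs_inner D (\<lambda>x. T' (T x)) = hs_inner (\<lambda>x. T (D x)) T"
      by (simp add: hs_inner_def is_adjointD(5)[OF T(1)])
    moreover have "hilbert_schmidt (\<lambda>x. T (D x))"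
      by (rule hilbert_schmidt_comp_right[OF Tb T(2) is_adjointD(1)[OF adj_D]])
    moreover have "T (A x) = T (D x) + T x" for x by (simp add: D_def bounded_clinear_simps[OF Tb] T(3))
    ultimately show ?thesis using hs_inner_add_left[of "\<lambda>x. T (D x)" T T] T(2) by (simp add: hs_inner_self)
  qed
  have "hs_inner D (\<lambda>x. W' (W x)) + hs_sq W = hs_inner (\<lambda>x. W (A x)) W"
    by (rule A_split[OF adj_W hsW]) (simp add: W_def U_P P_P)
  moreover have "hs_inner D (\<lambda>x. N' (N x)) + hs_sq N = hs_inner (\<lambda>x. N (A x)) N"
    by (rule A_split[OF adj_N hsN]) (simp add: N_def U_P P_P)
  ultimately show "hs_sq (\<lambda>x. F x - X x) = hs_sq (\<lambda>x. F x - U x) - real_of_int (pair_index P (\<lambda>x. X' (X x)))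
      + hs_inner (\<lambda>x. W (A x)) W + hs_inner (\<lambda>x. N (A x)) N"
    using 1 2 3 4 5 index by (simp add: M_def[abs_def])
qed

text \<open>If the lower bound is attained then \<open>W A = 0\<close> for \<open>W = (U - X) P\<close>. Hence \<open>A W\<^sup>* = 0\<close>, and since \<open>A\<close> is
  injective on the range of \<open>P\<close>, which contains that of \<open>W\<^sup>*\<close>, also \<open>W = 0\<close>.\<close>

lemma distance_lower_bound:
  assumes X: "is_adjoint X X'" and Q: "is_projection (\<lambda>x. X' (X x))"
    and hs: "hilbert_schmidt (\<lambda>x. F x - X x)"
  shows "hs_sq (\<lambda>x. F x - U x) - real_of_int (pair_index P (\<lambda>x. X' (X x))) \<le> hs_sq (\<lambda>x. F x - X x)"
    and "hs_sq (\<lambda>x. F x - X x) \<le> hs_sq (\<lambda>x. F x - U x) - real_of_int (pair_index P (\<lambda>x. X' (X x)))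
      \<Longrightarrow> X (P x) = U x"
proof -
  note Xb = is_adjointD(1)[OF X] and X'b = is_adjointD(2)[OF X] and Qa = is_projectionD(1)[OF Q]
  define W where "W x = U x - X (P x)" for x
  define N where "N x = P x - X' (X (P x))" for x
  note id = distance_identity[OF X Q hs, folded W_def N_def]
  define W' where "W' y = U' y - P (X' y)" for y
  have adj_W: "is_adjoint W W'"
    unfolding W_def W'_def by (rule is_adjoint_diff[OF adj_U is_adjoint_comp[OF X adj_P]])
  have Nb: "bounded_clinear N"
    unfolding N_def by (rule is_adjointD(1)[OF is_adjoint_diff[OF adj_P is_adjoint_comp[OF Qa adj_P]]])
  note Wb = is_adjointD(1)[OF adj_W]
  obtain b where b: "b > 0" "\<And>x. norm (A x) \<le> b * norm x"
    by (rule bounded_clinear_pos_bound[OF bounded_A]) blast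
  have hsW: "hilbert_schmidt W" and hsN: "hilbert_schmidt N" using id(1,2) by (simp_all add: W_def[abs_def] N_def[abs_def])
  have id3: "hs_sq (\<lambda>x. F x - X x) = hs_sq (\<lambda>x. F x - U x) - real_of_int (pair_index P (\<lambda>x. X' (X x)))
      + hs_inner (\<lambda>x. W (A x)) W + hs_inner (\<lambda>x. N (A x)) N"
    using id(3) by (simp add: W_def[abs_def] N_def[abs_def])
  have hsWA: "hilbert_schmidt (\<lambda>x. W (A x))" by (rule hilbert_schmidt_comp_right[OF Wb hsW bounded_A])
  have WA: "hs_sq (\<lambda>x. W (A x)) \<le> 2 * b * hs_inner (\<lambda>x. W (A x)) W"
    by (rule hs_inner_positive[OF positive_A b Wb hsW])
  have "hs_sq (\<lambda>x. N (A x)) \<le> 2 * b * hs_inner (\<lambda>x. N (A x)) N"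
    by (rule hs_inner_positive[OF positive_A b Nb hsN])
  hence "0 \<le> 2 * b * hs_inner (\<lambda>x. N (A x)) N"
    using hs_sq_nonneg[OF hilbert_schmidt_comp_right[OF Nb hsN bounded_A]] by linarith
  hence N0: "0 \<le> hs_inner (\<lambda>x. N (A x)) N" using b(1) by (simp add: zero_le_mult_iff)
  have "0 \<le> 2 * b * hs_inner (\<lambda>x. W (A x)) W" using WA hs_sq_nonneg[OF hsWA] by linarith
  hence W0: "0 \<le> hs_inner (\<lambda>x. W (A x)) W" using b(1) by (simp add: zero_le_mult_iff)
  show "hs_sq (\<lambda>x. F x - U x) - real_of_int (pair_index P (\<lambda>x. X' (X x))) \<le> hs_sq (\<lambda>x. F x - X x)"
    using id3 N0 W0 by simp
  assume "hs_sq (\<lambda>x. F x - X x) \<le> hs_sq (\<lambda>x. F x - U x) - real_of_int (pair_index P (\<lambda>x. X' (X x)))"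
  hence "hs_inner (\<lambda>x. W (A x)) W = 0" using id3 N0 W0 by linarith
  hence "hs_sq (\<lambda>x. W (A x)) = 0" using WA hs_sq_nonneg[OF hsWA] by simp
  hence "W (A (unit_vec i)) = 0" for i
    using hsWA unfolding hs_sq_def hilbert_schmidt_def by (simp add: suminf_eq_zero_iff)
  hence WA0: "(\<lambda>x. W (A x)) = (\<lambda>x. 0)"
    by (intro bounded_clinear_eqI bounded_clinear_comp[OF Wb bounded_A])
      (auto intro!: bounded_clinearI[where C = 0])
  have W'0: "W' y = 0" for y
  proof -
    have "A (W' y) = 0"
    proof (rule cinner_ext)
      fix x
      have "cinner x (A (W' y)) = cinner (W (A x)) y"
        using is_adjointD(3)[OF adj_A, of x "W' y"] is_adjointD(3)[OF adj_W, of "A x" y] by simp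
      thus "cinner x (A (W' y)) = cinner x 0" using fun_cong[OF WA0, of x] by simp
    qed
    hence "P (W' y) = 0" by (simp only: A_zero_iff)
    thus ?thesis by (simp add: W'_def lin P_U' U_P)
  qed
  have "W x = 0"
  proof (rule cinner_ext)
    fix y show "cinner y (W x) = cinner y 0" using is_adjointD(4)[OF adj_W, of y x] W'0 by simp
  qed
  thus "X (P x) = U x" by (simp add: W_def)
qed

section \<open>Extending the canonical partial isometry\<close>

text \<open>Only the values of \<open>S\<close> on \<open>ker F\<close> are meaningful. Composition with \<open>1 - P\<close> turns \<open>S\<close> into a
  globally defined partial isometry with the same image.\<close>

lemma partial_isometry_on_kernel:
  assumes S: "partial_isometry_between (ker F) (ortho_compl (range F)) S"
  defines "Z \<equiv> \<lambda>x. S (x - P x)"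
  shows "bounded_clinear Z" "is_projection (\<lambda>x. cadjoint Z (Z x))" "Z (P x) = 0"
    "U' (Z x) = 0" "F' (Z x) = 0" "range Z = S ` ker F"
proof -
  have CF: "x - P x \<in> ker F" for x unfolding ker_F by (simp add: ker_def lin U_P)
  have SF: "S x \<in> ortho_compl (range F)" if "x \<in> ker F" for x
    using S that by (auto simp: partial_isometry_between_def)
  have Sadd: "S (x + y) = S x + S y" and Sscale: "S (c *\<^sub>C x) = c *\<^sub>C S x" if "x \<in> ker F" "y \<in> ker F" for x y c
    using S that by (simp_all add: partial_isometry_between_def)
  obtain C where C: "\<And>x. x \<in> ker F \<Longrightarrow> norm (S x) \<le> C * norm x"
    using S unfolding partial_isometry_between_def by blast
  have Siso: "norm (S x) = norm x" if "x \<in> ker F" "x \<in> ortho_compl (ker F \<inter> ker S)" for x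
    using S that by (simp add: partial_isometry_between_def)
  have Z: "Z x = S (x - P x)" for x by (simp add: Z_def)
  show Zb: "bounded_clinear Z"
  proof (rule bounded_clinearI[where C = "\<bar>C\<bar>"])
    fix x y c
    have "x + y - P (x + y) = (x - P x) + (y - P y)" by (simp add: lin)
    thus "Z (x + y) = Z x + Z y" by (simp only: Z Sadd[OF CF CF])
    have "c *\<^sub>C x - P (c *\<^sub>C x) = c *\<^sub>C (x - P x)" by (simp add: lin scaleC_diff_right)
    thus "Z (c *\<^sub>C x) = c *\<^sub>C Z x" by (simp only: Z Sscale[OF CF CF])
    have "norm (Z x) \<le> C * norm (x - P x)" unfolding Z by (rule C[OF CF])
    also have "\<dots> \<le> \<bar>C\<bar> * norm x"
      using projection_norm_le[OF projection_complement[OF projection_P], of x]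
      by (intro mult_mono) auto
    finally show "norm (Z x) \<le> norm x * \<bar>C\<bar>" by (simp add: mult.commute)
  qed
  have adj: "is_adjoint Z (cadjoint Z)" by (rule is_adjoint_cadjoint[OF Zb])
  have S0: "S 0 = 0"
  proof -
    have "0 \<in> ker F" by (simp add: ker_def lin)
    thus ?thesis using Sadd[of 0 0] by simp
  qed
  show ZP: "Z (P x) = 0" for x by (simp add: Z P_P S0 U_P)
  show "is_projection (\<lambda>x. cadjoint Z (Z x))"
  proof (rule partial_isometry_projection(1)[OF adj])
    fix x assume x: "x \<in> ortho_compl (ker Z)"
    have "cinner (P x) (P x) = cinner x (P x)"
      using is_adjointD(3)[OF adj_P, of x "P x"] by (simp add: P_P U_P)
    also have "\<dots> = 0" using x ZP by (simp add: ortho_compl_def ker_def)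
    finally have Px: "P x = 0" by (simp add: cinner_self)
    hence xF: "x \<in> ker F" by (simp add: ker_def F_zero_iff)
    have "ker F \<inter> ker S \<subseteq> ker Z"
    proof
      fix y assume "y \<in> ker F \<inter> ker S"
      hence "P y = 0" "S y = 0" using F_zero_iff by (auto simp: ker_def)
      thus "y \<in> ker Z" by (simp add: ker_def Z)
    qed
    hence "x \<in> ortho_compl (ker F \<inter> ker S)" using x by (auto simp: ortho_compl_def)
    thus "norm (Z x) = norm x" using Siso[OF xF] Px by (simp add: Z)
  qed
  show "U' (Z x) = 0" for x unfolding Z by (rule U'_orthogonal[OF SF[OF CF]])
  show "F' (Z x) = 0" for x
  proof (rule cinner_ext)
    fix y
    have "cinner (Z x) (F y) = 0" using SF[OF CF, of x] by (simp add: Z ortho_compl_def)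
    thus "cinner y (F' (Z x)) = cinner y 0"
      using is_adjointD(3)[OF adj_F, of y "Z x"] cinner_commute_zero[of "F y" "Z x"] by simp
  qed
  show "range Z = S ` ker F"
  proof
    show "range Z \<subseteq> S ` ker F" using CF by (auto simp: Z)
    show "S ` ker F \<subseteq> range Z"
    proof
      fix y assume "y \<in> S ` ker F"
      then obtain x where "x \<in> ker F" "y = S x" by blast
      hence "Z x = y" using F_zero_iff by (simp add: Z ker_def)
      thus "y \<in> range Z" by blast
    qed
  qed
qed

text \<open>The operator \<open>Y = U + S (1 - P)\<close> has \<open>Y\<^sup>* Y = P + R\<close>, where the range of the projection \<open>R\<close> is
  contained in \<open>ker P\<close> and has the dimension of the image of \<open>S\<close>.\<close>

lemma extended_partial_isometry:
  assumes S: "partial_isometry_between (ker F) (ortho_compl (range F)) S"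
    and n: "ecdim (S ` ker F) = enat n"
  defines "Y \<equiv> \<lambda>x. U x + S (x - P x)"
  defines "Q \<equiv> \<lambda>x. cadjoint Y (Y x)"
  shows "bounded_clinear Y" "is_projection Q" "fredholm_pair P Q" "pair_index P Q = - int n"
    "hilbert_schmidt (\<lambda>x. F x - U x) \<Longrightarrow> hilbert_schmidt (\<lambda>x. F x - Y x)"
    "hilbert_schmidt (\<lambda>x. F x - U x) \<Longrightarrow> hs_sq (\<lambda>x. F x - Y x) = hs_sq (\<lambda>x. F x - U x) + real n"
proof -
  define Z where "Z x = S (x - P x)" for x
  note Z = partial_isometry_on_kernel[OF S, folded Z_def]
  have Zb: "bounded_clinear Z" using Z(1) by (simp add: Z_def[abs_def])
  define Z' where "Z' = cadjoint Z"
  define R where "R x = Z' (Z x)" for x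
  have adj_Z: "is_adjoint Z Z'" unfolding Z'_def by (rule is_adjoint_cadjoint[OF Zb])
  have R: "is_projection R" using Z(2) by (simp add: R_def[abs_def] Z'_def Z_def[abs_def])
  note Z'b = is_adjointD(2)[OF adj_Z] and Rb = is_projectionD(3)[OF R]
  note linZ = bounded_clinear_simps[OF Zb] bounded_clinear_simps[OF Z'b]
  have R': "is_projection (\<lambda>x. Z' (Z x))" using R by (simp add: R_def[abs_def])
  have ZP: "Z (P x) = 0" and U'Z: "U' (Z x) = 0" and F'Z: "F' (Z x) = 0" for x
    using Z(3,4,5) by (simp_all add: Z_def)
  have Z'U: "Z' (U x) = 0" for x
  proof (rule cinner_ext)
    fix y show "cinner y (Z' (U x)) = cinner y 0"
      using is_adjointD(3)[OF adj_Z, of y "U x"] is_adjointD(4)[OF adj_U, of "Z y" x] U'Z[of y] by simp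
  qed
  have RP: "R (P x) = 0" for x by (simp add: R_def ZP linZ)
  have PR: "P (R x) = 0" for x
  proof (rule cinner_ext)
    fix y show "cinner y (P (R x)) = cinner y 0"
      using is_adjointD(3)[OF adj_P, of y "R x"] is_adjointD(3)[OF is_projectionD(1)[OF R], of "P y" x] RP[of y]
      by simp
  qed
  have Y: "Y x = U x + Z x" for x by (simp add: Y_def Z_def)
  have adj_Y: "is_adjoint Y (\<lambda>y. U' y + Z' y)"
    using is_adjoint_add[OF adj_U adj_Z] by (simp add: Y[abs_def])
  show Yb: "bounded_clinear Y" by (rule is_adjointD(1)[OF adj_Y])
  have Q: "Q x = P x + R x" for x
    by (simp add: Q_def cadjoint_eq[OF adj_Y] Y R_def lin linZ U'Z Z'U)
  show "is_projection Q"
    unfolding is_projection_def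
  proof
    show "is_adjoint Q Q"
      using is_adjoint_add[OF adj_P is_projectionD(1)[OF R]] by (simp add: Q[abs_def])
    show "\<forall>x. Q (Q x) = Q x"
      using RP PR is_projectionD(2)[OF R]
      by (simp add: Q lin P_P bounded_clinear_simps[OF Rb] U_P)
  qed

  have RZ: "Z (R x) = Z x" and normR: "norm (Z x) = norm (R x)" for x
    using adjoint_norm_projection[OF adj_Z R'] by (simp_all add: R_def)
  have dim: "ecdim (range R) = enat n"
  proof -
    have "Z ` range R = range Z" using RZ by (auto simp: image_iff)
    moreover have "Z' ` range Z = range R" by (auto simp: R_def)
    ultimately have "ecdim (range R) = ecdim (range Z)" by (intro ecdim_eqI[OF Zb Z'b])
    moreover have "range Z = S ` ker F" using Z(6) by (simp add: Z_def[abs_def])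
    ultimately show ?thesis using n by simp
  qed
  hence finR: "finite_cdim (range R)" and cdimR: "cdim (range R) = n"
    by (auto simp: ecdim_def split: if_splits)

  have QP: "Q (P x) = P x" for x by (simp add: Q P_P RP U_P)
  have range_PQ: "range P \<subseteq> range Q" using QP by (metis image_subsetI rangeI)
  have kerQP: "ker Q \<inter> range P = {0}"
  proof -
    have "x = 0" if "Q x = 0" "P x = x" for x using QP[of x] that by simp
    moreover have "P 0 = 0" "Q 0 = 0" by (simp_all add: Q lin bounded_clinear_simps[OF Rb])
    ultimately show ?thesis
      using projection_range_iff[OF projection_P] by (auto simp: ker_def simp del: U_P)
  qed
  have kerPQ: "range Q \<inter> ker P = range R"
  proof
    show "range Q \<inter> ker P \<subseteq> range R"
    proof
      fix x assume "x \<in> range Q \<inter> ker P"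
      hence "Q x = x" "P x = 0" using projection_range_iff[OF \<open>is_projection Q\<close>] by (auto simp: ker_def)
      hence "R x = x" by (simp add: Q)
      thus "x \<in> range R" by (metis rangeI)
    qed
    show "range R \<subseteq> range Q \<inter> ker P"
    proof
      fix x assume "x \<in> range R"
      hence "R x = x" using projection_range_iff[OF R] by blast
      hence "P x = 0" using PR[of x] by simp
      hence "Q x = x" using \<open>R x = x\<close> by (simp add: Q)
      thus "x \<in> range Q \<inter> ker P" using \<open>P x = 0\<close> projection_range_iff[OF \<open>is_projection Q\<close>] by (simp add: ker_def)
    qed
  qed
  have zero: "cdim {0 :: ell2} = 0"
    using complex_vector.dim_le_card[of "{0 :: ell2}" "{}"] by simp
  show "pair_index P Q = - int n"
    unfolding pair_index_def kerQP kerPQ zero cdimR by simp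
  show "fredholm_pair P Q"
    unfolding fredholm_pair_def fredholm_between_def
  proof (intro conjI)
    have comp: "(Q \<circ> P) ` range P = range P" by (auto simp: QP P_P image_iff U_P)
    show "(Q \<circ> P) ` range P \<subseteq> range Q" unfolding comp by (rule range_PQ)
    show "closed ((Q \<circ> P) ` range P)" unfolding comp by (rule closed_projection_range[OF projection_P])
    have "range P \<inter> ker (Q \<circ> P) \<subseteq> {0}"
    proof
      fix x assume x: "x \<in> range P \<inter> ker (Q \<circ> P)"
      hence "P x = x" using projection_range_iff[OF projection_P] by blast
      moreover have "Q (P x) = 0" using x by (simp add: ker_def)
      ultimately show "x \<in> {0}" using QP[of x] by simp
    qed
    hence "range P \<inter> ker (Q \<circ> P) \<subseteq> cspan {}" by simp
    thus "finite_cdim (range P \<inter> ker (Q \<circ> P))" unfolding finite_cdim_def by blast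
    obtain B where B: "finite B" "B \<subseteq> range R" "range R \<subseteq> cspan B" "card B = cdim (range R)" "\<not> cdependent B"
      by (rule finite_cdim_basis[OF finR])
    have "range Q \<subseteq> cspan (range P \<union> B)"
    proof
      fix x assume "x \<in> range Q"
      then obtain z where z: "x = P z + R z" using Q by auto
      have "P z \<in> cspan (range P \<union> B)" by (rule complex_vector.span_base) simp
      moreover have "R z \<in> cspan (range P \<union> B)"
        using B(3) complex_vector.span_mono[of B "range P \<union> B"] by blast
      ultimately show "x \<in> cspan (range P \<union> B)" unfolding z by (rule complex_vector.span_add)
    qed
    thus "\<exists>B. finite B \<and> B \<subseteq> range Q \<and> range Q \<subseteq> cspan ((Q \<circ> P) ` range P \<union> B)"
      unfolding comp using B(1,2) kerPQ by (intro exI[of _ B]) auto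
  qed

  have R_proj: "R x \<in> range R" "y \<in> range R \<Longrightarrow> cinner (R x) y = cinner x y" for x y
    using is_adjointD(3)[OF is_projectionD(1)[OF R], of x y] projection_range_iff[OF R, of y] by auto
  note trace = projection_hilbert_schmidt_dim[OF csubspace_range[OF Rb] R_proj]
  have hsR: "hilbert_schmidt R" using trace(1) finR by blast
  have hsR_sq: "hs_sq R = real n" using trace(2)[OF _ finR] cdimR by simp
  have hsZ: "hilbert_schmidt Z" using hsR normR by (simp add: hilbert_schmidt_def)
  have hsZ_sq: "hs_sq Z = real n" using hsR_sq normR by (simp add: hs_sq_def)
  have eq: "F x - Y x = (F x - U x) - Z x" for x by (simp add: Y)
  show "hilbert_schmidt (\<lambda>x. F x - Y x)" if "hilbert_schmidt (\<lambda>x. F x - U x)"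
    unfolding eq by (rule hilbert_schmidt_diff(1)[OF that hsZ])
  have "inner (F x - U x) (Z x) = 0" for x
    by (simp add: inner_diff is_adjointD(5)[OF adj_F] is_adjointD(5)[OF adj_U] F'Z U'Z)
  hence "hs_inner (\<lambda>x. F x - U x) Z = 0" by (simp add: hs_inner_def)
  thus "hs_sq (\<lambda>x. F x - Y x) = hs_sq (\<lambda>x. F x - U x) + real n" if "hilbert_schmidt (\<lambda>x. F x - U x)"
    unfolding eq hilbert_schmidt_diff(2)[OF that hsZ] hsZ_sq by simp
qed

text \<open>Conversely, a partial isometry \<open>X\<close> that agrees with \<open>U\<close> on the range of \<open>P\<close> restricts to a partial
  isometry on \<open>ker F\<close>, because its initial space contains the range of \<open>P\<close>.\<close>

lemma restriction_partial_isometry: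
  assumes X: "is_adjoint X X'" and Q: "is_projection (\<lambda>x. X' (X x))"
    and XP: "\<And>x. X (P x) = U x"
    and fin: "finite_cdim (range (\<lambda>x. X' (X x)) \<inter> ker P)"
  shows "partial_isometry_between (ker F) (ortho_compl (range F)) X"
    and "ecdim (X ` ker F) = enat (nat (- pair_index P (\<lambda>x. X' (X x))))"
    and "X x = U x + X (x - P x)"
proof -
  note Xb = is_adjointD(1)[OF X] and X'b = is_adjointD(2)[OF X]
  note linX = bounded_clinear_simps[OF Xb] bounded_clinear_simps[OF X'b]
  have normQ: "norm (X x) = norm (X' (X x))" and XQ: "X (X' (X x)) = X x" for x
    by (rule adjoint_norm_projection[OF X Q])+
  \<comment> \<open>\<open>Q\<close> preserves the norm of \<open>P x\<close>, so it fixes this vector.\<close>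
  have QP: "X' (X (P x)) = P x" for x
    by (rule projection_norm_eq[OF Q]) (simp only: normQ[of "P x", symmetric], simp only: XP norm_U)
  have PQ: "P (X' (X x)) = P x" for x
  proof (rule cinner_ext)
    fix y show "cinner y (P (X' (X x))) = cinner y (P x)"
      using is_adjointD(3)[OF adj_P, of y "X' (X x)"] is_adjointD(3)[OF is_projectionD(1)[OF Q], of "P y" x]
        QP[of y] is_adjointD(3)[OF adj_P, of y x] by simp
  qed
  have XA: "F x = X (A x)" for x using XP[of "A x"] by (simp add: F_eq P_A)
  have QA: "X' (X (A x)) = A x" for x using QP[of "A x"] by (simp only: P_A)
  show "X x = U x + X (x - P x)" using XP[of x] by (simp add: linX)
  show "partial_isometry_between (ker F) (ortho_compl (range F)) X"
    unfolding partial_isometry_between_def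
  proof (intro conjI)
    show "X ` ker F \<subseteq> ortho_compl (range F)"
    proof
      fix y assume "y \<in> X ` ker F"
      then obtain x where x: "F x = 0" "y = X x" by (auto simp: ker_def)
      have "cinner (X x) (F z) = 0" for z
      proof -
        have "cinner (X x) (F z) = cinner x (A z)"
          using is_adjointD(3)[OF X, of x "X (A z)"] by (simp add: XA QA)
        also have "\<dots> = cinner (A x) z" by (simp add: is_adjointD(3)[OF adj_A])
        also have "\<dots> = 0" using x(1) norm_A[of x] by simp
        finally show ?thesis .
      qed
      thus "y \<in> ortho_compl (range F)" by (auto simp: x(2) ortho_compl_def)
    qed
    obtain b where "\<And>x. norm (X x) \<le> b * norm x" by (rule bounded_clinear_pos_bound[OF Xb]) blast
    thus "\<exists>K. \<forall>x\<in>ker F. norm (X x) \<le> K * norm x" by blast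
    show "\<forall>x\<in>ker F \<inter> ortho_compl (ker F \<inter> ker X). norm (X x) = norm x"
    proof
      fix x assume x: "x \<in> ker F \<inter> ortho_compl (ker F \<inter> ker X)"
      define z where "z = x - X' (X x)"
      have "P x = 0" using x F_zero_iff by (simp add: ker_def)
      hence "P z = 0" using PQ[of x] by (simp add: z_def lin)
      hence "F z = 0" by (simp only: F_zero_iff)
      moreover have "X z = 0" by (simp add: z_def linX XQ)
      ultimately have "cinner x z = 0" using x by (auto simp: ortho_compl_def ker_def)
      moreover have "cinner (X' (X x)) z = 0"
        using is_adjointD(3)[OF is_projectionD(1)[OF Q], of x z] \<open>X z = 0\<close> by (simp add: linX)
      ultimately have "cinner (x - X' (X x)) z = 0" by (simp only: cinner_diff_left diff_zero)
      hence "cinner z z = 0" by (simp only: z_def)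
      hence "X' (X x) = x" by (simp add: cinner_self z_def)
      thus "norm (X x) = norm x" by (simp add: normQ)
    qed
  qed (use linX in auto)
  define N where "N = range (\<lambda>x. X' (X x)) \<inter> ker P"
  have NQ: "X' (X x) = x" if "x \<in> N" for x using that projection_range_iff[OF Q] by (simp add: N_def)
  have "X ` N = X ` ker F"
  proof
    show "X ` N \<subseteq> X ` ker F" by (auto simp: N_def ker_F)
    show "X ` ker F \<subseteq> X ` N"
    proof
      fix y assume "y \<in> X ` ker F"
      then obtain x where x: "P x = 0" "y = X x" by (auto simp: ker_def F_zero_iff)
      have "X' (X x) \<in> N" using PQ[of x] x(1) by (simp add: N_def ker_def)
      moreover have "y = X (X' (X x))" by (simp add: XQ x)
      ultimately show "y \<in> X ` N" by blast
    qed
  qed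
  moreover have "X' ` X ` N = N" using NQ by (auto simp: image_iff)
  ultimately have "ecdim N = ecdim (X ` ker F)" by (intro ecdim_eqI[OF Xb X'b]) auto
  moreover have "ker (\<lambda>x. X' (X x)) \<inter> range P = {0}"
  proof -
    have "x = 0" if "X' (X x) = 0" "P x = x" for x using QP[of x] that by simp
    thus ?thesis
      using projection_range_iff[OF projection_P] by (auto simp: ker_def lin linX simp del: U_P)
  qed
  moreover have "cdim {0 :: ell2} = 0"
    using complex_vector.dim_le_card[of "{0 :: ell2}" "{}"] by simp
  ultimately show "ecdim (X ` ker F) = enat (nat (- pair_index P (\<lambda>x. X' (X x))))"
    using fin unfolding N_def ecdim_def pair_index_def by simp
qed

end

section \<open>Partial isometries of given rank\<close>

lemma orthonormal_partial_isometry: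
  fixes v :: "nat \<Rightarrow> 'a :: complex_inner" and w :: "nat \<Rightarrow> 'b :: complex_inner"
  assumes V: "csubspace V" and W: "csubspace W"
    and v: "orthonormal v {..<n}" "v ` {..<n} \<subseteq> V" and w: "orthonormal w {..<n}" "w ` {..<n} \<subseteq> W"
  defines "S \<equiv> \<lambda>x. \<Sum>j\<in>{..<n}. cinner x (v j) *\<^sub>C w j"
  shows "partial_isometry_between V W S" "ecdim (S ` V) = enat n" "\<And>j. j < n \<Longrightarrow> S (v j) = w j"
proof -
  have wS: "cinner (S x) (w j) = cinner x (v j)" if "j < n" for x j
  proof -
    have "cinner (S x) (w j) = (\<Sum>i\<in>{..<n}. if i = j then cinner x (v j) else 0)"
      unfolding S_def cinner_sum_left cinner_scaleC_left
      using w(1) that by (intro sum.cong) (auto simp: orthonormal_def)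
    thus ?thesis using that by simp
  qed
  have S_zero: "S x = 0 \<longleftrightarrow> (\<forall>j<n. cinner x (v j) = 0)" for x
    using wS[of _ x] by (auto simp: S_def)
  have norm_S: "(norm (S x))\<^sup>2 = (\<Sum>j<n. (cmod (cinner x (v j)))\<^sup>2)" for x
  proof -
    have "(\<Sum>j\<in>{..<n}. cinner (S x) (w j) *\<^sub>C w j) = S x"
      unfolding S_def using wS by (intro sum.cong) (auto simp: S_def)
    thus ?thesis
      using weakly_orthonormal_pythagoras[OF orthonormal_imp_weakly[OF w(1)], of "S x"] wS by simp
  qed
  have SW: "S x \<in> W" for x
    unfolding S_def using w(2) by (intro complex_vector.subspace_sum[OF W] complex_vector.subspace_scale[OF W]) auto
  show Sv: "S (v j) = w j" if "j < n" for j
  proof -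
    have "S (v j) = (\<Sum>i\<in>{..<n}. if i = j then w j else 0)"
      unfolding S_def using v(1) that by (intro sum.cong) (auto simp: orthonormal_def)
    thus ?thesis using that by simp
  qed
  show "partial_isometry_between V W S"
    unfolding partial_isometry_between_def
  proof (intro conjI)
    show "S ` V \<subseteq> W" using SW by blast
    have add: "S (x + y) = S x + S y" and scale: "S (c *\<^sub>C x) = c *\<^sub>C S x" for x y c
      by (simp_all add: S_def cinner_simps scaleC_add_left sum.distrib complex_vector.scale_sum_right scaleC_scaleC)
    show "\<forall>x\<in>V. \<forall>y\<in>V. S (x + y) = S x + S y" "\<forall>c. \<forall>x\<in>V. S (c *\<^sub>C x) = c *\<^sub>C S x"
      using add scale by auto
    have le: "norm (S x) \<le> norm x" for x
    proof -
      have "(norm (S x))\<^sup>2 \<le> (norm x)\<^sup>2"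
        using weakly_orthonormal_pythagoras[OF orthonormal_imp_weakly[OF v(1)], of x] by (simp add: norm_S)
      thus ?thesis by (rule power2_le_imp_le) simp
    qed
    thus "\<exists>K. \<forall>x\<in>V. norm (S x) \<le> K * norm x" by (intro exI[of _ 1]) simp
    show "\<forall>x\<in>V \<inter> ortho_compl (V \<inter> ker S). norm (S x) = norm x"
    proof
      fix x assume x: "x \<in> V \<inter> ortho_compl (V \<inter> ker S)"
      define s where "s = (\<Sum>j\<in>{..<n}. cinner x (v j) *\<^sub>C v j)"
      have o: "cinner (x - s) (v j) = 0" if "j < n" for j
        unfolding s_def using that by (intro weakly_orthonormal_residual orthonormal_imp_weakly v) auto
      have "s \<in> V" unfolding s_def
        using v(2) by (intro complex_vector.subspace_sum[OF V] complex_vector.subspace_scale[OF V]) auto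
      hence "x - s \<in> V \<inter> ker S" using x o S_zero complex_vector.subspace_diff[OF V] by (auto simp: ker_def)
      hence "cinner x (x - s) = 0" using x by (auto simp: ortho_compl_def)
      moreover have "cinner (x - s) s = 0"
        using o by (subst (2) s_def) (simp add: cinner_sum_right cinner_scaleC_right)
      hence "cinner s (x - s) = 0" by (simp add: cinner_commute_zero[of s])
      ultimately have "cinner (x - s) (x - s) = 0" by (simp only: cinner_diff_left[of x s "x - s"] diff_zero)
      hence "norm (x - s) = 0" by (simp add: cinner_self)
      moreover have "(norm x)\<^sup>2 = (\<Sum>j<n. (cmod (cinner x (v j)))\<^sup>2) + (norm (x - s))\<^sup>2"
        unfolding s_def by (rule weakly_orthonormal_pythagoras[OF orthonormal_imp_weakly[OF v(1)]]) simp
      ultimately have "(norm x)\<^sup>2 = (norm (S x))\<^sup>2" by (simp only: norm_S) simp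
      thus "norm (S x) = norm x" by (simp add: power2_eq_iff_nonneg)
    qed
  qed
  have sub: "w ` {..<n} \<subseteq> S ` V" using Sv v(2) by (force simp: image_iff)
  have span: "S ` V \<subseteq> cspan (w ` {..<n})"
    unfolding S_def
    by (intro image_subsetI complex_vector.span_sum complex_vector.span_scale complex_vector.span_base imageI)
  note ind = orthonormal_independent[OF w(1) finite_lessThan]
  have "cdim (S ` V) = n"
    using complex_vector.basis_card_eq_dim[OF sub span ind(2)] card_image[OF ind(1)] by simp
  moreover have "finite_cdim (S ` V)" unfolding finite_cdim_def using span by blast
  ultimately show "ecdim (S ` V) = enat n" by (simp add: ecdim_def)
qed

lemma orthonormal_scaleC: "orthonormal w J \<Longrightarrow> cmod c = 1 \<Longrightarrow> orthonormal (\<lambda>j. c *\<^sub>C w j) J"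
  using complex_norm_square[of c] by (auto simp: orthonormal_def cinner_simps mult.commute)

lemma infinite_unit_complex: "infinite {c :: complex. cmod c = 1}"
proof -
  define g where "g t = Complex t (sqrt (1 - t\<^sup>2))" for t
  have "inj_on g {0..1}" by (auto simp: inj_on_def g_def)
  moreover have "g ` {0..1} \<subseteq> {c. cmod c = 1}"
    by (auto simp: g_def cmod_def power_le_one)
  moreover have "infinite {0..1 :: real}" by (simp add: infinite_Icc)
  ultimately show ?thesis using finite_subset finite_imageD by blast
qed

section \<open>Symmetric approximations of negative index\<close>

theorem theorem4p8:
  fixes f :: "nat \<Rightarrow> 'a :: complex_hilbert"
    and K :: "'a set"
    and F U :: "ell2 \<Rightarrow> 'a"
    and A :: "ell2 \<Rightarrow> ell2"
    and k :: int
  assumes infinite_dim: "ecdim (UNIV :: 'a set) = \<infinity>"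
    and separable: "separable_space (euclidean :: 'a topology)"
    and frame: "frame_in K f"
    and close: "\<exists>x M. parseval_frame_in M x \<and> quadratically_close f x"
    and F: "F = synthesis f"
    and polar: "polar_decomposition F U A"
    and n1: "ecdim (ker F) > 0"
    and n3: "ecdim (ortho_compl K) > 0"
    and k_neg: "k \<le> - 1"
    and k_ge: "enat (nat (- k)) \<le> min (ecdim (ker F)) (ecdim (ortho_compl K))"
  shows
    "(\<forall>S. partial_isometry_between (ker F) (ortho_compl (range F)) S \<and>
           ecdim (S ` ker F) = enat (nat (- k)) \<longrightarrow>
        (\<forall>x \<in> close_parseval_frames_index f U k.
           (\<Sum>i. ennreal ((norm (f i - U (unit_vec i)
                     - S (unit_vec i - cadjoint U (U (unit_vec i)))))\<^sup>2))
             \<le> (\<Sum>i. ennreal ((norm (f i - x i))\<^sup>2)))) \<and>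
     infinite {y. symmetric_approximation f (close_parseval_frames_index f U k) y} \<and>
     {y. symmetric_approximation f (close_parseval_frames_index f U k) y} =
       {(\<lambda>i. U (unit_vec i) + S (unit_vec i - cadjoint U (U (unit_vec i)))) | S.
          partial_isometry_between (ker F) (ortho_compl (range F)) S \<and>
          ecdim (S ` ker F) = enat (nat (- k))}"
proof -
  obtain a b where ab: "a > 0" "b > 0" "frame_with_bounds a b K f"
    using frame unfolding frame_in_def by blast
  note syn = frame_synthesis[OF ab(3,2), folded F]
  interpret frame_polar_decomposition F U A K a
    using ab syn polar by unfold_locales (auto simp: frame_with_bounds_def)
  define n where "n = nat (- k)"
  have n: "n > 0" "int n = - k" using k_neg by (auto simp: n_def)
  define Qk where "Qk = close_parseval_frames_index f U k"
  define good where "good S \<longleftrightarrow> partial_isometry_between (ker F) (ortho_compl (range F)) S \<and>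
    ecdim (S ` ker F) = enat n" for S :: "ell2 \<Rightarrow> 'a"
  define y where "y S i = U (unit_vec i) + S (unit_vec i - P (unit_vec i))" for S :: "ell2 \<Rightarrow> 'a" and i
  \<comment> \<open>The minimal value of the squared distance.\<close>
  define d where "d = hs_sq (\<lambda>x. F x - U x) + real n"

  have close_frame: "bounded_clinear (synthesis x)" "synthesis x (unit_vec i) = x i"
    "is_projection (\<lambda>z. cadjoint (synthesis x) (synthesis x z))"
    "hilbert_schmidt (\<lambda>z. F z - synthesis x z)" "sqdist f x = ennreal (hs_sq (\<lambda>z. F z - synthesis x z))"
    if x: "parseval_frame_in M x" "quadratically_close f x" for x M i
  proof -
    have fr: "frame_with_bounds 1 1 M x" using x(1) by (simp add: parseval_frame_in_def)
    note xs = frame_synthesis[OF fr zero_less_one]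
    show "bounded_clinear (synthesis x)" "synthesis x (unit_vec i) = x i" by (rule xs)+
    show "is_projection (\<lambda>z. cadjoint (synthesis x) (synthesis x z))"
      by (rule parseval_frame_projection[OF x(1)])
    have "hs_ennreal (\<lambda>z. F z - synthesis x z) = sqdist f x"
      by (simp only: hs_ennreal_def sqdist_def xs(2) syn(2))
    thus hs: "hilbert_schmidt (\<lambda>z. F z - synthesis x z)"
      and "sqdist f x = ennreal (hs_sq (\<lambda>z. F z - synthesis x z))"
      using x(2) hs_ennreal_eq[of "\<lambda>z. F z - synthesis x z"]
      by (auto simp: quadratically_close_def hilbert_schmidt_iff)
  qed
  have hsFU: "hilbert_schmidt (\<lambda>x. F x - U x)"
  proof -
    obtain x M where x: "parseval_frame_in M x" "quadratically_close f x" using close by blast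
    show ?thesis
      by (rule hilbert_schmidt_F_diff_U[OF is_adjoint_cadjoint[OF close_frame(1)[OF x]] close_frame(3,4)[OF x]])
  qed
  have d0: "d \<ge> 0" using hs_sq_nonneg[OF hsFU] by (simp add: d_def)

  have in_Qk: "(\<exists>M. parseval_frame_in M x) \<and> quadratically_close f x \<and>
      fredholm_pair P (\<lambda>z. cadjoint (synthesis x) (synthesis x z)) \<and>
      pair_index P (\<lambda>z. cadjoint (synthesis x) (synthesis x z)) = k \<longleftrightarrow> x \<in> Qk" for x
    unfolding Qk_def close_parseval_frames_index_def close_parseval_frames_def by (simp add: Let_def o_def)

  have lower: "ennreal d \<le> sqdist f x" if x_in: "x \<in> Qk" for x
  proof -
    obtain M where x: "parseval_frame_in M x" "quadratically_close f x"
      "pair_index P (\<lambda>z. cadjoint (synthesis x) (synthesis x z)) = k" 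
      using x_in unfolding in_Qk[symmetric] by blast
    note cf = close_frame[OF x(1,2)]
    have "d \<le> hs_sq (\<lambda>z. F z - synthesis x z)"
      using distance_lower_bound(1)[OF is_adjoint_cadjoint[OF cf(1)] cf(3,4)] x(3) n(2) by (simp add: d_def)
    thus ?thesis by (simp add: cf(5) ennreal_leI)
  qed

  have attained: "y S \<in> Qk \<and> sqdist f (y S) = ennreal d" if S: "good S" for S
  proof -
    have pS: "partial_isometry_between (ker F) (ortho_compl (range F)) S" "ecdim (S ` ker F) = enat n"
      using S by (auto simp: good_def)
    define Y where "Y = (\<lambda>x. U x + S (x - P x))"
    have Yx: "U x + S (x - P x) = Y x" for x by (simp add: Y_def)
    note ext = extended_partial_isometry[OF pS, folded Y_def, unfolded Yx]
    note Yb = ext(1)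
    have synY: "synthesis (y S) = Y" by (rule synthesis_eq[OF Yb]) (simp add: y_def Y_def)
    have "parseval_frame_in (range Y) (\<lambda>i. Y (unit_vec i))"
      by (rule parseval_frame_of_partial_isometry[OF is_adjoint_cadjoint[OF Yb] ext(2)])
    hence pY: "parseval_frame_in (range Y) (y S)" by (simp add: y_def[abs_def] Y_def)
    have "hs_ennreal (\<lambda>x. F x - Y x) = sqdist f (y S)"
      by (simp add: hs_ennreal_def sqdist_def syn(2) y_def Y_def)
    hence dist: "sqdist f (y S) = ennreal d"
      using hs_ennreal_eq[OF ext(5)[OF hsFU]] ext(6)[OF hsFU] by (simp add: d_def)
    have "quadratically_close f (y S)" using dist by (simp add: quadratically_close_def)
    moreover have "fredholm_pair P (\<lambda>z. cadjoint Y (Y z))" "pair_index P (\<lambda>z. cadjoint Y (Y z)) = k"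
      using ext(3,4) n(2) by simp_all
    ultimately have "y S \<in> Qk" unfolding in_Qk[symmetric] synY using pY by blast
    thus ?thesis using dist by blast
  qed

  have unique: "\<exists>S. good S \<and> x = y S" if x: "x \<in> Qk" "sqdist f x \<le> ennreal d" for x
  proof -
    obtain M where M: "parseval_frame_in M x" "quadratically_close f x"
      "pair_index P (\<lambda>z. cadjoint (synthesis x) (synthesis x z)) = k" 
      using x(1) unfolding in_Qk[symmetric] by blast
    define X where "X = synthesis x"
    note cf = close_frame[OF M(1,2), folded X_def] and idx = M(3)[folded X_def]
    note Xa = is_adjoint_cadjoint[OF cf(1)]
    have "hs_sq (\<lambda>z. F z - X z) \<le> d" using x(2) d0 by (simp add: cf(5) ennreal_le_iff)
    hence XP: "X (P z) = U z" for z
      using distance_lower_bound(2)[OF Xa cf(3,4)] idx n(2) by (simp add: d_def)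
    have "hilbert_schmidt (\<lambda>z. P z - cadjoint X (X z))"
    proof -
      have "hilbert_schmidt (\<lambda>z. (F z - X z) - (F z - U z))"
        by (rule hilbert_schmidt_diff(1)[OF cf(4) hsFU])
      hence "hilbert_schmidt (\<lambda>z. U z - X z)" by simp
      thus ?thesis by (rule hilbert_schmidt_projection_difference[OF Xa])
    qed
    hence "hilbert_schmidt (\<lambda>z. cadjoint X (X z) - P z)"
      by (simp add: hilbert_schmidt_def norm_minus_commute)
    hence "finite_cdim (range (\<lambda>z. cadjoint X (X z)) \<inter> ker P)"
      using projection_pair_powers_tendsto(1)[OF cf(3) projection_P] by (simp add: Int_commute)
    note restr = restriction_partial_isometry[OF Xa cf(3) XP this]
    have "good X" using restr(1,2) idx by (simp add: good_def n_def)
    moreover have "x = y X"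
    proof
      fix i show "x i = y X i" unfolding y_def cf(2)[of i, symmetric] by (rule restr(3))
    qed
    ultimately show ?thesis by blast
  qed

  have "range F \<subseteq> K" using syn(3) by blast
  hence "ortho_compl K \<subseteq> ortho_compl (range F)" by (auto simp: ortho_compl_def)
  have "enat n \<le> ecdim (ker F)" "enat n \<le> ecdim (ortho_compl K)" using k_ge by (auto simp: n_def)
  then obtain v w where v: "orthonormal v {..<n}" "v ` {..<n} \<subseteq> ker F"
    and w: "orthonormal w {..<n}" "w ` {..<n} \<subseteq> ortho_compl K"
    using orthonormal_family_exists[OF csubspace_ker[OF syn(1)]]
      orthonormal_family_exists[OF csubspace_ortho_compl] by metis
  \<comment> \<open>The unit factor \<open>c\<close> produces infinitely many partial isometries, with different frames.\<close>
  define S where "S c x = (\<Sum>j\<in>{..<n}. cinner x (v j) *\<^sub>C c *\<^sub>C w j)" for c :: complex and x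
  have good_S: "good (S c)" and S_v: "S c (v 0) = c *\<^sub>C w 0" if c: "cmod c = 1" for c
  proof -
    have "(\<lambda>j. c *\<^sub>C w j) ` {..<n} \<subseteq> ortho_compl (range F)"
      using w(2) \<open>ortho_compl K \<subseteq> ortho_compl (range F)\<close>
        complex_vector.subspace_scale[OF csubspace_ortho_compl] by blast
    note iso = orthonormal_partial_isometry[OF csubspace_ker[OF syn(1)] csubspace_ortho_compl v
        orthonormal_scaleC[OF w(1) c] this]
    show "good (S c)" using iso(1,2) by (simp add: good_def S_def[abs_def])
    show "S c (v 0) = c *\<^sub>C w 0" using iso(3)[OF n(1)] by (simp add: S_def)
  qed
  have "inj_on (\<lambda>c. y (S c)) {c. cmod c = 1}"
  proof (rule inj_onI)
    fix c c' :: complex assume c: "c \<in> {c. cmod c = 1}" "c' \<in> {c. cmod c = 1}" and eq: "y (S c) = y (S c')"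
    have Zb: "bounded_clinear (\<lambda>x. S c (x - P x))" "bounded_clinear (\<lambda>x. S c' (x - P x))"
      using good_S c partial_isometry_on_kernel(1) by (auto simp: good_def)
    have "(\<lambda>x. S c (x - P x)) = (\<lambda>x. S c' (x - P x))"
      by (rule bounded_clinear_eqI[OF Zb]) (use fun_cong[OF eq] in \<open>simp add: y_def\<close>)
    moreover have "v 0 \<in> ker F" using v(2) n(1) by auto
    hence "P (v 0) = 0" using F_zero_iff by (simp add: ker_def)
    ultimately have "S c (v 0) = S c' (v 0)" by (auto dest: fun_cong[of _ _ "v 0"])
    hence "(c - c') *\<^sub>C w 0 = 0" using S_v c by (simp add: complex_vector.scale_left_diff_distrib)
    moreover have "w 0 \<noteq> 0" using orthonormal_norm[OF w(1), of 0] n(1) by auto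
    ultimately show "c = c'" by (simp add: complex_vector.scale_eq_0_iff)
  qed
  hence inf: "infinite ((\<lambda>c. y (S c)) ` {c. cmod c = 1})"
    using infinite_unit_complex finite_imageD by blast

  have best: "symmetric_approximation f Qk x \<longleftrightarrow> x \<in> Qk \<and> sqdist f x \<le> ennreal d" for x
  proof
    assume "symmetric_approximation f Qk x"
    thus "x \<in> Qk \<and> sqdist f x \<le> ennreal d"
      using attained[OF good_S[of 1]] unfolding symmetric_approximation_def by (metis norm_one)
  next
    assume "x \<in> Qk \<and> sqdist f x \<le> ennreal d"
    thus "symmetric_approximation f Qk x"
      unfolding symmetric_approximation_def using lower
      by (auto intro: order_trans le_less_trans[of _ "ennreal d"])
  qed
  have set_eq: "{x. symmetric_approximation f Qk x} = {y S | S. good S}"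
    unfolding best using attained unique by fastforce
  have "(\<lambda>c. y (S c)) ` {c. cmod c = 1} \<subseteq> {x. symmetric_approximation f Qk x}"
    unfolding set_eq using good_S by blast
  hence "infinite {x. symmetric_approximation f Qk x}" using inf infinite_super by blast
  moreover have "\<forall>S. good S \<longrightarrow> (\<forall>x\<in>Qk. (\<Sum>i. ennreal ((norm (f i - U (unit_vec i) - S (unit_vec i - P (unit_vec i))))\<^sup>2))
      \<le> (\<Sum>i. ennreal ((norm (f i - x i))\<^sup>2)))"
  proof (intro allI impI ballI)
    fix S x assume "good S" "x \<in> Qk"
    hence "sqdist f (y S) \<le> sqdist f x" using attained lower by simp
    thus "(\<Sum>i. ennreal ((norm (f i - U (unit_vec i) - S (unit_vec i - P (unit_vec i))))\<^sup>2))
      \<le> (\<Sum>i. ennreal ((norm (f i - x i))\<^sup>2))"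
      by (simp only: sqdist_def y_def diff_diff_eq)
  qed
  ultimately show ?thesis
    using set_eq unfolding Qk_def good_def y_def[abs_def] n_def by (intro conjI)
qed

end
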